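(* Let $\lambda>0$, $\beta>0$, $\epsilon>0$ and a positive integer $\gamma$ be fixed with $0<\epsilon<\gamma^2\beta/4$. For each $r>0$ let $(Y^r,X^r)$ be the continuous-time Markov chain described in the context, with arrival rate $\lambda r$, and let $(\bar Y^r,\bar X^r)=r^{-1}(Y^r, X^r-\lambda r/\beta)$. Suppose the initial states are deterministic and $(\bar Y^r(0),\bar X^r(0))\to (y(0),x(0))$ as $r\to\infty$, for some fixed $(y(0),x(0))\in\mathbb{R}^2$ with $x(0)\ge -\lambda/\beta$. Then these processes can be constructed on a common probability space such that the following holds: there exists a unique locally Lipschitz trajectory $(y,x)=((y(t),x(t)),\,t\ge 0)$ such that, with probability $1$, $$(\bar Y^r,\bar X^r)\to (y,x)\quad\text{uniformly on compact subsets of }[0,\infty)\text{ as } r\to\infty,$$ where $x(t)\ge -\lambda/\beta$ for all $t\ge 0$, and at every regular point $t\ge 0$ (all $t\ge0$ except a set of zero Lebesgue measure are regular) the following holds: if $x(t)>-\lambda/\beta$ then $$y'(t)=\beta x(t),\qquad x'(t)=-\gamma\beta x(t)-\epsilon y(t),$$ and if $x(t)=-\lambda/\beta$ then $$y'(t)=-\lambda,\qquad x'(t)=[\gamma\lambda-\epsilon y(t)]\vee 0 .$$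
   Context: Model: For scaling parameter $r>0$, the process $(Y^r(t),X^r(t))$, $t\ge0$, is a continuous-time Markov chain on $\mathbb{Z}\times\mathbb{Z}_+$ ($Y^r$ = agent queue minus customer queue, $X^r$ = number of pending invited agents) whose transitions from state $(Y,X)$ are: (i) at rate $\lambda r$ (customer arrival): $Y\mapsto Y-1$, $X\mapsto X+\gamma$; (ii) at rate $\beta X$ (invitation acceptance): $Y\mapsto Y+1$, $X\mapsto X-(\gamma\wedge X)$; (iii) at rate $\epsilon|Y|$: if $X\ge1$, $X\mapsto X-\mathrm{sgn}(Y)$ ($Y$ unchanged); if $X=0$, $X\mapsto X+1$ when $Y<0$ and no change when $Y\ge0$. Here $\mathrm{sgn}(z)=1,0,-1$ for $z>0$, $z=0$, $z<0$. Notation: $a\vee b=\max\{a,b\}$, $a\wedge b=\min\{a,b\}$. A point $t$ is called regular (for the pair of functions $y,x$) if for every nonempty subset of $\{y,x\}$ the derivatives of the pointwise maximum and of the pointwise minimum over that subset exist at $t$ (both one-sided derivatives exist and are equal). *)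

theory Defs
  imports "HOL-Probability.Probability"
begin

type_synonym state = "int \<times> nat"

text \<open>Transitions of the chain from state (Y,X): list of (rate, target state).
  Parameters: lam beta eps gam r.  A "no change" transition is given target = current state.\<close>
definition transitions :: "real \<Rightarrow> real \<Rightarrow> real \<Rightarrow> nat \<Rightarrow> real \<Rightarrow> state \<Rightarrow> (real \<times> state) list" where
  "transitions lam beta eps gam r s = (case s of (Y, X) \<Rightarrow>
     [(lam * r, (Y - 1, X + gam)),
      (beta * real X, (Y + 1, X - min gam X)),
      (eps * real_of_int \<bar>Y\<bar>,
         (if X \<ge> 1 then (Y, nat (int X - sgn Y))
          else if Y < 0 then (Y, X + 1) else (Y, X)))])"

definition jrate :: "(state \<Rightarrow> (real \<times> state) list) \<Rightarrow> state \<Rightarrow> state \<Rightarrow> real" where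
  "jrate tr s s' = (if s' = s then 0 else sum_list (map fst (filter (\<lambda>p. snd p = s') (tr s))))"

definition jtotal :: "(state \<Rightarrow> (real \<times> state) list) \<Rightarrow> state \<Rightarrow> real" where
  "jtotal tr s = sum_list (map fst (filter (\<lambda>p. snd p \<noteq> s) (tr s)))"

text \<open>Continuous-time Markov chain with transition structure tr started at z0, in the
  jump chain / holding time description (Norris): the jump chain J and holding times S
  have the joint law P(J 0 = s0, ..., J n = sn, S 0 > u0, ..., S (n-1) > u(n-1))
  = [s0 = z0] * prod (q(s_k,s_(k+1))/q(s_k)) exp(-q(s_k) u_k), and Z t = J n on
  the n-th holding interval.\<close>
definition is_ctmc :: "'w measure \<Rightarrow> (state \<Rightarrow> (real \<times> state) list) \<Rightarrow> state \<Rightarrow> (real \<Rightarrow> 'w \<Rightarrow> state) \<Rightarrow> bool" where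
  "is_ctmc M tr z0 Z \<longleftrightarrow>
    (\<exists>(J :: nat \<Rightarrow> 'w \<Rightarrow> state) (S :: nat \<Rightarrow> 'w \<Rightarrow> real).
      (\<forall>n. J n \<in> measurable M (count_space UNIV)) \<and>
      (\<forall>n. S n \<in> borel_measurable M) \<and>
      (\<forall>t\<ge>0. Z t \<in> measurable M (count_space UNIV)) \<and>
      (\<forall>n (s :: nat \<Rightarrow> state) (u :: nat \<Rightarrow> real). (\<forall>k<n. u k \<ge> 0) \<longrightarrow>
         measure M {\<omega> \<in> space M. (\<forall>k\<le>n. J k \<omega> = s k) \<and> (\<forall>k<n. S k \<omega> > u k)} =
         (if s 0 = z0 then 1 else 0) *
           (\<Prod>k<n. (jrate tr (s k) (s (Suc k)) / jtotal tr (s k)) * exp (- jtotal tr (s k) * u k))) \<and>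
      (\<forall>\<omega> n t. (\<Sum>k<n. S k \<omega>) \<le> t \<and> t < (\<Sum>k<Suc n. S k \<omega>) \<longrightarrow> Z t \<omega> = J n \<omega>))"

definition regular_point :: "(real \<Rightarrow> real) \<Rightarrow> (real \<Rightarrow> real) \<Rightarrow> real \<Rightarrow> bool" where
  "regular_point y x t \<longleftrightarrow>
     y differentiable (at t) \<and> x differentiable (at t) \<and>
     (\<lambda>s. max (y s) (x s)) differentiable (at t) \<and>
     (\<lambda>s. min (y s) (x s)) differentiable (at t)"

definition fluid_solution :: "real \<Rightarrow> real \<Rightarrow> real \<Rightarrow> nat \<Rightarrow> real \<Rightarrow> real \<Rightarrow> (real \<Rightarrow> real) \<Rightarrow> (real \<Rightarrow> real) \<Rightarrow> bool" where
  "fluid_solution lam beta eps gam y0 x0 y x \<longleftrightarrow>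
     y 0 = y0 \<and> x 0 = x0 \<and>
     (\<forall>T\<ge>0. \<exists>L. L-lipschitz_on {0..T} y \<and> L-lipschitz_on {0..T} x) \<and>
     (\<forall>t\<ge>0. x t \<ge> - lam / beta) \<and>
     (\<forall>t>0. regular_point y x t \<longrightarrow>
        (x t > - lam / beta \<longrightarrow>
           (y has_real_derivative beta * x t) (at t) \<and>
           (x has_real_derivative (- real gam * beta * x t - eps * y t)) (at t)) \<and>
        (x t = - lam / beta \<longrightarrow>
           (y has_real_derivative - lam) (at t) \<and>
           (x has_real_derivative max (real gam * lam - eps * y t) 0) (at t)))"

end

theory Submission
  imports Defs
begin

text \<open>
  All chains are driven by the same four sequences of independent exponential clocks: a transition
  type with current rate \<open>\<rho>\<close> runs its clock at speed \<open>\<rho>\<close>, and the clock that rings first determines the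
  next jump. By memorylessness this yields the prescribed jump chain and holding times for every \<open>r\<close>,
  while the strong law of large numbers for the clocks, a single event of probability one, controls all
  \<open>r\<close> simultaneously. On that event the number of transitions of each type differs by \<open>o(r)\<close> from
  the integral of its rate, so the scaled chain (with \<open>X/r\<close> not yet centred) solves up to a small error
  the integral equations \<open>Y = a + \<integral>(\<beta>X - \<lambda>)\<close> and \<open>X = F + sup (-F)\<^sup>+\<close> with
  \<open>F = b + \<integral>(\<gamma>\<lambda> - \<gamma>\<beta>X - \<epsilon>Y)\<close>; the running supremum is the Skorokhod regulator that keeps
  \<open>X\<close> nonnegative. Gronwall's inequality shows that approximate solutions are close to each other.
  Hence the scaled chains form a Cauchy family, which gives existence of the exact solution and
  convergence to it. Uniqueness in the class of locally Lipschitz trajectories rests on the almost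
  everywhere differentiability of Lipschitz functions and on the energy
  \<open>(y\<^sub>1 - y\<^sub>2)\<^sup>2 + (x\<^sub>1 - x\<^sub>2)\<^sup>2\<close>.
\<close>

section \<open>Lipschitz functions of a real variable\<close>

text \<open>The drift of \<open>X\<close> jumps at the boundary, so the differential conditions
  alone give no Lipschitz estimate. The integral form does: the running supremum is 1-Lipschitz in
  the uniform norm, so reflection costs only a factor 2 in one Gronwall constant. Existence then
  needs no iteration scheme, since a single sample point of the good event supplies approximate
  solutions of every accuracy on every bounded interval. A competitor in the uniqueness claim
  satisfies the differential conditions at regular points only; it is never rewritten as a reflected
  integral equation. Instead, the boundary correction can only push up the lower of two
  trajectories, so it enters the derivative of the energy with a favourable sign. The rates are
  unbounded in the state, whereas the law of large numbers is uniform only over \<open>O(r)\<close>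
  rings. Bounds of order \<open>r\<close> on all counts must therefore come first, from a cruder
  estimate that holds for every number of rings. Once a sample point is fixed everything is
  deterministic, which is why \<open>r\<close> may run through a continuum without a union of
  uncountably many null sets.\<close>

lemma expanding_continuous_bij:
  fixes F :: "real \<Rightarrow> real"
  assumes cont: "continuous_on UNIV F" and incr: "\<And>a b. a \<le> b \<Longrightarrow> b - a \<le> F b - F a"
  shows "bij F"
proof -
  have mono: "strict_mono F"
  proof (rule strict_monoI)
    fix a b :: real assume "a < b" then show "F a < F b" using incr[of a b] by linarith
  qed
  have "\<exists>x. F x = y" for y
  proof -
    define b where "b = \<bar>y - F 0\<bar>"
    have "F (-b) \<le> y" "y \<le> F b" using incr[of "-b" 0] incr[of 0 b] unfolding b_def by linarith+
    moreover have "-b \<le> b" by (simp add: b_def)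
    ultimately show ?thesis
      using IVT'[of F "-b" y b] continuous_on_subset[OF cont] by blast
  qed
  then have "surj F" unfolding surj_def by metis
  with mono show ?thesis unfolding bij_def using strict_mono_imp_inj_on by blast
qed

text \<open>Push Lebesgue measure forward along the inverse of \<open>F\<close>: the new measure of
  a set is the length of its image under \<open>F\<close>. Lipschitz maps preserve null sets, so
  this measure is absolutely continuous, and its Radon-Nikodym density is the required
  integrand.\<close>

lemma increasing_lipschitz_density:
  fixes F :: "real \<Rightarrow> real"
  assumes lip: "K-lipschitz_on UNIV F" and incr: "\<And>a b. a \<le> b \<Longrightarrow> b - a \<le> F b - F a"
  obtains g :: "real \<Rightarrow> real" where "\<And>a b. a \<le> b \<Longrightarrow> (g has_integral (F b - F a)) {a..b}"
proof -
  have cont: "continuous_on UNIV F" using lip by (rule lipschitz_on_continuous_on)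
  have bij: "bij F" using expanding_continuous_bij[OF cont incr] by blast
  have mono: "a \<le> b \<longleftrightarrow> F a \<le> F b" for a b
    using incr[of a b] incr[of b a] by linarith
  define \<psi> where "\<psi> = inv F"
  have F\<psi>: "F (\<psi> y) = y" for y unfolding \<psi>_def using bij by (simp add: bij_def surj_f_inv_f)
  have mono\<psi>: "mono \<psi>" by (rule monoI) (subst mono, simp add: F\<psi>)
  have [measurable]: "\<psi> \<in> borel_measurable borel" by (rule borel_measurable_mono[OF mono\<psi>])
  have vim: "\<psi> -` A = F ` A" for A
    using bij unfolding \<psi>_def by (simp add: bij_vimage_eq_inv_image inv_inv_eq bij_imp_bij_inv)
  define \<mu> where "\<mu> = distr lborel borel \<psi>"
  have ac: "absolutely_continuous lborel \<mu>"
    unfolding absolutely_continuous_def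
  proof
    fix A :: "real set" assume A: "A \<in> null_sets lborel"
    then have "negligible A" by (simp add: negligible_iff_null_sets null_sets_completionI)
    have "negligible (F ` A)"
    proof (rule negligible_locally_Lipschitz_image[OF _ \<open>negligible A\<close>])
      fix x assume "x \<in> A"
      show "\<exists>T B. open T \<and> x \<in> T \<and> (\<forall>y\<in>A \<inter> T. norm (F y - F x) \<le> B * norm (y - x))"
        using lip by (intro exI[of _ UNIV] exI[of _ K]) (auto simp: lipschitz_on_def dist_norm)
    qed auto
    then have "emeasure lebesgue (F ` A) = 0" by (simp add: negligible_iff_null_sets null_setsD1)
    moreover have "F ` A \<in> sets borel"
      using measurable_sets[of \<psi> borel borel A] A by (auto simp: vim null_sets_def)
    ultimately have "emeasure lborel (F ` A) = 0" by simp
    then show "A \<in> null_sets \<mu>"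
      using A by (auto simp: null_sets_def \<mu>_def emeasure_distr vim)
  qed
  obtain h where h[measurable]: "h \<in> borel_measurable lborel" and dens: "density lborel h = \<mu>"
    using sigma_finite_measure.Radon_Nikodym[OF sigma_finite_lborel ac] by (auto simp: \<mu>_def)
  have int: "(\<integral>\<^sup>+x. h x * indicator {a..b} x \<partial>lborel) = ennreal (F b - F a)" if "a \<le> b" for a b
  proof -
    have "(\<integral>\<^sup>+x. h x * indicator {a..b} x \<partial>lborel) = emeasure \<mu> {a..b}"
      by (simp add: dens[symmetric] emeasure_density)
    also have "\<dots> = emeasure lborel (F ` {a..b})" by (simp add: \<mu>_def emeasure_distr vim)
    also have "F ` {a..b} = {F a..F b}"
      unfolding vim[symmetric]
      by (simp add: set_eq_iff mono[of a] mono[of _ b] F\<psi>)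
    also have "emeasure lborel \<dots> = ennreal (F b - F a)"
      using mono that by simp
    finally show ?thesis .
  qed
  define g where "g x = enn2real (h x)" for x
  have [measurable]: "g \<in> borel_measurable borel" using h unfolding g_def by simp
  have "(g has_integral (F b - F a)) {a..b}" if "a \<le> b" for a b
  proof -
    \<comment> \<open>The density may be infinite, but only on a null set, because its integral over
      \<open>{a..b}\<close> is finite; passing to \<open>enn2real\<close> does not change the
      integral.\<close>
    have "AE x in lborel. h x * indicator {a..b} x \<noteq> \<infinity>"
      by (rule nn_integral_PInf_AE) (auto simp: int[OF that])
    then have "(\<integral>\<^sup>+x. ennreal (g x * indicator {a..b} x) \<partial>lborel) = (\<integral>\<^sup>+x. h x * indicator {a..b} x \<partial>lborel)"
      by (intro nn_integral_cong_AE) (auto simp: g_def indicator_def less_top)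
    then have "(\<integral>\<^sup>+x. ennreal (g x * indicator {a..b} x) \<partial>lborel) = ennreal (F b - F a)"
      using int[OF that] by simp
    then have "((\<lambda>x. g x * indicator {a..b} x) has_integral (F b - F a)) UNIV"
      using mono[of a b] that
      by (intro nn_integral_has_integral) (auto simp: g_def)
    then have "((\<lambda>x. if x \<in> {a..b} then g x else 0) has_integral (F b - F a)) UNIV"
      by (rule has_integral_eq_rhs[OF has_integral_eq[rotated]]) (auto simp: indicator_def)
    then show ?thesis by (simp only: has_integral_restrict_UNIV)
  qed
  then show ?thesis by (rule that)
qed

text \<open>Averages over cubes with lower corner \<open>x\<close> converge to \<open>g x\<close>
  almost everywhere; in dimension one these are exactly the right difference quotients.\<close>

lemma indefinite_integral_ae_right_quotient:
  fixes f g :: "real \<Rightarrow> real"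
  assumes int: "\<And>a b. a \<le> b \<Longrightarrow> (g has_integral (f b - f a)) {a..b}"
  obtains N where "negligible N"
    and "\<And>t. t \<notin> N \<Longrightarrow> ((\<lambda>s. (f s - f t) / (s - t)) \<longlongrightarrow> g t) (at_right t)"
proof -
  have "g integrable_on cbox a b" for a b
    using int[of a b] by (cases "a \<le> b") auto
  then obtain N where N: "negligible N"
    and lim: "\<And>x e. \<lbrakk>x \<notin> N; 0 < e\<rbrakk> \<Longrightarrow> \<exists>d>0. \<forall>h. 0 < h \<and> h < d \<longrightarrow>
       norm (integral (cbox x (x + h *\<^sub>R One)) g /\<^sub>R h ^ DIM(real) - g x) < e"
    using integrable_ccontinuous_explicit[of g] by blast
  have "((\<lambda>s. (f s - f t) / (s - t)) \<longlongrightarrow> g t) (at_right t)" if "t \<notin> N" for t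
  proof (rule tendstoI)
    fix e :: real assume "0 < e"
    from lim[OF \<open>t \<notin> N\<close> this] obtain d where "d > 0"
      and d: "\<And>h. 0 < h \<Longrightarrow> h < d \<Longrightarrow> norm (integral (cbox t (t + h *\<^sub>R One)) g /\<^sub>R h ^ DIM(real) - g t) < e"
      by blast
    have "dist ((f s - f t) / (s - t)) (g t) < e" if "t < s" "s < t + d" for s
    proof -
      have "integral {t..s} g = f s - f t" using int[of t s] that by (simp add: integral_unique)
      then show ?thesis
        using d[of "s - t"] that by (simp add: dist_norm divide_inverse ac_simps)
    qed
    then show "\<forall>\<^sub>F s in at_right t. dist ((f s - f t) / (s - t)) (g t) < e"
      unfolding eventually_at_right_field using \<open>d > 0\<close> by (intro exI[of _ "t + d"]) auto
  qed
  with N show ?thesis by (rule that)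
qed

text \<open>Left quotients of \<open>f\<close> are right quotients of the reflected function, and
  reflection maps null sets to null sets.\<close>

lemma indefinite_integral_ae_derivative:
  fixes f g :: "real \<Rightarrow> real"
  assumes int: "\<And>a b. a \<le> b \<Longrightarrow> (g has_integral (f b - f a)) {a..b}"
  obtains N where "negligible N" "\<And>t. t \<notin> N \<Longrightarrow> (f has_real_derivative g t) (at t)"
proof -
  obtain N1 where N1: "negligible N1"
    and r: "\<And>t. t \<notin> N1 \<Longrightarrow> ((\<lambda>s. (f s - f t) / (s - t)) \<longlongrightarrow> g t) (at_right t)"
    using indefinite_integral_ae_right_quotient[OF int] by blast
  have "((\<lambda>x. g (- x)) has_integral (- f (- b)) - (- f (- a))) {a..b}" if "a \<le> b" for a b
    using int[of "-b" "-a"] that has_integral_reflect_real[of g _ "-a" "-b"] by simp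
  then obtain N2 where N2: "negligible N2"
    and l: "\<And>t. t \<notin> N2 \<Longrightarrow> ((\<lambda>s. (- f (- s) - - f (- t)) / (s - t)) \<longlongrightarrow> g (- t)) (at_right t)"
    using indefinite_integral_ae_right_quotient[of "\<lambda>x. g (- x)" "\<lambda>x. - f (- x)"] by blast
  have "negligible (uminus ` N2)"
    by (rule negligible_differentiable_image_negligible[OF _ N2])
      (auto intro!: derivative_intros simp: differentiable_on_def)
  then have "negligible (N1 \<union> uminus ` N2)" using N1 by simp
  moreover have "(f has_real_derivative g t) (at t)" if "t \<notin> N1 \<union> uminus ` N2" for t
  proof -
    have "- t \<notin> N2" using that by force
    then have "((\<lambda>s. (- f (- s) - - f t) / (s + t)) \<longlongrightarrow> g t) (at_right (- t))"
      using l[of "-t"] by simp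
    then have "((\<lambda>s. (- f s + f t) / (- s + t)) \<longlongrightarrow> g t) (at_left t)"
      unfolding filterlim_at_left_to_right[of _ _ t] by simp
    moreover have "(- f s + f t) / (- s + t) = (f s - f t) / (s - t)" for s
      by (metis minus_diff_eq minus_divide_divide uminus_add_conv_diff)
    ultimately have "((\<lambda>s. (f s - f t) / (s - t)) \<longlongrightarrow> g t) (at_left t)" by simp
    moreover have "((\<lambda>s. (f s - f t) / (s - t)) \<longlongrightarrow> g t) (at_right t)" using that r by simp
    ultimately show ?thesis
      unfolding has_field_derivative_iff by (simp add: filterlim_split_at)
  qed
  ultimately show ?thesis by (rule that)
qed

lemma lipschitz_ae_derivative:
  fixes f :: "real \<Rightarrow> real"
  assumes lip: "L-lipschitz_on UNIV f"
  obtains g N where "negligible N" "\<And>t. t \<notin> N \<Longrightarrow> (f has_real_derivative g t) (at t)"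
    and "\<And>a b. a \<le> b \<Longrightarrow> (g has_integral (f b - f a)) {a..b}"
proof -
  \<comment> \<open>The slope \<open>L + 1\<close> outweighs the steepest possible descent of
    \<open>f\<close> and leaves a slope of at least 1, as the density lemma demands.\<close>
  define F where "F x = f x + (L + 1) * x" for x
  have L: "\<bar>f b - f a\<bar> \<le> L * \<bar>b - a\<bar>" for a b
    using lip by (simp add: lipschitz_on_def dist_real_def)
  have "L \<ge> 0" using lip by (simp add: lipschitz_on_def)
  have "(L + (L + 1))-lipschitz_on UNIV F"
    unfolding F_def using \<open>L \<ge> 0\<close>
    by (intro lipschitz_on_add lip) (auto simp: lipschitz_on_def dist_real_def abs_mult simp flip: right_diff_distrib)
  moreover have "b - a \<le> F b - F a" if "a \<le> b" for a b
    using L[of a b] that by (simp add: F_def algebra_simps) 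
  ultimately obtain g where g: "\<And>a b. a \<le> b \<Longrightarrow> (g has_integral (F b - F a)) {a..b}"
    using increasing_lipschitz_density by blast
  have int: "((\<lambda>x. g x - (L + 1)) has_integral (f b - f a)) {a..b}" if "a \<le> b" for a b
    using has_integral_diff[OF g[OF that] has_integral_const_real[of "L + 1" a b]] that
    by (simp add: F_def algebra_simps)
  obtain N where "negligible N" "\<And>t. t \<notin> N \<Longrightarrow> (f has_real_derivative g t - (L + 1)) (at t)"
    using indefinite_integral_ae_derivative[OF int] by metis
  then show ?thesis using int by (rule that)
qed

section \<open>Measurability of the set of differentiability points\<close>

text \<open>The Cauchy form removes the unknown derivative and leaves only countable quantifiers
  over \<open>n\<close> and \<open>k\<close> outside conditions on \<open>t\<close>, which is what a
  Borel argument needs.\<close>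

lemma differentiable_iff_Cauchy_quotient:
  fixes f :: "real \<Rightarrow> real" and t :: real
  defines "q \<equiv> \<lambda>h. (f (t + h) - f t) / h"
  shows "f differentiable (at t) \<longleftrightarrow>
    (\<forall>n::nat. \<exists>k::nat. \<forall>h h'. h \<noteq> 0 \<and> \<bar>h\<bar> < 1 / Suc k \<and> h' \<noteq> 0 \<and> \<bar>h'\<bar> < 1 / Suc k \<longrightarrow> \<bar>q h - q h'\<bar> \<le> 1 / Suc n)"
    (is "_ \<longleftrightarrow> ?C")
proof
  assume "f differentiable (at t)"
  then obtain D where "(f has_real_derivative D) (at t)"
    by (auto simp: real_differentiable_def)
  then have D: "q \<midarrow>0\<rightarrow> D" by (simp add: DERIV_def q_def)
  show ?C
  proof
    fix n :: nat
    define c where "c = 1 / (2 * real (Suc n))"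
    have c: "c > 0" "1 / Suc n = c + c" by (simp_all add: c_def field_simps)
    obtain s where "s > 0" and s: "\<And>h. h \<noteq> 0 \<Longrightarrow> \<bar>h\<bar> < s \<Longrightarrow> \<bar>q h - D\<bar> < c"
      using LIM_D[OF D c(1)] by auto
    obtain k where k: "1 / Suc k < s"
      using reals_Archimedean[OF \<open>s > 0\<close>] by (auto simp: inverse_eq_divide)
    have "\<bar>q h - q h'\<bar> \<le> 1 / Suc n" if "h \<noteq> 0" "\<bar>h\<bar> < 1 / Suc k" "h' \<noteq> 0" "\<bar>h'\<bar> < 1 / Suc k" for h h'
    proof -
      have "\<bar>q h - D\<bar> < c" "\<bar>q h' - D\<bar> < c"
        using s[of h] s[of h'] that k by linarith+
      then show ?thesis unfolding c(2) by linarith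
    qed
    then show "\<exists>k::nat. \<forall>h h'. h \<noteq> 0 \<and> \<bar>h\<bar> < 1 / Suc k \<and> h' \<noteq> 0 \<and> \<bar>h'\<bar> < 1 / Suc k \<longrightarrow> \<bar>q h - q h'\<bar> \<le> 1 / Suc n"
      by blast
  qed
next
  assume C: ?C
  define X where "X m = q (1 / Suc m)" for m
  have small: "\<bar>1 / Suc m\<bar> < 1 / Suc k" if "m > k" for m k :: nat
    using that by (simp add: frac_less2)
  have "Cauchy X"
  proof (rule CauchyI)
    fix e :: real assume "e > 0"
    then obtain n where n: "1 / Suc n < e" using reals_Archimedean by (auto simp: inverse_eq_divide)
    obtain k :: nat where k: "\<And>h h'. h \<noteq> 0 \<and> \<bar>h\<bar> < 1 / Suc k \<and> h' \<noteq> 0 \<and> \<bar>h'\<bar> < 1 / Suc k \<Longrightarrow> \<bar>q h - q h'\<bar> \<le> 1 / Suc n"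
      using C by metis
    have "norm (X m - X m') < e" if "m \<ge> Suc k" "m' \<ge> Suc k" for m m'
      using k[of "1 / Suc m" "1 / Suc m'"] small[of k m] small[of k m'] that n by (auto simp: X_def)
    then show "\<exists>M. \<forall>m\<ge>M. \<forall>m'\<ge>M. norm (X m - X m') < e" by blast
  qed
  then obtain D where D: "X \<longlonglongrightarrow> D" using Cauchy_convergent convergent_def by blast
  have "q \<midarrow>0\<rightarrow> D"
  proof (rule LIM_I)
    fix e :: real assume "e > 0"
    then obtain n where n: "1 / Suc n < e" using reals_Archimedean by (auto simp: inverse_eq_divide)
    obtain k :: nat where k: "\<And>h h'. h \<noteq> 0 \<and> \<bar>h\<bar> < 1 / Suc k \<and> h' \<noteq> 0 \<and> \<bar>h'\<bar> < 1 / Suc k \<Longrightarrow> \<bar>q h - q h'\<bar> \<le> 1 / Suc n"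
      using C by metis
    have "norm (q h - D) < e" if h: "h \<noteq> 0" "\<bar>h\<bar> < 1 / Suc k" for h
    proof -
      have "\<forall>m\<ge>Suc k. \<bar>q h - X m\<bar> \<le> 1 / Suc n"
        unfolding X_def using h small by (intro allI impI k) auto
      moreover have "(\<lambda>m. \<bar>q h - X m\<bar>) \<longlonglongrightarrow> \<bar>q h - D\<bar>" by (intro tendsto_intros D)
      ultimately have "\<bar>q h - D\<bar> \<le> 1 / Suc n"
        using LIMSEQ_le_const2 by blast
      then show ?thesis using n by simp
    qed
    then show "\<exists>s>0. \<forall>x. x \<noteq> 0 \<and> norm (x - 0) < s \<longrightarrow> norm (q x - D) < e"
      by (intro exI[of _ "1 / Suc k"]) auto
  qed
  then have "(f has_real_derivative D) (at t)" by (simp add: DERIV_def q_def)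
  then show "f differentiable (at t)" using real_differentiable_def by blast
qed

text \<open>For fixed increments the Cauchy condition is closed in \<open>t\<close> by continuity.
  The uncountable quantifier over increments is an intersection of closed sets, so only countable
  operations remain.\<close>

lemma borel_differentiable_set:
  fixes f :: "real \<Rightarrow> real"
  assumes "continuous_on UNIV f"
  shows "{t. f differentiable (at t)} \<in> sets borel"
proof -
  have shift: "continuous_on UNIV (\<lambda>t. f (t + h))" for h
    by (rule continuous_on_compose2[OF assms]) (auto intro!: continuous_intros)
  have "closed {t. \<forall>h h'. h \<noteq> 0 \<and> \<bar>h\<bar> < 1 / Suc k \<and> h' \<noteq> 0 \<and> \<bar>h'\<bar> < 1 / Suc k \<longrightarrow>
      \<bar>(f (t + h) - f t) / h - (f (t + h') - f t) / h'\<bar> \<le> 1 / Suc n}" for k n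
    unfolding divide_inverse
    by (intro closed_Collect_all closed_Collect_imp open_Collect_const closed_Collect_le
        continuous_on_rabs continuous_on_diff continuous_on_mult continuous_on_const shift assms)
  then have "(\<Inter>n. \<Union>k. {t. \<forall>h h'. h \<noteq> 0 \<and> \<bar>h\<bar> < 1 / Suc k \<and> h' \<noteq> 0 \<and> \<bar>h'\<bar> < 1 / Suc k \<longrightarrow>
      \<bar>(f (t + h) - f t) / h - (f (t + h') - f t) / h'\<bar> \<le> 1 / Suc n}) \<in> sets borel"
    by (intro sets.countable_INT sets.countable_UN image_subsetI borel_closed) auto
  moreover have "(\<Inter>n. \<Union>k. {t. \<forall>h h'. h \<noteq> 0 \<and> \<bar>h\<bar> < 1 / Suc k \<and> h' \<noteq> 0 \<and> \<bar>h'\<bar> < 1 / Suc k \<longrightarrow>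
      \<bar>(f (t + h) - f t) / h - (f (t + h') - f t) / h'\<bar> \<le> 1 / Suc n}) = {t. f differentiable (at t)}"
    unfolding differentiable_iff_Cauchy_quotient by blast
  ultimately show ?thesis by simp
qed

section \<open>Lipschitz functions on bounded intervals\<close>

lemma lipschitz_on_clamp:
  fixes f :: "real \<Rightarrow> real"
  assumes "L-lipschitz_on {0..T} f" "0 \<le> T"
  shows "L-lipschitz_on UNIV (\<lambda>t. f (max 0 (min T t)))"
proof (rule lipschitz_onI)
  fix s t :: real
  have "dist (f (max 0 (min T s))) (f (max 0 (min T t))) \<le> L * dist (max 0 (min T s)) (max 0 (min T t))"
    using assms by (intro lipschitz_onD[OF assms(1)]) auto
  also have "\<dots> \<le> L * dist s t"
    using assms(1) by (intro mult_left_mono) (auto simp: dist_real_def lipschitz_on_def)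
  finally show "dist (f (max 0 (min T s))) (f (max 0 (min T t))) \<le> L * dist s t" .
qed (use assms in \<open>auto simp: lipschitz_on_def\<close>)

lemma lipschitz_interval_ae_derivative:
  fixes f :: "real \<Rightarrow> real"
  assumes lip: "L-lipschitz_on {0..T} f" and "0 \<le> T"
  obtains g N where "negligible N" "\<And>t. t \<in> {0<..<T} - N \<Longrightarrow> (f has_real_derivative g t) (at t)"
    and "(g has_integral (f T - f 0)) {0..T}"
proof -
  obtain g N where N: "negligible N"
    and d: "\<And>t. t \<notin> N \<Longrightarrow> ((\<lambda>t. f (max 0 (min T t))) has_real_derivative g t) (at t)"
    and i: "\<And>a b. a \<le> b \<Longrightarrow> (g has_integral (f (max 0 (min T b)) - f (max 0 (min T a)))) {a..b}"
    by (rule lipschitz_ae_derivative[OF lipschitz_on_clamp[OF assms]]) (rule that)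
  have "(f has_real_derivative g t) (at t)" if "t \<in> {0<..<T} - N" for t
  proof (rule has_field_derivative_transform_within_open[OF d])
    show "t \<notin> N" "open {0<..<T}" "t \<in> {0<..<T}" using that by auto
    fix s assume "s \<in> {0<..<T}" then show "f (max 0 (min T s)) = f s" by simp
  qed
  moreover have "(g has_integral (f T - f 0)) {0..T}" using i[of 0 T] \<open>0 \<le> T\<close> by simp
  ultimately show ?thesis by (rule that[OF N])
qed

lemma negligible_nondifferentiable_lipschitz:
  fixes f :: "real \<Rightarrow> real"
  assumes lip: "\<And>T. 0 \<le> T \<Longrightarrow> \<exists>L. L-lipschitz_on {0..T} f"
  shows "negligible {t. 0 < t \<and> \<not> f differentiable (at t)}"
proof -
  have "negligible {t. 0 < t \<and> t < real n \<and> \<not> f differentiable (at t)}" for n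
  proof -
    obtain L where "L-lipschitz_on {0..real n} f" using lip[of "real n"] by auto
    then obtain g N where "negligible N"
      "\<And>t. t \<in> {0<..<real n} - N \<Longrightarrow> (f has_real_derivative g t) (at t)"
      by (rule lipschitz_interval_ae_derivative) auto
    moreover from this(2) have "{t. 0 < t \<and> t < real n \<and> \<not> f differentiable (at t)} \<subseteq> N"
      using real_differentiable_def by fastforce
    ultimately show ?thesis using negligible_subset by blast
  qed
  then have "negligible (\<Union>n. {t. 0 < t \<and> t < real n \<and> \<not> f differentiable (at t)})"
    by (intro negligible_countable_Union) auto
  moreover have "{t. 0 < t \<and> \<not> f differentiable (at t)} \<subseteq> (\<Union>n. {t. 0 < t \<and> t < real n \<and> \<not> f differentiable (at t)})"
    using reals_Archimedean2 by blast
  ultimately show ?thesis using negligible_subset by blast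
qed

text \<open>The sign is required only of derivatives that exist; existence almost everywhere comes
  from the Lipschitz property, and the fundamental theorem integrates the sign.\<close>

lemma lipschitz_ae_derivative_nonpos_imp_le:
  fixes f :: "real \<Rightarrow> real"
  assumes lip: "L-lipschitz_on {0..T} f" and "0 \<le> T" and N: "negligible N"
    and nonpos: "\<And>t D. t \<in> {0<..<T} - N \<Longrightarrow> (f has_real_derivative D) (at t) \<Longrightarrow> D \<le> 0"
  shows "f T \<le> f 0"
proof -
  obtain g N' where N': "negligible N'" "\<And>t. t \<in> {0<..<T} - N' \<Longrightarrow> (f has_real_derivative g t) (at t)"
    and i: "(g has_integral (f T - f 0)) {0..T}"
    by (rule lipschitz_interval_ae_derivative[OF lip \<open>0 \<le> T\<close>]) (rule that)
  have neg: "negligible (N \<union> N' \<union> {0, T})" using N N' by simp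
  have "((\<lambda>t. if t \<in> N \<union> N' \<union> {0, T} then 0 else g t) has_integral (f T - f 0)) {0..T}"
    by (rule has_integral_spike[OF neg _ i]) auto
  then have "f T - f 0 \<le> 0"
  proof (rule has_integral_le[OF _ has_integral_0])
    fix t assume "t \<in> {0..T}"
    then show "(if t \<in> N \<union> N' \<union> {0, T} then 0 else g t) \<le> 0"
      using N'(2)[of t] nonpos[of t "g t"] by auto
  qed
  then show ?thesis by simp
qed

section \<open>Reflected integral equations\<close>

text \<open>Paths of the chain jump, so the integral of \<open>\<phi>\<close> cannot be
  differentiated everywhere. Iterating the inequality avoids this: after \<open>n\<close>
  substitutions the crude bound \<open>K\<close> survives only with the factor
  \<open>(C * t) ^ n / fact n\<close>.\<close>

lemma gronwall_integral:
  fixes \<phi> :: "real \<Rightarrow> real"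
  assumes int: "\<phi> integrable_on {0..T}" and bound: "\<And>t. t \<in> {0..T} \<Longrightarrow> \<phi> t \<le> K"
    and ineq: "\<And>t. t \<in> {0..T} \<Longrightarrow> \<phi> t \<le> A + C * integral {0..t} \<phi>"
    and "A \<ge> 0" "C \<ge> 0" and t: "t \<in> {0..T}"
  shows "\<phi> t \<le> A * exp (C * t)"
proof -
  have step: "\<phi> t \<le> A * exp (C * t) + K * ((C * t) ^ n / fact n)" if "t \<in> {0..T}" for n t
    using that
  proof (induction n arbitrary: t)
    case 0
    have "0 \<le> A * exp (C * t)" using \<open>A \<ge> 0\<close> by simp
    then show ?case using bound[OF 0] by simp
  next
    case (Suc n)
    define c where "c = K / fact (Suc n)"
    have c: "c * (1 + real n) = K / fact n" by (simp add: c_def divide_simps)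
    \<comment> \<open>\<open>G\<close> is an antiderivative of \<open>C\<close> times the previous
      bound with \<open>G 0 = A\<close>; the choice of \<open>c\<close> produces the next
      factorial.\<close>
    define G where "G s = A * exp (C * s) + c * (C * s) ^ Suc n" for s
    have "((\<lambda>s. C * (A * exp (C * s) + K * ((C * s) ^ n / fact n))) has_integral (G t - G 0)) {0..t}"
    proof (rule fundamental_theorem_of_calculus)
      fix s :: real
      have "(G has_real_derivative C * (A * exp (C * s)) + c * (1 + real n) * (C * (C * s) ^ n)) (at s within {0..t})"
        unfolding G_def by (rule derivative_eq_intros refl | simp add: algebra_simps)+
      then show "(G has_vector_derivative C * (A * exp (C * s) + K * ((C * s) ^ n / fact n))) (at s within {0..t})"
        unfolding c by (simp add: has_real_derivative_iff_has_vector_derivative algebra_simps)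
    qed (use Suc in auto)
    note G = this
    have "((\<lambda>s. C * \<phi> s) has_integral (C * integral {0..t} \<phi>)) {0..t}"
      using integrable_on_subinterval[OF int, of 0 t] Suc.prems by (intro has_integral_mult_right integrable_integral) auto
    then have "C * integral {0..t} \<phi> \<le> G t - G 0"
      by (rule has_integral_le[OF _ G]) (use Suc \<open>C \<ge> 0\<close> in \<open>auto intro!: mult_left_mono\<close>)
    then show ?case using ineq[OF Suc.prems] by (simp add: G_def c_def)
  qed
  have "(\<lambda>n. (C * t) ^ n / fact n) \<longlonglongrightarrow> 0"
    using summable_LIMSEQ_zero[OF summable_exp[of "C * t"]] by (simp add: field_simps)
  then have "(\<lambda>n. A * exp (C * t) + K * ((C * t) ^ n / fact n)) \<longlonglongrightarrow> A * exp (C * t) + K * 0"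
    by (intro tendsto_intros)
  then show ?thesis
    using step[OF t] LIMSEQ_le_const[of _ "A * exp (C * t)" "\<phi> t"] by auto
qed

text \<open>\<open>f + regulator f\<close> is the Skorokhod reflection of \<open>f\<close> at zero.\<close>

definition regulator :: "(real \<Rightarrow> real) \<Rightarrow> real \<Rightarrow> real" where
  "regulator f t = (SUP s\<in>{0..t}. max 0 (- f s))"

lemma regulator_bdd_above:
  "continuous_on {0..t} f \<Longrightarrow> bdd_above ((\<lambda>s::real. max 0 (- f s :: real)) ` {0..t})"
  by (intro bounded_imp_bdd_above compact_imp_bounded compact_continuous_image continuous_intros compact_Icc)

lemma regulator_upper:
  assumes "continuous_on {0..t} f" "s \<in> {0..t}"
  shows "- f s \<le> regulator f t"
  using cSUP_upper[OF assms(2) regulator_bdd_above[OF assms(1)]] unfolding regulator_def by simp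

lemma regulator_nonneg:
  assumes "continuous_on {0..t} f" "0 \<le> t"
  shows "0 \<le> regulator f t"
  using cSUP_upper[OF _ regulator_bdd_above[OF assms(1)], of 0] assms(2) unfolding regulator_def by simp

lemma regulator_least:
  assumes "0 \<le> t" "0 \<le> c" "\<And>s. s \<in> {0..t} \<Longrightarrow> - f s \<le> c"
  shows "regulator f t \<le> c"
  unfolding regulator_def using assms by (intro cSUP_least) auto

lemma regulator_mono:
  assumes "continuous_on {0..t} f" "0 \<le> s" "s \<le> t"
  shows "regulator f s \<le> regulator f t"
  using assms by (intro regulator_least regulator_nonneg regulator_upper) auto

text \<open>The 1-Lipschitz property in the uniform norm, on which all stability estimates
  rest.\<close>

lemma regulator_diff:
  assumes "continuous_on {0..t} f" "continuous_on {0..t} g" "0 \<le> t"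
    and "\<And>s. s \<in> {0..t} \<Longrightarrow> \<bar>f s - g s\<bar> \<le> d"
  shows "\<bar>regulator f t - regulator g t\<bar> \<le> d"
proof -
  have d: "d \<ge> 0" using assms(4)[of 0] assms(3) by fastforce
  have "regulator f t \<le> regulator g t + d"
  proof (rule regulator_least)
    fix s assume "s \<in> {0..t}"
    then show "- f s \<le> regulator g t + d" using assms(4)[of s] regulator_upper[OF assms(2), of s] by linarith
  qed (use assms regulator_nonneg d in auto)
  moreover have "regulator g t \<le> regulator f t + d"
  proof (rule regulator_least)
    fix s assume "s \<in> {0..t}"
    then show "- g s \<le> regulator f t + d" using assms(4)[of s] regulator_upper[OF assms(1), of s] by linarith
  qed (use assms regulator_nonneg d in auto)
  ultimately show ?thesis by linarith
qed

text \<open>A new record of \<open>- f\<close> after time \<open>s\<close> can exceed the old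
  supremum only by the depth to which \<open>f\<close> falls below \<open>f s\<close>. This
  transfers Lipschitz bounds from \<open>f\<close> to its regulator.\<close>

lemma regulator_increment:
  assumes f: "continuous_on {0..t} f" "0 \<le> s" "s \<le> t"
    and L: "\<And>u. u \<in> {s..t} \<Longrightarrow> f s - f u \<le> d" and "d \<ge> 0"
  shows "regulator f t \<le> regulator f s + d"
proof (rule regulator_least)
  have fs: "continuous_on {0..s} f" using f by (elim continuous_on_subset) auto
  show "0 \<le> regulator f s + d" using regulator_nonneg[OF fs] assms by simp
  fix u assume u: "u \<in> {0..t}"
  show "- f u \<le> regulator f s + d"
  proof (cases "u \<le> s")
    case True
    then show ?thesis using regulator_upper[OF fs, of u] u \<open>d \<ge> 0\<close> by auto
  next
    case False
    then show ?thesis using regulator_upper[OF fs, of s] L[of u] u assms(2) by auto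
  qed
qed (use assms in auto)

text \<open>If the supremum grew on \<open>{s..t}\<close>, the lowest point \<open>m\<close> of
  \<open>f\<close> there would set the record, and the reflected path would vanish at
  \<open>m\<close>, against positivity.\<close>

lemma regulator_constant:
  assumes f: "continuous_on {0..t} f" "0 \<le> s" "s \<le> t"
    and pos: "\<And>u. u \<in> {s..t} \<Longrightarrow> 0 < f u + regulator f u"
  shows "regulator f t = regulator f s"
proof -
  have fs: "continuous_on {0..s} f" using f by (elim continuous_on_subset) auto
  have "continuous_on {s..t} (\<lambda>u. - f u)"
    using f by (intro continuous_intros) (elim continuous_on_subset, auto)
  then obtain m where m: "m \<in> {s..t}" "\<And>u. u \<in> {s..t} \<Longrightarrow> - f u \<le> - f m"
    using continuous_attains_sup[of "{s..t}" "\<lambda>u. - f u"] f by auto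
  have "- f m < regulator f m" using pos[OF m(1)] by simp
  have fm: "continuous_on {0..m} f" using f m(1) by (elim continuous_on_subset) auto
  have m_le: "- f m \<le> regulator f s"
  proof (rule ccontr)
    assume "\<not> - f m \<le> regulator f s"
    then have "regulator f m \<le> - f m"
    proof (intro regulator_least)
      fix u assume "u \<in> {0..m}"
      then show "- f u \<le> - f m"
        using m regulator_upper[OF fs, of u] \<open>\<not> - f m \<le> regulator f s\<close> by (cases "u \<le> s") auto
    qed (use m f regulator_nonneg[OF fs] in auto)
    with \<open>- f m < regulator f m\<close> show False by simp
  qed
  have "regulator f t \<le> regulator f s"
  proof (rule regulator_least)
    fix u assume "u \<in> {0..t}"
    then show "- f u \<le> regulator f s"
      using m(2)[of u] m_le regulator_upper[OF fs, of u] by (cases "u \<le> s") auto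
  qed (use f regulator_nonneg[OF fs] in auto)
  then show ?thesis using regulator_mono[OF f] by simp
qed

lemma integrable_path:
  fixes T :: real and X :: "real \<Rightarrow> real"
  assumes "X integrable_on {0..T}" "t \<le> T"
  shows "X integrable_on {0..t}"
  by (rule integrable_on_subinterval[OF assms(1)]) (use assms(2) in auto)

lemma integrable_cmult_real:
  fixes f :: "real \<Rightarrow> real"
  shows "f integrable_on S \<Longrightarrow> (\<lambda>x. c * f x) integrable_on S"
  using integrable_cmul[of f S c] by simp

section \<open>Approximate solutions and their stability\<close>

locale fluid_model =
  fixes lam beta eps :: real and gam :: nat
  assumes lam_pos: "lam > 0" and beta_pos: "beta > 0" and eps_pos: "eps > 0" and gam_pos: "gam > 0"
begin

text \<open>Here \<open>X\<close> is the uncentred coordinate, so the paper's \<open>x\<close> is \<open>X - lam / beta\<close> and its boundary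
  is \<open>X = 0\<close>.\<close>

definition ypath :: "real \<Rightarrow> (real \<Rightarrow> real) \<Rightarrow> real \<Rightarrow> real" where
  "ypath a X t = a + integral {0..t} (\<lambda>s. beta * X s - lam)"

definition xfree :: "real \<Rightarrow> (real \<Rightarrow> real) \<Rightarrow> (real \<Rightarrow> real) \<Rightarrow> real \<Rightarrow> real" where
  "xfree b Y X t = b + integral {0..t} (\<lambda>s. real gam * lam - real gam * beta * X s - eps * Y s)"

text \<open>One notion covers scaled chains and, with \<open>\<eta> = 0\<close>, exact solutions.
  Boundedness is part of it because the paths may jump; it makes differences absolutely integrable
  and starts the Gronwall iteration. Errors in the initial state are absorbed by
  \<open>\<eta>\<close>, so \<open>a\<close> and \<open>b\<close> can be the same for all
  \<open>r\<close>.\<close>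

definition fluid_approx :: "real \<Rightarrow> real \<Rightarrow> real \<Rightarrow> real \<Rightarrow> (real \<Rightarrow> real) \<Rightarrow> (real \<Rightarrow> real) \<Rightarrow> bool" where
  "fluid_approx \<eta> T a b Y X \<longleftrightarrow>
     Y integrable_on {0..T} \<and> X integrable_on {0..T} \<and> (\<exists>K. \<forall>t\<in>{0..T}. \<bar>Y t\<bar> \<le> K \<and> \<bar>X t\<bar> \<le> K) \<and>
     (\<forall>t\<in>{0..T}. \<bar>Y t - ypath a X t\<bar> \<le> \<eta> \<and> \<bar>X t - (xfree b Y X t + regulator (xfree b Y X) t)\<bar> \<le> \<eta>)"

lemma integrable_drift:
  assumes "Y integrable_on {0..T}" "X integrable_on {0..T}"
  shows "(\<lambda>s::real. real gam * lam - real gam * beta * X s - eps * Y s) integrable_on {0..T}"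
  using assms by (intro integrable_diff integrable_const_ivl integrable_cmult_real)

lemma integrable_ydrift:
  assumes "X integrable_on {0..T}"
  shows "(\<lambda>s::real. beta * X s - lam) integrable_on {0..T}"
  using assms by (intro integrable_diff integrable_const_ivl integrable_cmult_real)

lemma continuous_xfree:
  assumes "Y integrable_on {0..T}" "X integrable_on {0..T}"
  shows "continuous_on {0..T} (xfree b Y X)"
  unfolding xfree_def[abs_def] by (intro continuous_intros indefinite_integral_continuous_1 integrable_drift assms)

lemma fluid_approxD:
  assumes "fluid_approx \<eta> T a b Y X"
  shows "Y integrable_on {0..T}" "X integrable_on {0..T}" "\<exists>K. \<forall>t\<in>{0..T}. \<bar>Y t\<bar> \<le> K \<and> \<bar>X t\<bar> \<le> K"
    and "t \<in> {0..T} \<Longrightarrow> \<bar>Y t - ypath a X t\<bar> \<le> \<eta>"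
    and "t \<in> {0..T} \<Longrightarrow> \<bar>X t - (xfree b Y X t + regulator (xfree b Y X) t)\<bar> \<le> \<eta>"
  using assms unfolding fluid_approx_def by blast+

lemma fluid_approxI:
  assumes "Y integrable_on {0..T}" "X integrable_on {0..T}" "\<And>t. t \<in> {0..T} \<Longrightarrow> \<bar>Y t\<bar> \<le> K \<and> \<bar>X t\<bar> \<le> K"
    and "\<And>t. t \<in> {0..T} \<Longrightarrow> \<bar>Y t - ypath a X t\<bar> \<le> \<eta>"
    and "\<And>t. t \<in> {0..T} \<Longrightarrow> \<bar>X t - (xfree b Y X t + regulator (xfree b Y X) t)\<bar> \<le> \<eta>"
  shows "fluid_approx \<eta> T a b Y X"
  using assms unfolding fluid_approx_def by blast

lemma fluid_approx_mono:
  assumes ap: "fluid_approx \<eta> T a b Y X" and "\<eta> \<le> \<eta>'" "T' \<le> T"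
  shows "fluid_approx \<eta>' T' a b Y X"
proof -
  obtain K where K: "\<And>t. t \<in> {0..T} \<Longrightarrow> \<bar>Y t\<bar> \<le> K \<and> \<bar>X t\<bar> \<le> K"
    using fluid_approxD(3)[OF ap] by blast
  show ?thesis
  proof (rule fluid_approxI)
    fix t assume "t \<in> {0..T'}"
    then have t: "t \<in> {0..T}" using \<open>T' \<le> T\<close> by simp
    show "\<bar>Y t\<bar> \<le> K \<and> \<bar>X t\<bar> \<le> K" using K[OF t] .
    show "\<bar>Y t - ypath a X t\<bar> \<le> \<eta>'" using fluid_approxD(4)[OF ap t] \<open>\<eta> \<le> \<eta>'\<close> by linarith
    show "\<bar>X t - (xfree b Y X t + regulator (xfree b Y X) t)\<bar> \<le> \<eta>'"
      using fluid_approxD(5)[OF ap t] \<open>\<eta> \<le> \<eta>'\<close> by linarith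
  qed (use fluid_approxD(1,2)[OF ap] integrable_path \<open>T' \<le> T\<close> in blast)+
qed

text \<open>The Lipschitz constant of the pair of integral operators: \<open>beta\<close> from the
  \<open>Y\<close> equation, and \<open>gam * beta + eps\<close> from the free path, counted twice
  because the regulator can contribute the same amount again.\<close>

definition growth :: real where "growth = beta + 2 * (real gam * beta + eps)"

lemma growth_nonneg: "growth \<ge> 0"
  using beta_pos eps_pos by (simp add: growth_def)

text \<open>The majorant \<open>D\<close> is kept general: the distance itself serves the Gronwall
  argument, a constant serves the passage to uniform limits.\<close>

lemma path_diff_bound:
  assumes Y1: "Y1 integrable_on {0..T}" and X1: "X1 integrable_on {0..T}"
    and Y2: "Y2 integrable_on {0..T}" and X2: "X2 integrable_on {0..T}"
    and D: "D integrable_on {0..T}"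
    and le: "\<And>s. s \<in> {0..T} \<Longrightarrow> \<bar>Y1 s - Y2 s\<bar> + \<bar>X1 s - X2 s\<bar> \<le> D s"
    and t: "t \<in> {0..T}"
  shows "\<bar>ypath a X1 t - ypath a X2 t\<bar> + \<bar>xfree b Y1 X1 t + regulator (xfree b Y1 X1) t - (xfree b Y2 X2 t + regulator (xfree b Y2 X2) t)\<bar>
    \<le> growth * integral {0..t} D"
proof -
  have t0: "0 \<le> t" "t \<le> T" using t by auto
  have y: "\<bar>ypath a X1 t - ypath a X2 t\<bar> \<le> beta * integral {0..t} D"
  proof -
    note i1 = integrable_ydrift[OF integrable_path[OF X1 t0(2)]]
    note i2 = integrable_ydrift[OF integrable_path[OF X2 t0(2)]]
    have "ypath a X1 t - ypath a X2 t = integral {0..t} (\<lambda>u. (beta * X1 u - lam) - (beta * X2 u - lam))"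
      unfolding ypath_def by (subst integral_diff[OF i1 i2]) simp
    also have "\<bar>\<dots>\<bar> \<le> integral {0..t} (\<lambda>u. beta * D u)"
      unfolding real_norm_def[symmetric]
    proof (rule integral_norm_bound_integral[OF integrable_diff[OF i1 i2] integrable_cmult_real[OF integrable_path[OF D t0(2)]]])
      fix u assume u: "u \<in> {0..t}"
      have "\<bar>X1 u - X2 u\<bar> \<le> D u" using le[of u] u t by auto
      then have "beta * \<bar>X1 u - X2 u\<bar> \<le> beta * D u" using beta_pos by simp
      then show "norm (beta * X1 u - lam - (beta * X2 u - lam)) \<le> beta * D u"
        using beta_pos by (simp add: abs_mult flip: right_diff_distrib)
    qed
    finally show ?thesis by simp
  qed
  have x: "\<bar>xfree b Y1 X1 s - xfree b Y2 X2 s\<bar> \<le> (real gam * beta + eps) * integral {0..t} D" if s: "s \<in> {0..t}" for s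
  proof -
    have sT: "0 \<le> s" "s \<le> T" using s t by auto
    note i1 = integrable_drift[OF integrable_path[OF Y1 sT(2)] integrable_path[OF X1 sT(2)]]
    note i2 = integrable_drift[OF integrable_path[OF Y2 sT(2)] integrable_path[OF X2 sT(2)]]
    have eq: "xfree b Y1 X1 s - xfree b Y2 X2 s = integral {0..s} (\<lambda>u. (real gam * lam - real gam * beta * X1 u - eps * Y1 u) - (real gam * lam - real gam * beta * X2 u - eps * Y2 u))"
      unfolding xfree_def by (subst integral_diff[OF i1 i2]) simp
    have "\<bar>xfree b Y1 X1 s - xfree b Y2 X2 s\<bar> \<le> integral {0..s} (\<lambda>u. (real gam * beta + eps) * D u)"
      unfolding eq real_norm_def[symmetric]
    proof (rule integral_norm_bound_integral[OF integrable_diff[OF i1 i2] integrable_cmult_real[OF integrable_path[OF D sT(2)]]])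
      fix u assume u: "u \<in> {0..s}"
      have le': "\<bar>X1 u - X2 u\<bar> \<le> D u" "\<bar>Y1 u - Y2 u\<bar> \<le> D u" using le[of u] u sT by auto
      have "norm ((real gam * lam - real gam * beta * X1 u - eps * Y1 u) - (real gam * lam - real gam * beta * X2 u - eps * Y2 u))
        = \<bar>real gam * beta * (X1 u - X2 u) + eps * (Y1 u - Y2 u)\<bar>" by (simp add: algebra_simps)
      also have "\<dots> \<le> real gam * beta * \<bar>X1 u - X2 u\<bar> + eps * \<bar>Y1 u - Y2 u\<bar>"
        using beta_pos eps_pos by (intro order_trans[OF abs_triangle_ineq]) (simp add: abs_mult)
      also have "\<dots> \<le> real gam * beta * D u + eps * D u"
        using beta_pos eps_pos le' by (intro add_mono mult_left_mono) auto
      finally show "norm ((real gam * lam - real gam * beta * X1 u - eps * Y1 u) - (real gam * lam - real gam * beta * X2 u - eps * Y2 u)) \<le> (real gam * beta + eps) * D u"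
        by (simp add: algebra_simps)
    qed
    also have "\<dots> = (real gam * beta + eps) * integral {0..s} D" by (rule integral_mult_right)
    also have "\<dots> \<le> (real gam * beta + eps) * integral {0..t} D"
    proof (rule mult_left_mono)
      show "integral {0..s} D \<le> integral {0..t} D"
      proof (rule integral_subset_le[OF _ integrable_path[OF D sT(2)] integrable_path[OF D t0(2)]])
        show "{0..s} \<subseteq> {0..t}" using s by simp
        show "\<forall>u\<in>{0..t}. 0 \<le> D u"
        proof
          fix u assume "u \<in> {0..t}"
          then have "\<bar>Y1 u - Y2 u\<bar> + \<bar>X1 u - X2 u\<bar> \<le> D u" using le[of u] t by simp
          then show "0 \<le> D u" by linarith
        qed
      qed
      show "0 \<le> real gam * beta + eps" using beta_pos eps_pos by simp
    qed
    finally show ?thesis .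
  qed
  have "\<bar>regulator (xfree b Y1 X1) t - regulator (xfree b Y2 X2) t\<bar> \<le> (real gam * beta + eps) * integral {0..t} D"
    by (rule regulator_diff[OF continuous_xfree continuous_xfree t0(1) x])
      (use integrable_path t0 Y1 X1 Y2 X2 in blast)+
  moreover have "\<bar>p - q\<bar> \<le> c \<Longrightarrow> \<bar>u - v\<bar> \<le> c \<Longrightarrow> \<bar>u + p - (v + q)\<bar> \<le> 2 * c" for p q u v c :: real
    by linarith
  ultimately have "\<bar>xfree b Y1 X1 t + regulator (xfree b Y1 X1) t - (xfree b Y2 X2 t + regulator (xfree b Y2 X2) t)\<bar>
    \<le> 2 * ((real gam * beta + eps) * integral {0..t} D)"
    using x[of t] t0 by simp
  from add_mono[OF y this] show ?thesis
    unfolding growth_def distrib_right mult.assoc .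
qed

text \<open>Gronwall is applied to the sum of both coordinate distances. Each coordinate contributes
  \<open>\<eta> + \<eta>'\<close>, whence the factor 2.\<close>

lemma fluid_approx_stable:
  assumes 1: "fluid_approx \<eta> T a b Y1 X1" and 2: "fluid_approx \<eta>' T a b Y2 X2" and t: "t \<in> {0..T}"
  shows "\<bar>Y1 t - Y2 t\<bar> + \<bar>X1 t - X2 t\<bar> \<le> 2 * (\<eta> + \<eta>') * exp (growth * T)"
proof -
  define \<phi> where "\<phi> t = \<bar>Y1 t - Y2 t\<bar> + \<bar>X1 t - X2 t\<bar>" for t
  note d1 = fluid_approxD[OF 1] and d2 = fluid_approxD[OF 2]
  obtain K1 where K1: "\<And>t. t \<in> {0..T} \<Longrightarrow> \<bar>Y1 t\<bar> \<le> K1 \<and> \<bar>X1 t\<bar> \<le> K1" using d1(3) by blast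
  obtain K2 where K2: "\<And>t. t \<in> {0..T} \<Longrightarrow> \<bar>Y2 t\<bar> \<le> K2 \<and> \<bar>X2 t\<bar> \<le> K2" using d2(3) by blast
  have abs_int: "(\<lambda>t. \<bar>F t - G t\<bar>) integrable_on {0..T}"
    if "F integrable_on {0..T}" "G integrable_on {0..T}" "\<And>t. t \<in> {0..T} \<Longrightarrow> \<bar>F t - G t\<bar> \<le> K1 + K2" for F G :: "real \<Rightarrow> real"
  proof -
    have "(\<lambda>t. F t - G t) absolutely_integrable_on {0..T}"
      by (rule absolutely_integrable_integrable_bound[where g="\<lambda>_. K1 + K2"])
        (use that in \<open>auto intro!: integrable_diff\<close>)
    then show ?thesis by (simp add: absolutely_integrable_on_def)
  qed
  have bound: "\<bar>Y1 t - Y2 t\<bar> \<le> K1 + K2" "\<bar>X1 t - X2 t\<bar> \<le> K1 + K2" if "t \<in> {0..T}" for t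
    using K1[OF that] K2[OF that] by linarith+
  have int: "\<phi> integrable_on {0..T}"
    unfolding \<phi>_def by (intro integrable_add abs_int d1 d2 bound)
  have eta: "\<eta> \<ge> 0" "\<eta>' \<ge> 0" using d1(4)[OF t] d2(4)[OF t] by linarith+
  have ineq: "\<phi> t \<le> 2 * (\<eta> + \<eta>') + growth * integral {0..t} \<phi>" if t: "t \<in> {0..T}" for t
  proof -
    have "\<bar>ypath a X1 t - ypath a X2 t\<bar> + \<bar>xfree b Y1 X1 t + regulator (xfree b Y1 X1) t - (xfree b Y2 X2 t + regulator (xfree b Y2 X2) t)\<bar>
      \<le> growth * integral {0..t} \<phi>"
      by (rule path_diff_bound[OF d1(1,2) d2(1,2) int _ t]) (simp add: \<phi>_def)
    moreover have "\<bar>Y1 t - Y2 t\<bar> \<le> \<eta> + \<eta>' + \<bar>ypath a X1 t - ypath a X2 t\<bar>"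
      using d1(4)[OF t] d2(4)[OF t] by linarith
    moreover have "\<bar>X1 t - X2 t\<bar> \<le> \<eta> + \<eta>' + \<bar>xfree b Y1 X1 t + regulator (xfree b Y1 X1) t - (xfree b Y2 X2 t + regulator (xfree b Y2 X2) t)\<bar>"
      using d1(5)[OF t] d2(5)[OF t] by linarith
    moreover have "p + q \<le> r \<Longrightarrow> u \<le> e + p \<Longrightarrow> v \<le> e + q \<Longrightarrow> u + v \<le> 2 * e + r" for p q r u v e :: real
      by linarith
    ultimately show ?thesis unfolding \<phi>_def[of t] by blast
  qed
  have "\<phi> t \<le> 2 * (\<eta> + \<eta>') * exp (growth * t)"
  proof (rule gronwall_integral[OF int _ ineq _ growth_nonneg t])
    fix s assume s: "s \<in> {0..T}"
    show "\<phi> s \<le> (K1 + K2) + (K1 + K2)"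
      unfolding \<phi>_def by (rule add_mono[OF bound(1)[OF s] bound(2)[OF s]])
  qed (use eta in auto)
  also have "\<dots> \<le> 2 * (\<eta> + \<eta>') * exp (growth * T)"
    using t eta growth_nonneg by (intro mult_left_mono) (auto intro!: mult_left_mono)
  finally show ?thesis unfolding \<phi>_def .
qed

text \<open>Lets a uniform limit inherit the integral equations: its error is that of the
  approximant plus a multiple of the uniform distance.\<close>

lemma fluid_approx_perturb:
  assumes 1: "fluid_approx \<eta> T a b Y1 X1" and int: "Y integrable_on {0..T}" "X integrable_on {0..T}"
    and close: "\<And>t. t \<in> {0..T} \<Longrightarrow> \<bar>Y1 t - Y t\<bar> + \<bar>X1 t - X t\<bar> \<le> d"
  shows "fluid_approx (\<eta> + d + growth * (T * d)) T a b Y X"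
proof -
  note d1 = fluid_approxD[OF 1]
  obtain K where K: "\<And>t. t \<in> {0..T} \<Longrightarrow> \<bar>Y1 t\<bar> \<le> K \<and> \<bar>X1 t\<bar> \<le> K" using d1(3) by blast
  have diff: "\<bar>ypath a X1 t - ypath a X t\<bar> + \<bar>xfree b Y1 X1 t + regulator (xfree b Y1 X1) t - (xfree b Y X t + regulator (xfree b Y X) t)\<bar>
      \<le> growth * (T * d)" if t: "t \<in> {0..T}" for t
  proof -
    have "\<bar>ypath a X1 t - ypath a X t\<bar> + \<bar>xfree b Y1 X1 t + regulator (xfree b Y1 X1) t - (xfree b Y X t + regulator (xfree b Y X) t)\<bar>
      \<le> growth * integral {0..t} (\<lambda>_. d)"
      by (rule path_diff_bound[OF d1(1,2) int integrable_const_ivl close t])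
    also have "\<dots> \<le> growth * (T * d)"
    proof -
      have "0 \<le> d" using close[OF t] by linarith
      then have "t * d \<le> T * d" using t by (intro mult_right_mono) auto
      then show ?thesis using t growth_nonneg by (auto intro: mult_left_mono)
    qed
    finally show ?thesis .
  qed
  show ?thesis
  proof (rule fluid_approxI[OF int])
    fix t assume t: "t \<in> {0..T}"
    show "\<bar>Y t\<bar> \<le> K + d \<and> \<bar>X t\<bar> \<le> K + d"
      using K[OF t] close[OF t] by linarith
    show "\<bar>Y t - ypath a X t\<bar> \<le> \<eta> + d + growth * (T * d)"
      using diff[OF t] close[OF t] d1(4)[OF t] by linarith
    show "\<bar>X t - (xfree b Y X t + regulator (xfree b Y X) t)\<bar> \<le> \<eta> + d + growth * (T * d)"
      using diff[OF t] close[OF t] d1(5)[OF t] by linarith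
  qed
qed

lemma fluid_approx_zeroI:
  assumes "\<And>e. e > 0 \<Longrightarrow> fluid_approx e T a b Y X"
  shows "fluid_approx 0 T a b Y X"
proof -
  note d = fluid_approxD[OF assms]
  obtain K where K: "\<And>t. t \<in> {0..T} \<Longrightarrow> \<bar>Y t\<bar> \<le> K \<and> \<bar>X t\<bar> \<le> K" using d(3)[OF zero_less_one] by blast
  show ?thesis
  proof (rule fluid_approxI[OF d(1)[OF zero_less_one] d(2)[OF zero_less_one] K])
    fix t assume t: "t \<in> {0..T}"
    show "\<bar>Y t - ypath a X t\<bar> \<le> 0"
      by (rule field_le_epsilon) (use d(4)[OF _ t] in simp)
    show "\<bar>X t - (xfree b Y X t + regulator (xfree b Y X) t)\<bar> \<le> 0"
      by (rule field_le_epsilon) (use d(5)[OF _ t] in simp)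
  qed
qed

text \<open>Accuracy and horizon improve together with \<open>n\<close>, so on any fixed interval
  stability makes a tail of the sequence uniformly Cauchy.\<close>

lemma fluid_exact_exists:
  assumes approx: "\<And>n. fluid_approx (1 / Suc n) (real n) a b (Y n) (X n)"
  obtains y x where "\<And>T. fluid_approx 0 T a b y x"
proof -
  have tail: "fluid_approx (1 / Suc k) T a b (Y n) (X n)" if "k \<le> n" "T \<le> real k" for k n T
    by (rule fluid_approx_mono[OF approx]) (use that in \<open>auto simp: frac_le\<close>)
  have close: "\<bar>Y m t - Y n t\<bar> + \<bar>X m t - X n t\<bar> \<le> 4 * exp (growth * T) / Suc k"
    if "k \<le> m" "k \<le> n" "t \<in> {0..T}" "T \<le> real k" for k m n and t T :: real
    using fluid_approx_stable[OF tail[OF that(1,4)] tail[OF that(2,4)] that(3)] by simp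
  have eventually_small: "\<exists>k. c / Suc k < e \<and> T \<le> real k" if "e > 0" for c e T :: real
  proof -
    obtain k :: nat where k: "max T (c / e) < real k" using reals_Archimedean2 by blast
    then have "c < e * real k" using that by (simp add: field_simps)
    also have "\<dots> \<le> e * Suc k" using that by simp
    finally show ?thesis using k by (intro exI[of _ k]) (simp add: pos_divide_less_eq)
  qed
  \<comment> \<open>\<open>Z\<close> stands for either coordinate; both are dominated by the same
    sum of distances.\<close>
  have lim: "convergent (\<lambda>n. Z n t)" if "t \<ge> 0"
    and Z: "\<And>m n. \<bar>Z m t - Z n t\<bar> \<le> \<bar>Y m t - Y n t\<bar> + \<bar>X m t - X n t\<bar>" for t and Z :: "nat \<Rightarrow> real \<Rightarrow> real"
  proof -
    have "Cauchy (\<lambda>n. Z n t)"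
    proof (rule CauchyI)
      fix e :: real assume "e > 0"
      then obtain k where "4 * exp (growth * t) / Suc k < e" "t \<le> real k"
        using eventually_small by blast
      then have "\<bar>Z m t - Z n t\<bar> < e" if "k \<le> m" "k \<le> n" for m n
        using close[OF that, of t t] Z[of m n] \<open>t \<ge> 0\<close> by auto
      then show "\<exists>M. \<forall>m\<ge>M. \<forall>n\<ge>M. norm (Z m t - Z n t) < e" by auto
    qed
    then show ?thesis by (rule Cauchy_convergent)
  qed
  define y x where "y t = lim (\<lambda>n. Y n t)" and "x t = lim (\<lambda>n. X n t)" for t
  have y: "(\<lambda>n. Y n t) \<longlonglongrightarrow> y t" and x: "(\<lambda>n. X n t) \<longlonglongrightarrow> x t" if "t \<ge> 0" for t
    unfolding y_def x_def using lim[OF that] by (auto simp: convergent_LIMSEQ_iff)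
  have close': "\<bar>Y k t - y t\<bar> + \<bar>X k t - x t\<bar> \<le> 4 * exp (growth * T) / Suc k"
    if "t \<in> {0..T}" "T \<le> real k" for k t and T :: real
  proof (rule LIMSEQ_le_const2)
    show "(\<lambda>n. \<bar>Y k t - Y n t\<bar> + \<bar>X k t - X n t\<bar>) \<longlonglongrightarrow> \<bar>Y k t - y t\<bar> + \<bar>X k t - x t\<bar>"
      using that by (intro tendsto_intros x y) auto
    show "\<exists>N. \<forall>n\<ge>N. \<bar>Y k t - Y n t\<bar> + \<bar>X k t - X n t\<bar> \<le> 4 * exp (growth * T) / Suc k"
      using close[OF order_refl _ that] by blast
  qed
  have int: "Z integrable_on {0..T}"
    if Zn: "\<And>n. T \<le> real n \<Longrightarrow> Zn n integrable_on {0..T}"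
    and cl: "\<And>k t. t \<in> {0..T} \<Longrightarrow> T \<le> real k \<Longrightarrow> \<bar>Zn k t - Z t\<bar> \<le> 4 * exp (growth * T) / Suc k" for Z :: "real \<Rightarrow> real" and Zn T
  proof -
    have "Z integrable_on cbox 0 T"
    proof (rule integrable_uniform_limit)
      fix e :: real assume "e > 0"
      then obtain k where "4 * exp (growth * T) / Suc k < e" "T \<le> real k"
        using eventually_small by blast
      then show "\<exists>g. (\<forall>x\<in>cbox 0 T. norm (Z x - g x) \<le> e) \<and> g integrable_on cbox 0 T"
        using Zn cl by (intro exI[of _ "Zn k"]) (force simp: abs_minus_commute)
    qed
    then show ?thesis by simp
  qed
  have exact: "fluid_approx 0 T a b y x" if "T \<ge> 0" for T
  proof (rule fluid_approx_zeroI)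
    fix e :: real assume "e > 0"
    have iy: "y integrable_on {0..T}"
    proof (rule int[of T Y])
      fix k assume "T \<le> real k"
      then show "Y k integrable_on {0..T}" by (rule fluid_approxD(1)[OF tail[OF order_refl]])
      fix t assume "t \<in> {0..T}"
      from close'[OF this \<open>T \<le> real k\<close>]
      show "\<bar>Y k t - y t\<bar> \<le> 4 * exp (growth * T) / Suc k" by linarith
    qed
    have ix: "x integrable_on {0..T}"
    proof (rule int[of T X])
      fix k assume "T \<le> real k"
      then show "X k integrable_on {0..T}" by (rule fluid_approxD(2)[OF tail[OF order_refl]])
      fix t assume "t \<in> {0..T}"
      from close'[OF this \<open>T \<le> real k\<close>]
      show "\<bar>X k t - x t\<bar> \<le> 4 * exp (growth * T) / Suc k" by linarith
    qed
    \<comment> \<open>Collects the three error terms of \<open>fluid_approx_perturb\<close> for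
      accuracy \<open>1 / Suc k\<close> and distance
      \<open>4 * exp (growth * T) / Suc k\<close>.\<close>
    define c where "c = 1 + 4 * exp (growth * T) + growth * (T * (4 * exp (growth * T)))"
    obtain k where k: "c / Suc k < e" "T \<le> real k" using eventually_small[OF \<open>e > 0\<close>] by blast
    have "fluid_approx (1 / Suc k + 4 * exp (growth * T) / Suc k + growth * (T * (4 * exp (growth * T) / Suc k))) T a b y x"
      by (rule fluid_approx_perturb[OF tail[OF order_refl k(2)] iy ix close'[OF _ k(2)]])
    moreover have "1 / Suc k + 4 * exp (growth * T) / Suc k + growth * (T * (4 * exp (growth * T) / Suc k)) = c / Suc k"
      by (simp add: c_def add_divide_distrib)
    ultimately show "fluid_approx e T a b y x"
      using k(1) by (auto intro: fluid_approx_mono)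
  qed
  have "fluid_approx 0 T a b y x" for T
    by (rule fluid_approx_mono[OF exact[of "max 0 T"]]) auto
  then show ?thesis by (rule that)
qed

end

section \<open>Fluid solutions\<close>

lemma lipschitz_on_max_min:
  fixes f g :: "real \<Rightarrow> real"
  assumes "L-lipschitz_on S f" "L-lipschitz_on S g"
  shows "L-lipschitz_on S (\<lambda>t. max (f t) (g t))" "L-lipschitz_on S (\<lambda>t. min (f t) (g t))"
proof -
  have L: "L \<ge> 0" using assms(1) by (simp add: lipschitz_on_def)
  have f: "\<bar>f s - f t\<bar> \<le> L * \<bar>s - t\<bar>" and g: "\<bar>g s - g t\<bar> \<le> L * \<bar>s - t\<bar>" if "s \<in> S" "t \<in> S" for s t
    using lipschitz_onD[OF assms(1) that] lipschitz_onD[OF assms(2) that] by (simp_all add: dist_real_def)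
  show "L-lipschitz_on S (\<lambda>t. max (f t) (g t))"
    by (rule lipschitz_onI[OF _ L]) (use f g in \<open>fastforce simp: dist_real_def max_def\<close>)
  show "L-lipschitz_on S (\<lambda>t. min (f t) (g t))"
    by (rule lipschitz_onI[OF _ L]) (use f g in \<open>fastforce simp: dist_real_def min_def\<close>)
qed

lemma negligible_nonregular:
  assumes "\<And>T. 0 \<le> T \<Longrightarrow> \<exists>L. L-lipschitz_on {0..T} y \<and> L-lipschitz_on {0..T} x"
  shows "negligible {t. 0 < t \<and> \<not> regular_point y x t}"
proof -
  have "{t. 0 < t \<and> \<not> regular_point y x t} \<subseteq>
    ({t. 0 < t \<and> \<not> y differentiable at t} \<union> {t. 0 < t \<and> \<not> x differentiable at t}) \<union>
    ({t. 0 < t \<and> \<not> (\<lambda>s. max (y s) (x s)) differentiable at t} \<union>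
     {t. 0 < t \<and> \<not> (\<lambda>s. min (y s) (x s)) differentiable at t})"
    by (auto simp: regular_point_def)
  moreover have "negligible \<dots>"
    by (intro negligible_Un negligible_nondifferentiable_lipschitz)
      (use assms lipschitz_on_max_min in blast)+
  ultimately show ?thesis using negligible_subset by blast
qed

text \<open>Negligibility refers to completed Lebesgue measure. Membership in the null sets of
  \<open>lborel\<close> also requires a Borel set, and continuity on the whole line supplies
  that.\<close>

lemma nonregular_null_set:
  assumes lip: "\<And>T. 0 \<le> T \<Longrightarrow> \<exists>L. L-lipschitz_on {0..T} y \<and> L-lipschitz_on {0..T} x"
    and cont: "continuous_on UNIV y" "continuous_on UNIV x"
  shows "{t. t \<ge> 0 \<and> \<not> regular_point y x t} \<in> null_sets lborel"
proof -
  have "{t. t \<ge> 0 \<and> \<not> regular_point y x t} = {0..} \<inter>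
    - ({t. y differentiable at t} \<inter> {t. x differentiable at t} \<inter> {t. (\<lambda>s. max (y s) (x s)) differentiable at t} \<inter>
       {t. (\<lambda>s. min (y s) (x s)) differentiable at t})"
    by (auto simp: regular_point_def)
  also have "\<dots> \<in> sets borel"
    by (intro sets.Int borel_comp borel_differentiable_set continuous_on_max continuous_on_min cont) auto
  finally have meas: "{t. t \<ge> 0 \<and> \<not> regular_point y x t} \<in> sets borel" .
  have "{t. t \<ge> 0 \<and> \<not> regular_point y x t} \<subseteq> {t. 0 < t \<and> \<not> regular_point y x t} \<union> {0}"
    by auto
  moreover have "negligible ({t. 0 < t \<and> \<not> regular_point y x t} \<union> {0})"
    using negligible_nonregular[OF lip] by (intro negligible_Un) auto
  ultimately have "negligible {t. t \<ge> 0 \<and> \<not> regular_point y x t}"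
    using negligible_subset by blast
  then have "emeasure lebesgue {t. t \<ge> 0 \<and> \<not> regular_point y x t} = 0"
    by (simp add: negligible_iff_null_sets null_setsD1)
  with meas show ?thesis by (simp add: null_sets_def)
qed

lemma lipschitz_indefinite_integral:
  fixes g :: "real \<Rightarrow> real"
  assumes int: "g integrable_on {0..T}" and bound: "\<And>t. t \<in> {0..T} \<Longrightarrow> \<bar>g t\<bar> \<le> L" and "0 \<le> L"
  shows "L-lipschitz_on {0..T} (\<lambda>t. c + integral {0..t} g)"
proof (rule lipschitz_onI[OF _ \<open>0 \<le> L\<close>])
  have *: "\<bar>integral {0..t} g - integral {0..s} g\<bar> \<le> L * (t - s)" if "0 \<le> s" "s \<le> t" "t \<le> T" for s t
  proof -
    have i: "g integrable_on {0..t}" "g integrable_on {s..t}"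
      using that by (auto intro: integrable_on_subinterval[OF int])
    have "integral {0..s} g + integral {s..t} g = integral {0..t} g"
      using that i by (intro Henstock_Kurzweil_Integration.integral_combine) auto
    moreover have "norm (integral {s..t} g) \<le> L * measure lborel {s..t}"
      using that bound by (intro has_integral_bound_real[OF \<open>0 \<le> L\<close> finite.emptyI integrable_integral[OF i(2)]]) auto
    ultimately show ?thesis using that by simp
  qed
  fix s t assume "s \<in> {0..T}" "t \<in> {0..T}"
  then show "dist (c + integral {0..s} g) (c + integral {0..t} g) \<le> L * dist s t"
    using *[of s t] *[of t s] by (cases "s \<le> t") (auto simp: dist_real_def abs_minus_commute)
qed

lemma lipschitz_on_square:
  fixes d :: "real \<Rightarrow> real"
  assumes "L-lipschitz_on {0..T} d"
  shows "\<exists>L'. L'-lipschitz_on {0..T} (\<lambda>t. (d t)\<^sup>2)"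
proof -
  have L: "L \<ge> 0" using assms by (simp add: lipschitz_on_def)
  have "bounded (d ` {0..T})"
    by (intro compact_imp_bounded compact_continuous_image lipschitz_on_continuous_on[OF assms] compact_Icc)
  then obtain K where K: "\<And>t. t \<in> {0..T} \<Longrightarrow> \<bar>d t\<bar> \<le> K" "K > 0"
    unfolding bounded_pos ball_simps real_norm_def by blast
  have "(2 * K * L)-lipschitz_on {0..T} (\<lambda>t. (d t)\<^sup>2)"
  proof (rule lipschitz_onI)
    fix s t assume st: "s \<in> {0..T}" "t \<in> {0..T}"
    have "dist ((d s)\<^sup>2) ((d t)\<^sup>2) = \<bar>d s + d t\<bar> * \<bar>d s - d t\<bar>"
      by (simp add: dist_real_def power2_eq_square algebra_simps flip: abs_mult)
    also have "\<dots> \<le> (2 * K) * (L * dist s t)"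
      using K(1)[OF st(1)] K(1)[OF st(2)] lipschitz_onD[OF assms st]
      by (intro mult_mono) (auto simp: dist_real_def)
    finally show "dist ((d s)\<^sup>2) ((d t)\<^sup>2) \<le> 2 * K * L * dist s t" by simp
  qed (use K L in simp)
  then show ?thesis by blast
qed

section \<open>Uniqueness by an energy estimate\<close>

text \<open>Truncation by \<open>max\<close> acts only on a trajectory at the lowest level
  \<open>c\<close> and can only raise its derivative; against a trajectory above \<open>c\<close>,
  this correction has the sign opposite to the difference of positions.\<close>

lemma boundary_drift_ineq:
  fixes x1 x2 d1 d2 e1 e2 :: real
  assumes "x1 > c \<and> e1 = d1 \<or> x1 = c \<and> e1 = max d1 0"
    and "x2 > c \<and> e2 = d2 \<or> x2 = c \<and> e2 = max d2 0"
  shows "(x1 - x2) * (e1 - e2) \<le> (x1 - x2) * (d1 - d2)"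
proof -
  consider "e1 = d1" "e2 = d2" | "x1 = c" "x2 > c" "e1 \<ge> d1" "e2 = d2" | "x1 > c" "x2 = c" "e1 = d1" "e2 \<ge> d2" | "x1 = x2"
    using assms by auto
  then show ?thesis
  proof cases
    case 2 then show ?thesis by (intro mult_left_mono_neg) auto
  next
    case 3 then show ?thesis by (intro mult_left_mono) auto
  qed auto
qed

context fluid_model begin

lemma fluid_solution_unique:
  assumes 1: "fluid_solution lam beta eps gam a b y1 x1" and 2: "fluid_solution lam beta eps gam a b y2 x2"
    and "t \<ge> 0"
  shows "y1 t = y2 t \<and> x1 t = x2 t"
proof -
  note d1 = 1[unfolded fluid_solution_def] and d2 = 2[unfolded fluid_solution_def]
  have lip1: "\<And>T. 0 \<le> T \<Longrightarrow> \<exists>L. L-lipschitz_on {0..T} y1 \<and> L-lipschitz_on {0..T} x1" using d1 by blast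
  have lip2: "\<And>T. 0 \<le> T \<Longrightarrow> \<exists>L. L-lipschitz_on {0..T} y2 \<and> L-lipschitz_on {0..T} x2" using d2 by blast
  define V where "V s = (y1 s - y2 s)\<^sup>2 + (x1 s - x2 s)\<^sup>2" for s
  define N where "N = {t. 0 < t \<and> \<not> regular_point y1 x1 t} \<union> {t. 0 < t \<and> \<not> regular_point y2 x2 t}"
  have N: "negligible N" unfolding N_def using lip1 lip2 by (intro negligible_Un negligible_nonregular)
  have lipV: "\<exists>L. L-lipschitz_on {0..T} V" if T: "0 \<le> T" for T
  proof -
    obtain L1 L2 where L: "L1-lipschitz_on {0..T} y1" "L1-lipschitz_on {0..T} x1" "L2-lipschitz_on {0..T} y2" "L2-lipschitz_on {0..T} x2"
      using lip1[OF T] lip2[OF T] by blast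
    obtain L3 where "L3-lipschitz_on {0..T} (\<lambda>s. (y1 s - y2 s)\<^sup>2)"
      using lipschitz_on_square[OF lipschitz_on_diff[OF L(1,3)]] by blast
    moreover obtain L4 where "L4-lipschitz_on {0..T} (\<lambda>s. (x1 s - x2 s)\<^sup>2)"
      using lipschitz_on_square[OF lipschitz_on_diff[OF L(2,4)]] by blast
    ultimately show ?thesis unfolding V_def[abs_def] using lipschitz_on_add by blast
  qed
  have derivV: "\<exists>D \<le> (beta + eps) * V s. (V has_real_derivative D) (at s)" if s: "s > 0" "s \<notin> N" for s
  proof -
    define e1 where "e1 = - real gam * beta * x1 s - eps * y1 s"
    define e2 where "e2 = - real gam * beta * x2 s - eps * y2 s"
    \<comment> \<open>At the boundary \<open>beta * x s = - lam\<close>, so both cases share one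
      formula for \<open>y'\<close>, and \<open>x'\<close> is either the free drift \<open>e\<close>
      or its positive part.\<close>
    have rate: "\<exists>D. (y has_real_derivative beta * x s) (at s) \<and> (x has_real_derivative D) (at s) \<and>
        (x s > - lam / beta \<and> D = e \<or> x s = - lam / beta \<and> D = max e 0)"
      if sol: "fluid_solution lam beta eps gam a b y x" and reg: "regular_point y x s"
        and e: "e = - real gam * beta * x s - eps * y s" for x y e
    proof -
      have imp: "x s \<ge> - lam / beta" "(x s > - lam / beta \<longrightarrow>
           (y has_real_derivative beta * x s) (at s) \<and>
           (x has_real_derivative (- real gam * beta * x s - eps * y s)) (at s))"
        "(x s = - lam / beta \<longrightarrow>
           (y has_real_derivative - lam) (at s) \<and>
           (x has_real_derivative max (real gam * lam - eps * y s) 0) (at s))"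
        using sol reg s unfolding fluid_solution_def by auto
      show ?thesis
      proof (cases "x s > - lam / beta")
        case True
        then show ?thesis using imp(2) e by blast
      next
        case False
        then have x: "x s = - lam / beta" using imp(1) by simp
        then have bx: "beta * x s = - lam" using beta_pos by simp
        then have "e = real gam * lam - eps * y s" unfolding e by (simp add: mult.assoc)
        then show ?thesis using imp(3) x bx by auto
      qed
    qed
    have reg: "regular_point y1 x1 s" "regular_point y2 x2 s" using s by (auto simp: N_def)
    from rate[OF 1 reg(1) e1_def] obtain D1 where D1: "(y1 has_real_derivative beta * x1 s) (at s)" "(x1 has_real_derivative D1) (at s)"
      "x1 s > - lam / beta \<and> D1 = e1 \<or> x1 s = - lam / beta \<and> D1 = max e1 0" by blast
    from rate[OF 2 reg(2) e2_def] obtain D2 where D2: "(y2 has_real_derivative beta * x2 s) (at s)" "(x2 has_real_derivative D2) (at s)"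
      "x2 s > - lam / beta \<and> D2 = e2 \<or> x2 s = - lam / beta \<and> D2 = max e2 0" by blast
    define u v where "u = y1 s - y2 s" and "v = x1 s - x2 s"
    have "(V has_real_derivative 2 * (u * (beta * v)) + 2 * (v * (D1 - D2))) (at s)"
      unfolding V_def[abs_def] u_def v_def
      by (rule derivative_eq_intros D1 D2 refl)+ (simp add: algebra_simps)
    moreover have "2 * (u * (beta * v)) + 2 * (v * (D1 - D2)) \<le> (beta + eps) * V s"
    proof -
      have "v * (D1 - D2) \<le> v * (e1 - e2)"
        unfolding v_def by (rule boundary_drift_ineq[OF D1(3) D2(3)])
      also have "e1 - e2 = - (real gam * beta * v) - eps * u"
        by (simp add: e1_def e2_def u_def v_def algebra_simps)
      finally have "2 * (u * (beta * v)) + 2 * (v * (D1 - D2)) \<le>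
         beta * (2 * u * v) + eps * (- (2 * u * v)) - 2 * (real gam * beta * v\<^sup>2)"
        by (simp add: algebra_simps power2_eq_square)
      \<comment> \<open>Both \<open>2 * u * v\<close> and its negative are at most
        \<open>u\<^sup>2 + v\<^sup>2\<close>, and the friction term with \<open>gam\<close> is
        discarded by its sign.\<close>
      also have "\<dots> \<le> beta * (u\<^sup>2 + v\<^sup>2) + eps * (u\<^sup>2 + v\<^sup>2) - 0"
        using beta_pos eps_pos sum_squares_bound[of u v] sum_squares_bound[of u "-v"]
        by (intro add_mono diff_mono mult_left_mono) auto
      finally show ?thesis by (simp add: V_def u_def v_def algebra_simps)
    qed
    ultimately show ?thesis by blast
  qed
  have contV: "continuous_on {0..T} V" for T
    using lipV[of T] lipschitz_on_continuous_on by (cases "0 \<le> T") auto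
  have intV: "V integrable_on {0..T}" for T
    by (rule integrable_continuous_real[OF contV])
  have V0: "V 0 = 0" using d1 d2 by (simp add: V_def)
  obtain K where K: "\<And>s. s \<in> {0..t} \<Longrightarrow> V s \<le> K"
    using continuous_attains_sup[OF compact_Icc _ contV, of t] \<open>t \<ge> 0\<close> by fastforce
  have ineq: "V s \<le> 0 + (beta + eps) * integral {0..s} V" if "s \<in> {0..t}" for s
  proof -
    have s: "0 \<le> s" using that by simp
    obtain L where L: "L-lipschitz_on {0..s} V" using lipV[OF s] by blast
    have KV: "\<bar>(beta + eps) * V u\<bar> \<le> (beta + eps) * K" if "u \<in> {0..s}" for u
      using K[of u] that \<open>s \<in> {0..t}\<close> beta_pos eps_pos by (auto simp: abs_mult V_def)
    have K0: "0 \<le> (beta + eps) * K" using KV[of 0] s by auto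
    \<comment> \<open>Subtracting this integral from \<open>V\<close> leaves a Lipschitz function
      with nonpositive derivative almost everywhere; so the differential inequality becomes the
      integral one required by Gronwall, here with initial constant 0.\<close>
    have "((beta + eps) * K)-lipschitz_on {0..s} (\<lambda>u. 0 + integral {0..u} (\<lambda>u. (beta + eps) * V u))"
      by (rule lipschitz_indefinite_integral[OF integrable_cmult_real[OF intV] KV K0])
    from lipschitz_on_diff[OF L this]
    have "V s - (0 + integral {0..s} (\<lambda>u. (beta + eps) * V u)) \<le> V 0 - (0 + integral {0..0} (\<lambda>u. (beta + eps) * V u))"
    proof (rule lipschitz_ae_derivative_nonpos_imp_le[OF _ s N])
      fix u D assume u: "u \<in> {0<..<s} - N"
        and D: "((\<lambda>t. V t - (0 + integral {0..t} (\<lambda>u. (beta + eps) * V u))) has_real_derivative D) (at u)"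
      obtain D' where D': "D' \<le> (beta + eps) * V u" "(V has_real_derivative D') (at u)"
        using derivV[of u] u by auto
      have "((\<lambda>t. integral {0..t} (\<lambda>u. (beta + eps) * V u)) has_real_derivative (beta + eps) * V u) (at u within {0..s})"
        using u by (intro integral_has_real_derivative continuous_intros contV) auto
      then have "((\<lambda>t. integral {0..t} (\<lambda>u. (beta + eps) * V u)) has_real_derivative (beta + eps) * V u) (at u)"
        using u by (simp add: at_within_Icc_at)
      from DERIV_diff[OF D'(2) this]
      have "((\<lambda>t. V t - (0 + integral {0..t} (\<lambda>u. (beta + eps) * V u))) has_real_derivative D' - (beta + eps) * V u) (at u)"
        by (simp only: add_0)
      then show "D \<le> 0" using DERIV_unique[OF D] D'(1) by simp
    qed
    then show ?thesis by (simp add: V0)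
  qed
  have "V t \<le> 0 * exp ((beta + eps) * t)"
    by (rule gronwall_integral[OF intV K ineq]) (use \<open>t \<ge> 0\<close> beta_pos eps_pos in auto)
  then show ?thesis by (simp add: V_def sum_power2_le_zero_iff)
qed

section \<open>From the integral equations to the differential conditions\<close>

text \<open>Freezing the paths at their initial values for negative times makes them continuous on
  the whole line without affecting derivatives at positive times.\<close>

lemma fluid_exact_solution:
  assumes exact: "\<And>T. fluid_approx 0 T a b y x" and "b \<ge> 0"
  defines "yF \<equiv> \<lambda>t. y (max 0 t)" and "xF \<equiv> \<lambda>t. x (max 0 t) - lam / beta"
  shows "fluid_solution lam beta eps gam a (b - lam / beta) yF xF"
    and "continuous_on UNIV yF" "continuous_on UNIV xF"
proof -
  define f where "f = xfree b y x"
  have y: "y t = ypath a x t" and x: "x t = f t + regulator f t" if "t \<ge> 0" for t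
    using fluid_approxD(4,5)[OF exact, of t t] that by (auto simp: f_def)
  have iy: "y integrable_on {0..T}" and ix: "x integrable_on {0..T}" for T
    using fluid_approxD(1,2)[OF exact] by blast+
  have cf: "continuous_on {0..T} f" for T unfolding f_def by (rule continuous_xfree[OF iy ix])
  have x_nonneg: "x t \<ge> 0" if "t \<ge> 0" for t
    using regulator_upper[OF cf, of t t] x[OF that] that by simp
  have lip: "\<exists>L. L-lipschitz_on {0..T} y \<and> L-lipschitz_on {0..T} x \<and> L-lipschitz_on {0..T} f" if T: "0 \<le> T" for T
  proof -
    obtain K where K: "\<And>t. t \<in> {0..T} \<Longrightarrow> \<bar>y t\<bar> \<le> K \<and> \<bar>x t\<bar> \<le> K"
      using fluid_approxD(3)[OF exact[of T]] by blast
    have K0: "K \<ge> 0" using K[of 0] T by auto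
    define L1 where "L1 = beta * K + lam"
    define L2 where "L2 = real gam * lam + real gam * beta * K + eps * K"
    have L0: "L1 \<ge> 0" "L2 \<ge> 0" using K0 beta_pos eps_pos lam_pos by (auto simp: L1_def L2_def)
    have "L1-lipschitz_on {0..T} (ypath a x)"
      unfolding ypath_def[abs_def]
    proof (rule lipschitz_indefinite_integral[OF integrable_ydrift[OF ix] _ L0(1)])
      fix t assume t: "t \<in> {0..T}"
      have "beta * \<bar>x t\<bar> \<le> beta * K" using K[OF t] beta_pos by simp
      then have "\<bar>beta * x t\<bar> \<le> beta * K" using beta_pos by (simp add: abs_mult)
      then show "\<bar>beta * x t - lam\<bar> \<le> L1" unfolding L1_def using lam_pos by linarith
    qed
    then have Ly: "L1-lipschitz_on {0..T} y"
      by (rule lipschitz_on_transform) (simp add: y)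
    have Lf: "L2-lipschitz_on {0..T} f"
      unfolding f_def xfree_def[abs_def]
    proof (rule lipschitz_indefinite_integral[OF integrable_drift[OF iy ix] _ L0(2)])
      fix t assume t: "t \<in> {0..T}"
      have "real gam * beta * \<bar>x t\<bar> \<le> real gam * beta * K" "eps * \<bar>y t\<bar> \<le> eps * K"
        using K[OF t] beta_pos eps_pos by (auto intro: mult_left_mono)
      then have "\<bar>real gam * beta * x t\<bar> \<le> real gam * beta * K" "\<bar>eps * y t\<bar> \<le> eps * K"
        using beta_pos eps_pos by (simp_all add: abs_mult)
      moreover have "0 \<le> real gam * lam" using lam_pos by simp
      ultimately show "\<bar>real gam * lam - real gam * beta * x t - eps * y t\<bar> \<le> L2" unfolding L2_def by linarith
    qed
    have reg: "\<bar>regulator f t - regulator f s\<bar> \<le> L2 * (t - s)" if st: "0 \<le> s" "s \<le> t" "t \<le> T" for s t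
    proof -
      have "regulator f t \<le> regulator f s + L2 * (t - s)"
      proof (rule regulator_increment[OF cf st(1,2)])
        fix u assume u: "u \<in> {s..t}"
        have "\<bar>f s - f u\<bar> \<le> L2 * (u - s)"
          using lipschitz_onD[OF Lf, of s u] st u by (simp add: dist_real_def)
        also have "\<dots> \<le> L2 * (t - s)" using u L0 by (intro mult_left_mono) auto
        finally show "f s - f u \<le> L2 * (t - s)" by linarith
      qed (use L0 st in simp)
      then show ?thesis using regulator_mono[OF cf st(1,2)] by simp
    qed
    have Lr: "L2-lipschitz_on {0..T} (regulator f)"
    proof (rule lipschitz_onI[OF _ L0(2)])
      fix s t assume "s \<in> {0..T}" "t \<in> {0..T}"
      then show "dist (regulator f s) (regulator f t) \<le> L2 * dist s t"
        using reg[of s t] reg[of t s] by (cases "s \<le> t") (auto simp: dist_real_def abs_minus_commute)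
    qed
    have Lx: "(L2 + L2)-lipschitz_on {0..T} x"
      by (rule lipschitz_on_transform[OF lipschitz_on_add[OF Lf Lr]]) (simp add: x)
    show ?thesis
      by (intro exI[of _ "L1 + (L2 + L2)"] conjI lipschitz_on_le[OF Ly] lipschitz_on_le[OF Lx] lipschitz_on_le[OF Lf])
        (use L0 in auto)
  qed
  have cy: "continuous_on {0..T} y" and cx: "continuous_on {0..T} x" for T
    using lip[of T] lipschitz_on_continuous_on by (cases "0 \<le> T"; fastforce)+
  have cont: "continuous_on UNIV (\<lambda>t. z (max 0 t))" if z: "\<And>T. continuous_on {0..T} z" for z :: "real \<Rightarrow> real"
  proof -
    have "continuous_on {-real n..real n} (\<lambda>t. z (max 0 t))" for n
      by (rule continuous_on_compose2[OF z[of "real n"]]) (auto intro!: continuous_intros)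
    then have "isCont (\<lambda>t. z (max 0 t)) t" for t
    proof -
      obtain n :: nat where "\<bar>t\<bar> < real n" using reals_Archimedean2 by blast
      then have "t \<in> interior {-real n..real n}" by (auto simp: abs_less_iff)
      with \<open>\<And>n. continuous_on {-real n..real n} (\<lambda>t. z (max 0 t))\<close> show ?thesis
        by (rule continuous_on_interior)
    qed
    then show ?thesis by (simp add: continuous_at_imp_continuous_on)
  qed
  show "continuous_on UNIV yF" "continuous_on UNIV xF"
    unfolding yF_def xF_def by (intro continuous_intros cont cy cx)+
  have dy: "(ypath a x has_real_derivative beta * x t - lam) (at t)"
    and df: "(f has_real_derivative real gam * lam - real gam * beta * x t - eps * y t) (at t)" if "t > 0" for t
  proof -
    have "((\<lambda>s. integral {0..s} (\<lambda>u. beta * x u - lam)) has_real_derivative beta * x t - lam) (at t within {0..t+1})"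
      using that by (intro integral_has_real_derivative continuous_intros cx) auto
    then show "(ypath a x has_real_derivative beta * x t - lam) (at t)"
      unfolding ypath_def[abs_def] using that by (auto simp: at_within_Icc_at intro!: derivative_eq_intros)
    have "((\<lambda>s. integral {0..s} (\<lambda>u. real gam * lam - real gam * beta * x u - eps * y u)) has_real_derivative
        real gam * lam - real gam * beta * x t - eps * y t) (at t within {0..t+1})"
      using that by (intro integral_has_real_derivative continuous_intros cx cy) auto
    then show "(f has_real_derivative real gam * lam - real gam * beta * x t - eps * y t) (at t)"
      unfolding f_def xfree_def[abs_def] using that by (auto simp: at_within_Icc_at intro!: derivative_eq_intros)
  qed
  have dyF: "(yF has_real_derivative beta * x t - lam) (at t)" if "t > 0" for t
    by (rule has_field_derivative_transform_within_open[OF dy[OF that], of "{0<..}"])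
      (use that in \<open>auto simp: yF_def y\<close>)
  \<comment> \<open>While the path stays off the boundary the regulator is constant, so
    \<open>xF\<close> differs from \<open>f\<close> locally by a constant.\<close>
  have interior: "(xF has_real_derivative real gam * lam - real gam * beta * x t - eps * y t) (at t)"
    if t: "t > 0" "x t > 0" for t
  proof -
    have "isCont (\<lambda>s. x (max 0 s)) t"
      using cont[of x] cx by (simp add: continuous_on_eq_continuous_at)
    then have "\<forall>\<^sub>F s in at t. 0 < x (max 0 s)"
      using t by (intro order_tendstoD[of _ "x t"]) (auto simp: isCont_def)
    then obtain d where d: "d > 0" "\<And>s. s \<noteq> t \<Longrightarrow> dist s t < d \<Longrightarrow> 0 < x (max 0 s)"
      by (auto simp: eventually_at)
    \<comment> \<open>Halving keeps the closed window strictly inside both the positive times and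
      the region where \<open>x\<close> is positive.\<close>
    define \<delta> where "\<delta> = min d t / 2"
    have \<delta>: "\<delta> > 0" "\<delta> < d" "\<delta> < t" using d t by (auto simp: \<delta>_def min_def)
    have pos: "x s > 0" if "\<bar>s - t\<bar> \<le> \<delta>" for s
      using d(2)[of s] t that \<delta> by (cases "s = t") (auto simp: dist_real_def max_def split: if_splits)
    have const: "regulator f s = regulator f (t - \<delta>)" if "s \<in> {t - \<delta><..<t + \<delta>}" for s
    proof (rule regulator_constant[OF cf])
      fix u assume "u \<in> {t - \<delta>..s}"
      then show "0 < f u + regulator f u" using pos[of u] x[of u] that \<delta> by auto
    qed (use that \<delta> in auto)
    have "((\<lambda>s. f s + (regulator f (t - \<delta>) - lam / beta)) has_real_derivative real gam * lam - real gam * beta * x t - eps * y t) (at t)"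
      using df[OF t(1)] by (auto intro!: derivative_eq_intros)
    then show ?thesis
    proof (rule has_field_derivative_transform_within_open)
      fix s assume s: "s \<in> {t - \<delta><..<t + \<delta>}"
      then show "f s + (regulator f (t - \<delta>) - lam / beta) = xF s"
        using const[OF s] x[of s] \<delta> by (auto simp: xF_def)
    qed (use \<delta> in auto)
  qed
  \<comment> \<open>At the boundary \<open>xF\<close> has a local minimum, so any derivative there
    is 0. The difference from \<open>f\<close> is the regulator up to time shifts of nothing but a
    constant, hence nondecreasing, so the free drift cannot be positive and its positive part is
    also 0.\<close>
  have boundary: "D = 0 \<and> real gam * lam - eps * y t \<le> 0"
    if t: "t > 0" "x t = 0" and D: "(xF has_real_derivative D) (at t)" for t D
  proof -
    have D0: "D = 0"
    proof (rule DERIV_local_min[OF D t(1)])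
      show "\<forall>s. \<bar>t - s\<bar> < t \<longrightarrow> xF t \<le> xF s"
        using t x_nonneg by (auto simp: xF_def)
    qed
    have "((\<lambda>s. xF s + lam / beta - f s) has_real_derivative D - (real gam * lam - real gam * beta * x t - eps * y t)) (at t)"
      using D df[OF t(1)] by (auto intro!: derivative_eq_intros)
    moreover have "mono_on {0<..} (\<lambda>s. xF s + lam / beta - f s)"
      using x regulator_mono[OF cf] by (intro mono_onI) (auto simp: xF_def)
    ultimately have "0 \<le> D - (real gam * lam - real gam * beta * x t - eps * y t)"
      using t by (intro mono_on_imp_deriv_nonneg[where A="{0<..}"]) (auto simp: interior_open)
    then show ?thesis using D0 t by simp
  qed
  show "fluid_solution lam beta eps gam a (b - lam / beta) yF xF"
    unfolding fluid_solution_def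
  proof (intro conjI allI impI)
    show "yF 0 = a" using y[of 0] by (simp add: yF_def ypath_def)
    have "regulator f 0 = 0" using \<open>b \<ge> 0\<close> by (simp add: regulator_def f_def xfree_def)
    then show "xF 0 = b - lam / beta" using x[of 0] by (simp add: xF_def f_def xfree_def)
    fix T :: real assume T: "T \<ge> 0"
    from lip[OF T] obtain L where L: "L-lipschitz_on {0..T} y" "L-lipschitz_on {0..T} x" by blast
    have "L-lipschitz_on {0..T} yF" by (rule lipschitz_on_transform[OF L(1)]) (simp add: yF_def)
    moreover have "L-lipschitz_on {0..T} xF"
      using L(2) unfolding lipschitz_on_def by (auto simp: xF_def dist_real_def)
    ultimately show "\<exists>L. L-lipschitz_on {0..T} yF \<and> L-lipschitz_on {0..T} xF" by blast
  next
    fix t :: real assume "t \<ge> 0"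
    then show "- lam / beta \<le> xF t" using x_nonneg[of t] by (simp add: xF_def)
  next
    fix t :: real assume t: "t > 0" "xF t > - lam / beta"
    then have "x t > 0" by (simp add: xF_def)
    have "beta * x t - lam = beta * xF t" using t beta_pos by (simp add: xF_def field_simps)
    then show "(yF has_real_derivative beta * xF t) (at t)" using dyF[OF t(1)] by simp
    have "real gam * lam - real gam * beta * x t - eps * y t = - real gam * beta * xF t - eps * yF t"
      using t beta_pos by (simp add: xF_def yF_def field_simps)
    then show "(xF has_real_derivative - real gam * beta * xF t - eps * yF t) (at t)"
      using interior[OF t(1) \<open>x t > 0\<close>] by simp
  next
    fix t :: real assume t: "t > 0" "regular_point yF xF t" "xF t = - lam / beta"
    then have x0: "x t = 0" by (simp add: xF_def)
    then show "(yF has_real_derivative - lam) (at t)" using dyF[OF t(1)] by simp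
    obtain D where D: "(xF has_real_derivative D) (at t)"
      using t(2) by (auto simp: regular_point_def real_differentiable_def)
    have "max (real gam * lam - eps * yF t) 0 = D"
      using boundary[OF t(1) x0 D] t(1) by (simp add: yF_def)
    then show "(xF has_real_derivative max (real gam * lam - eps * yF t) 0) (at t)" using D by simp
  qed
qed

end

section \<open>Competing exponential clocks\<close>

definition exp1 :: "real measure" where
  "exp1 = density lborel (exponential_density 1)"

definition clockM :: "(nat \<Rightarrow> real) measure" where
  "clockM = (\<Pi>\<^sub>M n\<in>UNIV. exp1)"

lemma sets_exp1[simp, measurable_cong]: "sets exp1 = sets borel"
  by (simp add: exp1_def)

lemma space_exp1[simp]: "space exp1 = UNIV"
  by (simp add: exp1_def)

lemma prob_space_exp1: "prob_space exp1"
  unfolding exp1_def by (rule prob_space_exponential_density) simp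

lemma product_prob_space_exp1: "product_prob_space (\<lambda>_. exp1)"
  by (simp add: product_prob_space_def product_prob_space_axioms_def product_sigma_finite_def
      prob_space_exp1 prob_space_imp_sigma_finite)

lemma prob_space_clockM: "prob_space clockM"
  unfolding clockM_def by (intro prob_space_PiM prob_space_exp1)

lemma space_clockM[simp]: "space clockM = UNIV"
  by (simp add: clockM_def space_PiM)

lemma UNIV_in_sets_clockM[simp]: "UNIV \<in> sets clockM"
  using sets.top[of clockM] by simp

lemma sets_clockM[measurable_cong]: "sets clockM = sets (\<Pi>\<^sub>M n\<in>UNIV. borel)"
  unfolding clockM_def by (intro sets_PiM_cong) auto

lemma measurable_clock_coordinate[measurable]: "(\<lambda>w. w n) \<in> borel_measurable clockM"
proof -
  have "(\<lambda>w. w n) \<in> borel_measurable (\<Pi>\<^sub>M n\<in>UNIV. (borel :: real measure))"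
    by (rule measurable_component_singleton) simp
  then show ?thesis using measurable_cong_sets[OF sets_clockM refl] by blast
qed

lemma measurable_into_clock:
  assumes "\<And>n. (\<lambda>x. f x n) \<in> borel_measurable M"
  shows "f \<in> measurable M clockM"
proof -
  have "f \<in> measurable M (\<Pi>\<^sub>M n\<in>UNIV. (borel :: real measure))"
    by (rule measurable_PiM_single') (use assms in \<open>auto simp: space_PiM\<close>)
  then show ?thesis using measurable_cong_sets[OF refl sets_clockM] by blast
qed

text \<open>Memorylessness: beyond the level \<open>c\<close> the overshoot is again exponential.
  Both half-lines are needed because ties between clocks are broken by index.\<close>

lemma emeasure_exp1_shift:
  assumes B[measurable]: "B \<in> sets borel" and K: "K = {c..} \<or> K = {c<..}" and "c \<ge> 0"
  shows "emeasure exp1 {b. b \<in> K \<and> b - c \<in> B} = ennreal (exp (- c)) * emeasure exp1 B"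
proof -
  have [measurable]: "K \<in> sets borel" using K by auto
  have "{b. b \<in> K \<and> b - c \<in> B} \<in> sets borel" by measurable
  then have "emeasure exp1 {b. b \<in> K \<and> b - c \<in> B} =
      (\<integral>\<^sup>+b. ennreal (exponential_density 1 b) * indicator {b. b \<in> K \<and> b - c \<in> B} b \<partial>lborel)"
    unfolding exp1_def by (subst emeasure_density) auto
  also have "\<dots> = (\<integral>\<^sup>+x. ennreal (exponential_density 1 (c + x)) * indicator {b. b \<in> K \<and> b - c \<in> B} (c + x) \<partial>lborel)"
    by (subst nn_integral_real_affine[where c=1 and t=c]) auto
  also have "\<dots> = (\<integral>\<^sup>+x. ennreal (exp (- c)) * (ennreal (exponential_density 1 x) * indicator B x) \<partial>lborel)"
  proof (rule nn_integral_cong_AE)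
    \<comment> \<open>At \<open>x = 0\<close> the two kinds of half-line disagree; a single point
      has measure zero.\<close>
    have "AE x in lborel. x \<noteq> (0::real)" by (rule AE_lborel_singleton)
    then show "AE x in lborel. ennreal (exponential_density 1 (c + x)) * indicator {b. b \<in> K \<and> b - c \<in> B} (c + x) =
      ennreal (exp (- c)) * (ennreal (exponential_density 1 x) * indicator B x)"
    proof eventually_elim
      case (elim x)
      then show ?case
        using K \<open>c \<ge> 0\<close>
        by (auto simp: exponential_density_def indicator_def exp_add exp_diff exp_minus ennreal_mult[symmetric] field_simps)
    qed
  qed
  also have "\<dots> = ennreal (exp (- c)) * emeasure exp1 B"
    unfolding exp1_def by (subst nn_integral_cmult) (auto simp: emeasure_density)
  finally show ?thesis .
qed

text \<open>Used twice: with \<open>l\<close> the total rate over the winner's rate it gives the law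
  of the first ring, and with \<open>l = 1 - s\<close> the moment generating function.\<close>

lemma nn_integral_exp1_exp_tail:
  assumes "l > 0" "x \<ge> 0"
  shows "(\<integral>\<^sup>+a. ennreal (exp (- (l - 1) * a)) * indicator {x<..} a \<partial>exp1) = ennreal (exp (- l * x) / l)"
proof -
  have "(\<integral>\<^sup>+a. ennreal (exp (- (l - 1) * a)) * indicator {x<..} a \<partial>exp1) =
     (\<integral>\<^sup>+a. ennreal (exponential_density 1 a) * (ennreal (exp (- (l - 1) * a)) * indicator {x<..} a) \<partial>lborel)"
    unfolding exp1_def by (subst nn_integral_density) auto
  also have "\<dots> = (\<integral>\<^sup>+a. ennreal (exp (- l * a)) * indicator {x..} a \<partial>lborel)"
  proof (rule nn_integral_cong_AE)
    have "AE a in lborel. a \<noteq> (x::real)" by (rule AE_lborel_singleton)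
    then show "AE a in lborel. ennreal (exponential_density 1 a) * (ennreal (exp (- (l - 1) * a)) * indicator {x<..} a) =
       ennreal (exp (- l * a)) * indicator {x..} a"
      by eventually_elim (use assms in \<open>auto simp: exponential_density_def indicator_def ennreal_mult[symmetric] exp_add[symmetric] algebra_simps\<close>)
  qed
  also have "\<dots> = ennreal (0 - (- exp (- l * x) / l))"
  proof (rule nn_integral_FTC_atLeast)
    show "((\<lambda>a. - exp (- l * a) / l) has_real_derivative exp (- l * a)) (at a)" for a
      using assms by (auto intro!: derivative_eq_intros)
    show "((\<lambda>a. - exp (- l * a) / l) \<longlongrightarrow> 0) at_top"
    proof -
      have "filterlim (\<lambda>a. - l * a) at_bot at_top"
        by (rule filterlim_tendsto_neg_mult_at_bot[OF tendsto_const _ filterlim_ident]) (use assms in simp)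
      then have "((\<lambda>a. exp (- l * a)) \<longlongrightarrow> 0) at_top"
        by (rule filterlim_compose[OF exp_at_bot])
      then have "((\<lambda>a. - exp (- l * a) / l) \<longlongrightarrow> - 0 / l) at_top"
        by (intro tendsto_intros) (use assms in auto)
      then show ?thesis by simp
    qed
  qed auto
  finally show ?thesis by simp
qed

lemma emeasure_clock_box:
  assumes "finite J" "\<And>n. n \<in> J \<Longrightarrow> B n \<in> sets borel"
  shows "emeasure clockM {v. \<forall>n\<in>J. v n \<in> B n} = (\<Prod>n\<in>J. emeasure exp1 (B n))"
proof -
  interpret product_prob_space "\<lambda>_. exp1" UNIV by (rule product_prob_space_exp1)
  show ?thesis
    using emeasure_PiM_Collect[of J B] assms by (simp add: clockM_def space_PiM)
qed

lemma box_sets: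
  assumes "finite J" "\<And>n. n \<in> J \<Longrightarrow> B n \<in> sets borel"
  shows "{v. \<forall>n\<in>J. v n \<in> B n} \<in> sets clockM"
proof -
  have "{v \<in> space clockM. v n \<in> B n} \<in> sets clockM" if "n \<in> J" for n
    using measurable_sets[OF measurable_clock_coordinate assms(2)[OF that], of n] by (simp add: vimage_def)
  then have "{v \<in> space clockM. \<forall>n\<in>J. v n \<in> B n} \<in> sets clockM"
    using assms(1) by (intro sets.sets_Collect_finite_All) auto
  then show ?thesis by simp
qed

text \<open>Memorylessness for several clocks at once. Both sides are finite measures in
  \<open>A\<close>, so it is enough to compare them on finite-dimensional boxes, where they
  factor.\<close>

lemma clockM_shift:
  assumes H: "finite H" and c: "\<And>n. n \<in> H \<Longrightarrow> c n \<ge> 0"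
    and K: "\<And>n. n \<in> H \<Longrightarrow> K n = {c n..} \<or> K n = {c n<..}"
    and A: "A \<in> sets clockM"
  shows "emeasure clockM {v. (\<forall>n\<in>H. v n \<in> K n) \<and> (\<lambda>n. if n \<in> H then v n - c n else v n) \<in> A} =
    ennreal (exp (- (\<Sum>n\<in>H. c n))) * emeasure clockM A"
proof -
  interpret P: prob_space clockM by (rule prob_space_clockM)
  let ?f = "\<lambda>(v::nat \<Rightarrow> real) n. if n \<in> H then v n - c n else v n"
  let ?D = "{v. \<forall>n\<in>H. v n \<in> K n}"
  have Kb: "K n \<in> sets borel" if "n \<in> H" for n
    using K[OF that] by (metis atLeast_borel greaterThan_borel)
  have f[measurable]: "?f \<in> measurable clockM clockM"
  proof (rule measurable_into_clock)
    show "(\<lambda>v. ?f v n) \<in> borel_measurable clockM" for n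
      by (cases "n \<in> H") simp_all
  qed
  have D: "?D \<in> sets clockM"
    using box_sets[OF H Kb] .
  define Q where "Q = distr (density clockM (indicator ?D)) clockM ?f"
  have Q: "emeasure Q X = emeasure clockM {v. (\<forall>n\<in>H. v n \<in> K n) \<and> ?f v \<in> X}" if X: "X \<in> sets clockM" for X
  proof -
    have [measurable]: "?f -` X \<in> sets clockM" using measurable_sets[OF f X] by simp
    have "emeasure Q X = (\<integral>\<^sup>+v. indicator ?D v * indicator (?f -` X) v \<partial>clockM)"
      unfolding Q_def using X D f by (subst emeasure_distr) (auto simp: emeasure_density)
    also have "\<dots> = (\<integral>\<^sup>+v. indicator (?D \<inter> ?f -` X) v \<partial>clockM)"
      by (simp add: indicator_inter_arith)
    also have "\<dots> = emeasure clockM (?D \<inter> ?f -` X)"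
      using D by (intro nn_integral_indicator) auto
    also have "?D \<inter> ?f -` X = {v. (\<forall>n\<in>H. v n \<in> K n) \<and> ?f v \<in> X}" by auto
    finally show ?thesis .
  qed
  have "Q = scale_measure (ennreal (exp (- (\<Sum>n\<in>H. c n)))) clockM"
  proof (rule measure_eqI_PiM_infinite[where I=UNIV and M="\<lambda>_. exp1"])
    show "sets Q = sets (Pi\<^sub>M UNIV (\<lambda>_. exp1))"
      "sets (scale_measure (ennreal (exp (- (\<Sum>n\<in>H. c n)))) clockM) = sets (Pi\<^sub>M UNIV (\<lambda>_. exp1))"
      by (simp_all add: Q_def clockM_def)
    show "finite_measure Q"
    proof (rule finite_measureI)
      have "emeasure Q (space Q) = emeasure Q (space clockM)" by (simp add: Q_def)
      also have "\<dots> = emeasure clockM {v. (\<forall>n\<in>H. v n \<in> K n) \<and> ?f v \<in> space clockM}"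
        by (rule Q[OF sets.top])
      finally show "emeasure Q (space Q) \<noteq> \<infinity>" by simp
    qed
    fix B :: "nat \<Rightarrow> real set" and J :: "nat set" assume J: "finite J" and "\<And>n. n \<in> J \<Longrightarrow> B n \<in> sets exp1"
    then have B: "\<And>n. n \<in> J \<Longrightarrow> B n \<in> sets borel" by simp
    \<comment> \<open>Unconstrained sides are added so that the box can be indexed by
      \<open>J\<close> and \<open>H\<close> together.\<close>
    define B' where "B' n = (if n \<in> J then B n else UNIV)" for n
    have B'[measurable]: "B' n \<in> sets borel" for n by (simp add: B'_def B)
    define C where "C n = (if n \<in> H then {b. b \<in> K n \<and> b - c n \<in> B' n} else B' n)" for n
    have C: "C n \<in> sets borel" for n
      unfolding C_def using B' Kb[of n] by (cases "n \<in> H") auto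
    have emb: "prod_emb UNIV (\<lambda>_. exp1) J (Pi\<^sub>E J B) = {v. \<forall>n\<in>J \<union> H. v n \<in> B' n}"
      by (auto simp: prod_emb_def B'_def PiE_iff)
    have meas: "{v. \<forall>n\<in>J \<union> H. v n \<in> B' n} \<in> sets clockM"
      using H J by (intro box_sets) auto
    have "emeasure Q {v. \<forall>n\<in>J \<union> H. v n \<in> B' n} = emeasure clockM {v. \<forall>n\<in>J \<union> H. v n \<in> C n}"
      by (subst Q[OF meas], rule arg_cong[of _ _ "emeasure clockM"]) (auto simp: C_def split: if_splits)
    also have "\<dots> = (\<Prod>n\<in>J \<union> H. emeasure exp1 (C n))"
      using H J C by (intro emeasure_clock_box) auto
    also have "\<dots> = (\<Prod>n\<in>J \<union> H. (if n \<in> H then ennreal (exp (- c n)) else 1) * emeasure exp1 (B' n))"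
      by (intro prod.cong refl) (auto simp: C_def emeasure_exp1_shift[OF B' K c])
    also have "\<dots> = (\<Prod>n\<in>J \<union> H. if n \<in> H then ennreal (exp (- c n)) else 1) * (\<Prod>n\<in>J \<union> H. emeasure exp1 (B' n))"
      by (rule prod.distrib)
    also have "(\<Prod>n\<in>J \<union> H. if n \<in> H then ennreal (exp (- c n)) else 1) = (\<Prod>n\<in>H. ennreal (exp (- c n)))"
      using H J by (intro prod.mono_neutral_cong_right) auto
    also have "\<dots> = ennreal (exp (- (\<Sum>n\<in>H. c n)))"
      using H by (subst prod_ennreal) (auto simp: exp_sum sum_negf[symmetric])
    also have "(\<Prod>n\<in>J \<union> H. emeasure exp1 (B' n)) = emeasure clockM {v. \<forall>n\<in>J \<union> H. v n \<in> B' n}"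
      using H J by (intro emeasure_clock_box[symmetric]) auto
    finally show "emeasure Q (prod_emb UNIV (\<lambda>_. exp1) J (Pi\<^sub>E J B)) =
      emeasure (scale_measure (ennreal (exp (- (\<Sum>n\<in>H. c n)))) clockM) (prod_emb UNIV (\<lambda>_. exp1) J (Pi\<^sub>E J B))"
      by (simp add: emb)
  qed
  with Q[OF A] show ?thesis by simp
qed

text \<open>Coordinate \<open>i\<close> is independent of the others, and since \<open>sh\<close> is
  injective and misses \<open>i\<close>, the reindexed coordinates again form a full sample.\<close>

lemma clockM_fresh:
  assumes sh: "inj sh" "\<And>n. sh n \<noteq> i"
    and E: "{(a, v). \<Phi> a v} \<in> sets (borel \<Otimes>\<^sub>M clockM)"
  shows "emeasure clockM {w. \<Phi> (w i) (\<lambda>n. w (sh n))} = (\<integral>\<^sup>+a. emeasure clockM {v. \<Phi> a v} \<partial>exp1)"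
proof -
  let ?R = "\<Pi>\<^sub>M n\<in>UNIV - {i}. exp1"
  interpret R: prob_space ?R by (intro prob_space_PiM prob_space_exp1)
  have split: "clockM = distr (exp1 \<Otimes>\<^sub>M ?R) clockM (\<lambda>(x, X). X(i := x))"
    using distr_pair_PiM_eq_PiM[of "UNIV - {i}" "\<lambda>_. exp1" i] prob_space_exp1
    by (simp add: clockM_def insert_absorb)
  have reindex: "distr ?R clockM (\<lambda>X n. X (sh n)) = clockM"
    using distr_PiM_reindex[of "UNIV - {i}" "\<lambda>_. exp1" sh UNIV] sh prob_space_exp1
    by (simp add: clockM_def restrict_UNIV Pi_iff cong: distr_cong)
  have m1: "(\<lambda>(x, X). X(i := x)) \<in> measurable (exp1 \<Otimes>\<^sub>M ?R) clockM"
  proof (rule measurable_into_clock)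
    fix n
    show "(\<lambda>p. (case p of (x, X) \<Rightarrow> X(i := x)) n) \<in> borel_measurable (exp1 \<Otimes>\<^sub>M ?R)"
      by (cases "n = i") (auto simp: case_prod_beta)
  qed
  have m2: "(\<lambda>X n. X (sh n)) \<in> measurable ?R clockM"
  proof (rule measurable_into_clock)
    fix n
    have "(\<lambda>X. X (sh n)) \<in> measurable ?R exp1" by (rule measurable_component_singleton) (use sh in auto)
    then show "(\<lambda>X. X (sh n)) \<in> borel_measurable ?R"
      using measurable_cong_sets[OF refl sets_exp1] by blast
  qed
  have Ea: "{v. \<Phi> a v} \<in> sets clockM" for a
    using sets_Pair1[OF E, of a] by (simp add: vimage_def)
  have mE: "{w. \<Phi> (w i) (\<lambda>n. w (sh n))} \<in> sets clockM"
  proof -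
    have "(\<lambda>w. (w i, \<lambda>n. w (sh n))) \<in> measurable clockM (borel \<Otimes>\<^sub>M clockM)"
      by (intro measurable_Pair measurable_into_clock) auto
    from measurable_sets[OF this E] show ?thesis by (simp add: vimage_def)
  qed
  have "emeasure clockM {w. \<Phi> (w i) (\<lambda>n. w (sh n))} =
      emeasure (exp1 \<Otimes>\<^sub>M ?R) ((\<lambda>(x, X). X(i := x)) -` {w. \<Phi> (w i) (\<lambda>n. w (sh n))} \<inter> space (exp1 \<Otimes>\<^sub>M ?R))"
    by (subst split, rule emeasure_distr[OF m1 mE])
  also have "\<dots> = (\<integral>\<^sup>+a. emeasure ?R (Pair a -` ((\<lambda>(x, X). X(i := x)) -` {w. \<Phi> (w i) (\<lambda>n. w (sh n))} \<inter> space (exp1 \<Otimes>\<^sub>M ?R))) \<partial>exp1)"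
    by (rule R.emeasure_pair_measure_alt[OF measurable_sets[OF m1 mE]])
  also have "\<dots> = (\<integral>\<^sup>+a. emeasure clockM {v. \<Phi> a v} \<partial>exp1)"
  proof (rule nn_integral_cong)
    fix a
    have "Pair a -` ((\<lambda>(x, X). X(i := x)) -` {w. \<Phi> (w i) (\<lambda>n. w (sh n))} \<inter> space (exp1 \<Otimes>\<^sub>M ?R)) =
      (\<lambda>X n. X (sh n)) -` {v. \<Phi> a v} \<inter> space ?R"
      using sh by (auto simp: space_pair_measure)
    then show "emeasure ?R (Pair a -` ((\<lambda>(x, X). X(i := x)) -` {w. \<Phi> (w i) (\<lambda>n. w (sh n))} \<inter> space (exp1 \<Otimes>\<^sub>M ?R))) =
      emeasure clockM {v. \<Phi> a v}"
      using emeasure_distr[OF m2 Ea[of a]] reindex by simp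
  qed
  finally show ?thesis .
qed

section \<open>The jump chain driven by the clocks\<close>

locale competing_clocks =
  fixes rate :: "nat \<Rightarrow> 's::countable \<Rightarrow> real" and target :: "nat \<Rightarrow> 's \<Rightarrow> 's"
  assumes rate_nonneg: "0 \<le> rate i s" and total_pos: "0 < (\<Sum>i<4. rate i s)"
begin

text \<open>Coordinate \<open>4 * k + i\<close> of \<open>w\<close> is the \<open>k\<close>-th ring gap of clock \<open>i\<close>; the coordinates below 4 are the
  times left until the next rings.\<close>

definition first_clock :: "'s \<Rightarrow> (nat \<Rightarrow> real) \<Rightarrow> nat \<Rightarrow> bool" where
  "first_clock s w i \<longleftrightarrow> i < 4 \<and> rate i s > 0 \<and> (\<forall>j<4. rate j s > 0 \<longrightarrow> w i / rate i s \<le> w j / rate j s)"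

text \<open>The least index breaks ties, so the winner is determined at every sample point and not
  just almost surely.\<close>

definition winner :: "'s \<Rightarrow> (nat \<Rightarrow> real) \<Rightarrow> nat" where
  "winner s w = (LEAST i. first_clock s w i)"

definition holding :: "'s \<Rightarrow> (nat \<Rightarrow> real) \<Rightarrow> real" where
  "holding s w = w (winner s w) / rate (winner s w) s"

definition residual :: "'s \<Rightarrow> (nat \<Rightarrow> real) \<Rightarrow> nat \<Rightarrow> real" where
  "residual s w n = (if n mod 4 = winner s w then w (n + 4)
     else if n < 4 then w n - rate n s * holding s w else w n)"

definition step :: "'s \<times> (nat \<Rightarrow> real) \<Rightarrow> 's \<times> (nat \<Rightarrow> real)" where
  "step = (\<lambda>(s, w). (target (winner s w) s, residual s w))"

lemma first_clock_exists: "\<exists>i. first_clock s w i"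
proof -
  let ?I = "{i\<in>{..<4}. rate i s > 0}"
  have "?I \<noteq> {}"
  proof
    assume "?I = {}"
    have "rate i s \<le> 0" if "i < 4" for i
    proof -
      have "i \<notin> ?I" using \<open>?I = {}\<close> by blast
      then show ?thesis using that by simp
    qed
    then have "(\<Sum>i<4. rate i s) \<le> 0" by (intro sum_nonpos) simp
    then show False using total_pos[of s] by simp
  qed
  let ?f = "\<lambda>i. w i / rate i s"
  have "Min (?f ` ?I) \<in> ?f ` ?I" using \<open>?I \<noteq> {}\<close> by (intro Min_in) auto
  then obtain i where i: "i \<in> ?I" "?f i = Min (?f ` ?I)" by (metis (no_types, lifting) imageE)
  have "?f i \<le> ?f j" if "j < 4" "rate j s > 0" for j
    unfolding i(2) using that by (intro Min_le) auto
  then show ?thesis using i(1) unfolding first_clock_def by blast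
qed

lemma first_clock_winner: "first_clock s w (winner s w)"
  unfolding winner_def using first_clock_exists by (rule LeastI_ex)

lemma winner_less: "winner s w < 4" and rate_winner: "rate (winner s w) s > 0"
  using first_clock_winner by (auto simp: first_clock_def)

text \<open>Victory of \<open>i\<close> becomes a product of half-lines in the other coordinates,
  strict below \<open>i\<close> and weak above because of the tie rule; this is the form
  \<open>clockM_shift\<close> accepts.\<close>

lemma winner_eq_iff:
  "winner s w = i \<longleftrightarrow> i < 4 \<and> rate i s > 0 \<and>
    (\<forall>j. j < 4 \<and> j \<noteq> i \<and> rate j s > 0 \<longrightarrow>
       w j \<in> (if j < i then {rate j s * (w i / rate i s)<..} else {rate j s * (w i / rate i s)..}))"
  (is "_ \<longleftrightarrow> ?R")
proof -
  have le: "w i / rate i s \<le> w j / rate j s \<longleftrightarrow> rate j s * (w i / rate i s) \<le> w j"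
    and less: "w i / rate i s < w j / rate j s \<longleftrightarrow> rate j s * (w i / rate i s) < w j" if "rate j s > 0" for j
    using that by (simp_all add: pos_le_divide_eq pos_less_divide_eq mult.commute)
  show ?thesis
  proof
    assume w: "winner s w = i"
    then have f: "first_clock s w i" using first_clock_winner[of s w] by simp
    have "w i / rate i s < w j / rate j s" if j: "j < i" "rate j s > 0" for j
    proof -
      have "\<not> first_clock s w j" using j w unfolding winner_def by (metis not_less_Least)
      then obtain k where "k < 4" "rate k s > 0" "w k / rate k s < w j / rate j s"
        using j f by (auto simp: first_clock_def not_le)
      then show ?thesis using f by (force simp: first_clock_def)
    qed
    then show ?R using f le less by (auto simp: first_clock_def)
  next
    assume R: ?R
    have f: "first_clock s w i"
      unfolding first_clock_def
    proof (intro conjI allI impI)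
      fix j assume "j < 4" "rate j s > 0"
      then show "w i / rate i s \<le> w j / rate j s"
        using R le[of j] by (cases "j = i") (auto split: if_splits)
    qed (use R in auto)
    show "winner s w = i"
      unfolding winner_def
    proof (rule Least_equality)
      show "first_clock s w i" by (rule f)
      fix j assume j: "first_clock s w j"
      show "i \<le> j"
      proof (rule ccontr)
        assume "\<not> i \<le> j"
        then have ji: "j < i" "j < 4" "rate j s > 0" using j by (auto simp: first_clock_def)
        then have "w j \<in> (if j < i then {rate j s * (w i / rate i s)<..} else {rate j s * (w i / rate i s)..})"
          using R by blast
        then have "w i / rate i s < w j / rate j s" using ji less[of j] by simp
        moreover have "w j / rate j s \<le> w i / rate i s" using j R unfolding first_clock_def by blast
        ultimately show False by simp
      qed
    qed
  qed
qed

lemma measurable_winner[measurable]: "winner s \<in> measurable clockM (count_space UNIV)"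
proof -
  have "{w \<in> space clockM. first_clock s w i} \<in> sets clockM" for i
  proof (cases "i < 4 \<and> rate i s > 0")
    case True
    have "{w \<in> space clockM. w i / rate i s \<le> w j / rate j s} \<in> sets clockM" for j
      by (rule borel_measurable_le) measurable
    then have "{w \<in> space clockM. \<forall>j\<in>{j. j < 4 \<and> rate j s > 0}. w i / rate i s \<le> w j / rate j s} \<in> sets clockM"
      by (intro sets.sets_Collect_finite_All) auto
    with True show ?thesis by (simp add: first_clock_def imp_conjL)
  next
    case False
    then have "{w \<in> space clockM. first_clock s w i} = {}" by (auto simp: first_clock_def)
    then show ?thesis by simp
  qed
  then have "Measurable.pred clockM (\<lambda>w. first_clock s w i)" for i
    unfolding pred_def by blast
  then show ?thesis unfolding winner_def[abs_def] by (rule measurable_Least)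
qed

lemma measurable_holding[measurable]: "holding s \<in> borel_measurable clockM"
proof -
  have "(\<lambda>w. w (winner s w) / rate (winner s w) s) \<in> borel_measurable clockM"
    by (rule measurable_compose_countable[where g="winner s" and f="\<lambda>i w. w i / rate i s"]) measurable
  then show ?thesis unfolding holding_def[abs_def] .
qed

lemma measurable_residual[measurable]: "residual s \<in> measurable clockM clockM"
proof (rule measurable_into_clock)
  fix n
  have "{w \<in> space clockM. n mod 4 = winner s w} \<in> sets clockM"
    using measurable_sets[OF measurable_winner[of s], of "{n mod 4}"] by (simp add: vimage_def eq_commute)
  then show "(\<lambda>w. residual s w n) \<in> borel_measurable clockM"
    unfolding residual_def by (intro measurable_If) (auto intro!: borel_measurable_diff borel_measurable_times measurable_holding)
qed

lemma measurable_step[measurable]: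
  "step \<in> measurable (count_space UNIV \<Otimes>\<^sub>M clockM) (count_space UNIV \<Otimes>\<^sub>M clockM)"
proof (rule measurable_pair_measure_countable1)
  fix s :: 's
  have "(\<lambda>w. target (winner s w) s) \<in> measurable clockM (count_space UNIV)"
    by (rule measurable_compose[OF measurable_winner]) simp
  then show "(\<lambda>w. step (s, w)) \<in> measurable clockM (count_space UNIV \<Otimes>\<^sub>M clockM)"
    unfolding step_def by simp
qed auto

lemma measurable_step_iterate:
  "(\<lambda>w. (step ^^ n) (s, w)) \<in> measurable clockM (count_space UNIV \<Otimes>\<^sub>M clockM)"
proof (induction n)
  case (Suc n)
  then show ?case using measurable_compose[OF Suc measurable_step] by simp
qed simp

lemma measurable_holding_pair:
  "(\<lambda>(s, w). holding s w) \<in> borel_measurable (count_space UNIV \<Otimes>\<^sub>M clockM)"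
  by (rule measurable_pair_measure_countable1) auto

text \<open>Given the winning clock and its ring, the memoryless residuals of the others together with the
  unused rings form a fresh sample, so the chain restarts independently of its first step.\<close>

lemma emeasure_first_step:
  assumes i: "i < 4" "rate i s > 0" and "u \<ge> 0" and A: "A \<in> sets clockM"
  shows "emeasure clockM {w. winner s w = i \<and> holding s w > u \<and> residual s w \<in> A} =
    ennreal (rate i s / (\<Sum>j<4. rate j s) * exp (- (\<Sum>j<4. rate j s) * u)) * emeasure clockM A"
proof -
  define q where "q = (\<Sum>j<4. rate j s)"
  \<comment> \<open>\<open>sh\<close> removes the winner's used ring and moves its later gaps down
    one place, leaving the rivals' coordinates in position.\<close>
  define sh where "sh n = (if n mod 4 = i then n + 4 else n)" for n :: nat
  have sh: "inj sh" "\<And>n. sh n \<noteq> i"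
    using i by (auto simp: sh_def inj_def split: if_splits)
  define H where "H = {j. j < 4 \<and> j \<noteq> i \<and> rate j s > 0}"
  have H: "finite H" by (simp add: H_def)
  define c where "c a j = rate j s * (a / rate i s)" for a j
  define K where "K a j = (if j < i then {c a j<..} else {c a j..})" for a j
  define \<Phi> where "\<Phi> a v \<longleftrightarrow> a / rate i s > u \<and> (\<forall>n\<in>H. v n \<in> K a n) \<and> (\<lambda>n. if n \<in> H then v n - c a n else v n) \<in> A" for a v
  have ev: "{w. winner s w = i \<and> holding s w > u \<and> residual s w \<in> A} = {w. \<Phi> (w i) (\<lambda>n. w (sh n))}"
  proof (intro Collect_cong)
    fix w
    have "winner s w = i \<longleftrightarrow> (\<forall>n\<in>H. w (sh n) \<in> K (w i) n)"
      unfolding winner_eq_iff using i by (auto simp: H_def K_def c_def sh_def)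
    note win = this
    have hold: "holding s w = w i / rate i s" if "winner s w = i"
      using that by (simp add: holding_def)
    have res: "residual s w = (\<lambda>n. if n \<in> H then w (sh n) - c (w i) n else w (sh n))" if "winner s w = i"
    proof
      fix n
      show "residual s w n = (if n \<in> H then w (sh n) - c (w i) n else w (sh n))"
        using that i rate_nonneg[of n s]
        by (auto simp: residual_def holding_def H_def sh_def c_def)
    qed
    show "(winner s w = i \<and> holding s w > u \<and> residual s w \<in> A) = \<Phi> (w i) (\<lambda>n. w (sh n))"
    proof (cases "winner s w = i")
      case True
      then show ?thesis unfolding \<Phi>_def win[symmetric] hold[OF True] res[OF True] by blast
    next
      case False
      then show ?thesis unfolding \<Phi>_def win[symmetric] by blast
    qed
  qed
  have mf: "(\<lambda>(a, v) n. if n \<in> H then v n - c a n else v n) \<in> measurable (borel \<Otimes>\<^sub>M clockM) clockM"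
  proof (rule measurable_into_clock)
    show "(\<lambda>p. (case p of (a, v) \<Rightarrow> \<lambda>n. if n \<in> H then v n - c a n else v n) n) \<in> borel_measurable (borel \<Otimes>\<^sub>M clockM)" for n
      unfolding c_def by (cases "n \<in> H") (auto simp: case_prod_beta)
  qed
  have E: "{(a, v). \<Phi> a v} \<in> sets (borel \<Otimes>\<^sub>M clockM)"
  proof -
    have 1: "{p \<in> space (borel \<Otimes>\<^sub>M clockM). fst p / rate i s > u} \<in> sets (borel \<Otimes>\<^sub>M clockM)"
      by measurable
    have 2: "{p \<in> space (borel \<Otimes>\<^sub>M clockM). \<forall>n\<in>H. snd p n \<in> K (fst p) n} \<in> sets (borel \<Otimes>\<^sub>M clockM)"
    proof (rule sets.sets_Collect_finite_All[OF _ H])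
      fix n
      show "{p \<in> space (borel \<Otimes>\<^sub>M clockM). snd p n \<in> K (fst p) n} \<in> sets (borel \<Otimes>\<^sub>M clockM)"
        unfolding K_def c_def by (cases "n < i") (simp_all, measurable)
    qed
    have 3: "{p \<in> space (borel \<Otimes>\<^sub>M clockM). (\<lambda>(a, v) n. if n \<in> H then v n - c a n else v n) p \<in> A} \<in> sets (borel \<Otimes>\<^sub>M clockM)"
      using measurable_sets[OF mf A] by (simp add: vimage_def Int_def conj_commute)
    have eq: "{(a, v). \<Phi> a v} = {p \<in> space (borel \<Otimes>\<^sub>M clockM). fst p / rate i s > u} \<inter>
      {p \<in> space (borel \<Otimes>\<^sub>M clockM). \<forall>n\<in>H. snd p n \<in> K (fst p) n} \<inter>
      {p \<in> space (borel \<Otimes>\<^sub>M clockM). (\<lambda>(a, v) n. if n \<in> H then v n - c a n else v n) p \<in> A}"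
      by (auto simp: \<Phi>_def space_pair_measure)
    show ?thesis unfolding eq by (intro sets.Int 1 2 3)
  qed
  have "emeasure clockM {w. winner s w = i \<and> holding s w > u \<and> residual s w \<in> A} =
     (\<integral>\<^sup>+a. emeasure clockM {v. \<Phi> a v} \<partial>exp1)"
    unfolding ev by (rule clockM_fresh[OF sh E])
  \<comment> \<open>The exponential weight is the probability that all rivals outlast the time
    \<open>a / rate i s\<close>, by memorylessness at the levels \<open>c a n\<close>.\<close>
  also have "\<dots> = (\<integral>\<^sup>+a. ennreal (exp (- (q / rate i s - 1) * a)) * indicator {rate i s * u<..} a * emeasure clockM A \<partial>exp1)"
  proof (rule nn_integral_cong)
    fix a :: real
    have gt: "a / rate i s > u \<longleftrightarrow> a \<in> {rate i s * u<..}"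
      using i by (simp add: pos_less_divide_eq mult.commute)
    show "emeasure clockM {v. \<Phi> a v} = ennreal (exp (- (q / rate i s - 1) * a)) * indicator {rate i s * u<..} a * emeasure clockM A"
    proof (cases "a \<in> {rate i s * u<..}")
      case True
      then have a: "a \<ge> 0" using \<open>u \<ge> 0\<close> i by (smt (verit) greaterThan_iff mult_nonneg_nonneg)
      have "{v. \<Phi> a v} = {v. (\<forall>n\<in>H. v n \<in> K a n) \<and> (\<lambda>n. if n \<in> H then v n - c a n else v n) \<in> A}"
        using True gt by (auto simp: \<Phi>_def)
      also have "emeasure clockM \<dots> = ennreal (exp (- (\<Sum>n\<in>H. c a n))) * emeasure clockM A"
        using a i rate_nonneg by (intro clockM_shift[OF H _ _ A]) (auto simp: c_def K_def)
      also have "- (\<Sum>n\<in>H. c a n) = - (q / rate i s - 1) * a"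
      proof -
        have "(\<Sum>n\<in>H. rate n s) = (\<Sum>n\<in>{..<4} - {i}. rate n s)"
          by (intro sum.mono_neutral_left) (auto simp: H_def less_le rate_nonneg)
        also have "\<dots> = q - rate i s" unfolding q_def by (subst sum_diff1) (use i in auto)
        finally have "(\<Sum>n\<in>H. c a n) = (q - rate i s) * (a / rate i s)"
          by (simp add: c_def sum_distrib_right[symmetric] sum_divide_distrib[symmetric])
        then show ?thesis using i by (simp add: field_simps)
      qed
      finally show ?thesis using True by simp
    next
      case False
      then have "{v. \<Phi> a v} = {}" using gt by (auto simp: \<Phi>_def)
      then show ?thesis using False by simp
    qed
  qed
  also have "\<dots> = (\<integral>\<^sup>+a. ennreal (exp (- (q / rate i s - 1) * a)) * indicator {rate i s * u<..} a \<partial>exp1) * emeasure clockM A"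
  proof (rule nn_integral_multc)
    have "(\<lambda>a. ennreal (exp (- (q / rate i s - 1) * a)) * indicator {rate i s * u<..} a) \<in> borel_measurable borel"
      by measurable
    then show "(\<lambda>a. ennreal (exp (- (q / rate i s - 1) * a)) * indicator {rate i s * u<..} a) \<in> borel_measurable exp1"
      using measurable_cong_sets[OF sets_exp1 refl] by blast
  qed
  also have "(\<integral>\<^sup>+a. ennreal (exp (- (q / rate i s - 1) * a)) * indicator {rate i s * u<..} a \<partial>exp1) =
     ennreal (exp (- (q / rate i s) * (rate i s * u)) / (q / rate i s))"
    using i \<open>u \<ge> 0\<close> total_pos[of s] by (intro nn_integral_exp1_exp_tail) (auto simp: q_def)
  also have "exp (- (q / rate i s) * (rate i s * u)) / (q / rate i s) = rate i s / q * exp (- q * u)"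
    using i by simp
  finally show ?thesis unfolding q_def .
qed

lemma measurable_path_event:
  "{w. (\<forall>k\<le>n. fst ((step ^^ k) (s, w)) = st k) \<and> (\<forall>k<n. case_prod holding ((step ^^ k) (s, w)) > u k)} \<in> sets clockM"
proof -
  have 1: "(\<lambda>w. fst ((step ^^ k) (s, w))) \<in> measurable clockM (count_space UNIV)" for k
    by (rule measurable_compose[OF measurable_step_iterate measurable_fst])
  have 2: "(\<lambda>w. case_prod holding ((step ^^ k) (s, w))) \<in> borel_measurable clockM" for k
    by (rule measurable_compose[OF measurable_step_iterate measurable_holding_pair])
  have "{w \<in> space clockM. fst ((step ^^ k) (s, w)) = st k} \<in> sets clockM" for k
    using measurable_sets[OF 1, of "{st k}" k] by (simp add: vimage_def)
  moreover have "{w \<in> space clockM. case_prod holding ((step ^^ k) (s, w)) > u k} \<in> sets clockM" for k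
    by (rule borel_measurable_less) (use 2 in auto)
  ultimately have "{w \<in> space clockM. (\<forall>k\<in>{..n}. fst ((step ^^ k) (s, w)) = st k) \<and> (\<forall>k\<in>{..<n}. case_prod holding ((step ^^ k) (s, w)) > u k)} \<in> sets clockM"
    by (intro sets.sets_Collect_conj sets.sets_Collect_finite_All) auto
  then show ?thesis by (simp add: atMost_def lessThan_def)
qed

lemma emeasure_path:
  assumes "\<And>k. k < n \<Longrightarrow> u k \<ge> 0"
  shows "emeasure clockM
    {w. (\<forall>k\<le>n. fst ((step ^^ k) (st 0, w)) = st k) \<and> (\<forall>k<n. case_prod holding ((step ^^ k) (st 0, w)) > u k)} =
    ennreal (\<Prod>k<n. (\<Sum>i | i < 4 \<and> target i (st k) = st (Suc k). rate i (st k)) / (\<Sum>i<4. rate i (st k)) *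
       exp (- (\<Sum>i<4. rate i (st k)) * u k))"
  using assms
proof (induction n arbitrary: st u)
  case 0
  interpret P: prob_space clockM by (rule prob_space_clockM)
  show ?case using P.emeasure_space_1 by simp
next
  case (Suc n)
  define s where "s = st 0"
  define q where "q = (\<Sum>i<4. rate i s)"
  define G where "G = {w. (\<forall>k\<le>n. fst ((step ^^ k) (st (Suc 0), w)) = st (Suc k)) \<and>
    (\<forall>k<n. case_prod holding ((step ^^ k) (st (Suc 0), w)) > u (Suc k))}"
  define R where "R = (\<Prod>k<n. (\<Sum>i | i < 4 \<and> target i (st (Suc k)) = st (Suc (Suc k)). rate i (st (Suc k))) / (\<Sum>i<4. rate i (st (Suc k))) *
       exp (- (\<Sum>i<4. rate i (st (Suc k))) * u (Suc k)))"
  have R: "emeasure clockM G = ennreal R"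
    unfolding G_def R_def by (rule Suc.IH[of "\<lambda>k. u (Suc k)" "\<lambda>k. st (Suc k)"]) (use Suc.prems in simp)
  have G: "G \<in> sets clockM" unfolding G_def by (rule measurable_path_event)
  have R0: "R \<ge> 0"
    unfolding R_def using rate_nonneg total_pos less_imp_le by (intro prod_nonneg mult_nonneg_nonneg divide_nonneg_nonneg sum_nonneg ballI) auto
  \<comment> \<open>Several clocks may lead to the same state, so the event is split by winner.
    Clocks of rate zero never win and add nothing to the sum when it is later extended to all clocks
    with this target.\<close>
  define W where "W = {i. i < 4 \<and> target i s = st (Suc 0) \<and> rate i s > 0}"
  have all_le: "(\<forall>k\<le>Suc n. P k) \<longleftrightarrow> P 0 \<and> (\<forall>k\<le>n. P (Suc k))" for P :: "nat \<Rightarrow> bool"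
    by (metis Suc_le_mono le0 not0_implies_Suc)
  have ev: "{w. (\<forall>k\<le>Suc n. fst ((step ^^ k) (s, w)) = st k) \<and> (\<forall>k<Suc n. case_prod holding ((step ^^ k) (s, w)) > u k)} =
    (\<Union>i\<in>W. {w. winner s w = i \<and> holding s w > u 0 \<and> residual s w \<in> G})" (is "?E = _")
  proof (intro set_eqI)
    fix w
    have it: "(step ^^ Suc k) (s, w) = (step ^^ k) (target (winner s w) s, residual s w)" for k
      by (simp add: funpow_Suc_right step_def del: funpow.simps)
    have "w \<in> ?E \<longleftrightarrow> holding s w > u 0 \<and> (\<forall>k\<le>n. fst ((step ^^ k) (target (winner s w) s, residual s w)) = st (Suc k)) \<and>
        (\<forall>k<n. case_prod holding ((step ^^ k) (target (winner s w) s, residual s w)) > u (Suc k))"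
      unfolding mem_Collect_eq all_le All_less_Suc2 it by (auto simp: s_def)
    also have "\<dots> \<longleftrightarrow> holding s w > u 0 \<and> target (winner s w) s = st (Suc 0) \<and> residual s w \<in> G"
    proof (cases "target (winner s w) s = st (Suc 0)")
      case False
      then have "fst ((step ^^ 0) (target (winner s w) s, residual s w)) \<noteq> st (Suc 0)" by simp
      then show ?thesis using False by blast
    qed (simp add: G_def)
    also have "\<dots> \<longleftrightarrow> w \<in> (\<Union>i\<in>W. {w. winner s w = i \<and> holding s w > u 0 \<and> residual s w \<in> G})"
      using winner_less[of s w] rate_winner[of s w] by (auto simp: W_def)
    finally show "w \<in> ?E \<longleftrightarrow> w \<in> (\<Union>i\<in>W. {w. winner s w = i \<and> holding s w > u 0 \<and> residual s w \<in> G})" .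
  qed
  have meas: "{w. winner s w = i \<and> holding s w > u 0 \<and> residual s w \<in> G} \<in> sets clockM" for i
  proof -
    have "{w \<in> space clockM. winner s w = i} \<in> sets clockM"
      using measurable_sets[OF measurable_winner, of "{i}" s] by (simp add: vimage_def)
    moreover have "{w \<in> space clockM. holding s w > u 0} \<in> sets clockM"
      by (rule borel_measurable_less) (use measurable_holding in auto)
    moreover have "{w \<in> space clockM. residual s w \<in> G} \<in> sets clockM"
      using measurable_sets[OF measurable_residual G] by (simp add: vimage_def)
    ultimately have "{w \<in> space clockM. winner s w = i \<and> holding s w > u 0 \<and> residual s w \<in> G} \<in> sets clockM"
      by (intro sets.sets_Collect_conj) auto
    then show ?thesis by simp
  qed
  have "finite W" by (simp add: W_def)
  have "emeasure clockM ?E = (\<Sum>i\<in>W. emeasure clockM {w. winner s w = i \<and> holding s w > u 0 \<and> residual s w \<in> G})"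
    unfolding ev using meas \<open>finite W\<close>
    by (intro sum_emeasure[symmetric]) (auto simp: disjoint_family_on_def)
  also have "\<dots> = (\<Sum>i\<in>W. ennreal (rate i s / q * exp (- q * u 0)) * ennreal R)"
    unfolding q_def R[symmetric] using Suc.prems[of 0] G by (intro sum.cong refl emeasure_first_step) (auto simp: W_def)
  also have "\<dots> = ennreal (\<Sum>i\<in>W. rate i s / q * exp (- q * u 0) * R)"
    using R0 rate_nonneg total_pos[of s] by (simp add: ennreal_mult[symmetric] q_def[symmetric] sum_ennreal)
  also have "(\<Sum>i\<in>W. rate i s / q * exp (- q * u 0) * R) = (\<Sum>i\<in>W. rate i s) / q * exp (- q * u 0) * R"
    by (simp add: sum_distrib_right sum_divide_distrib)
  also have "(\<Sum>i\<in>W. rate i s) = (\<Sum>i | i < 4 \<and> target i s = st (Suc 0). rate i s)"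
    by (intro sum.mono_neutral_left) (auto simp: W_def less_le rate_nonneg)
  finally show ?case
    unfolding prod.lessThan_Suc_shift R_def s_def q_def by (simp add: mult.assoc)
qed

lemma residual_nonneg:
  assumes "\<And>n. w n \<ge> 0"
  shows "holding s w \<ge> 0" "j < 4 \<Longrightarrow> rate j s * holding s w \<le> w j" "residual s w n \<ge> 0"
proof -
  show "holding s w \<ge> 0" using assms rate_winner[of s w] by (simp add: holding_def)
  show le: "rate j s * holding s w \<le> w j" if "j < 4" for j
  proof (cases "rate j s > 0")
    case True
    then have "holding s w \<le> w j / rate j s"
      using first_clock_winner[of s w] that by (simp add: first_clock_def holding_def)
    then show ?thesis using True by (simp add: pos_le_divide_eq mult.commute)
  next
    case False
    then have "rate j s = 0" using rate_nonneg[of j s] by simp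
    then show ?thesis using assms by simp
  qed
  show "residual s w n \<ge> 0" using assms le[of n] by (simp add: residual_def)
qed

text \<open>Absolute values change the clocks on a null set only, but make the holding times nonnegative for
  every sample point.\<close>

definition conf :: "'s \<Rightarrow> (nat \<Rightarrow> real) \<Rightarrow> nat \<Rightarrow> 's \<times> (nat \<Rightarrow> real)" where
  "conf z \<omega> k = (step ^^ k) (z, \<lambda>n. \<bar>\<omega> n\<bar>)"

definition jump_state :: "'s \<Rightarrow> nat \<Rightarrow> (nat \<Rightarrow> real) \<Rightarrow> 's" where
  "jump_state z k \<omega> = fst (conf z \<omega> k)"

definition jump_hold :: "'s \<Rightarrow> nat \<Rightarrow> (nat \<Rightarrow> real) \<Rightarrow> real" where
  "jump_hold z k \<omega> = case_prod holding (conf z \<omega> k)"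

text \<open>At a time that lies in no holding interval, as after an explosion, \<open>LEAST\<close>
  yields an unspecified but fixed index, so the process is still total and measurable.\<close>

definition process :: "'s \<Rightarrow> real \<Rightarrow> (nat \<Rightarrow> real) \<Rightarrow> 's" where
  "process z t \<omega> = jump_state z (LEAST n. (\<Sum>k<n. jump_hold z k \<omega>) \<le> t \<and> t < (\<Sum>k<Suc n. jump_hold z k \<omega>)) \<omega>"

lemma conf_nonneg: "snd (conf z \<omega> k) n \<ge> 0"
proof (induction k arbitrary: n)
  case (Suc k)
  then show ?case
    using residual_nonneg(3)[of "snd (conf z \<omega> k)"] by (simp add: conf_def step_def case_prod_beta)
qed (simp add: conf_def)

lemma jump_hold_nonneg: "jump_hold z k \<omega> \<ge> 0"
  using residual_nonneg(1)[OF conf_nonneg] by (simp add: jump_hold_def case_prod_beta)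

lemma process_eq:
  assumes "(\<Sum>k<n. jump_hold z k \<omega>) \<le> t" "t < (\<Sum>k<Suc n. jump_hold z k \<omega>)"
  shows "process z t \<omega> = jump_state z n \<omega>"
proof -
  have mono: "(\<Sum>k<m. jump_hold z k \<omega>) \<le> (\<Sum>k<m'. jump_hold z k \<omega>)" if "m \<le> m'" for m m'
    using that by (intro sum_mono2) (auto simp: jump_hold_nonneg)
  have "(LEAST n. (\<Sum>k<n. jump_hold z k \<omega>) \<le> t \<and> t < (\<Sum>k<Suc n. jump_hold z k \<omega>)) = n"
  proof (rule Least_equality)
    show "(\<Sum>k<n. jump_hold z k \<omega>) \<le> t \<and> t < (\<Sum>k<Suc n. jump_hold z k \<omega>)" using assms by blast
    fix m assume m: "(\<Sum>k<m. jump_hold z k \<omega>) \<le> t \<and> t < (\<Sum>k<Suc m. jump_hold z k \<omega>)"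
    show "n \<le> m"
    proof (rule ccontr)
      assume "\<not> n \<le> m"
      then have "(\<Sum>k<Suc m. jump_hold z k \<omega>) \<le> (\<Sum>k<n. jump_hold z k \<omega>)" by (intro mono) auto
      with m assms show False by linarith
    qed
  qed
  then show ?thesis by (simp add: process_def)
qed

lemma measurable_conf: "(\<lambda>\<omega>. conf z \<omega> k) \<in> measurable clockM (count_space UNIV \<Otimes>\<^sub>M clockM)"
  unfolding conf_def
  by (rule measurable_compose[OF measurable_into_clock measurable_step_iterate]) simp

lemma measurable_jump_state: "jump_state z k \<in> measurable clockM (count_space UNIV)"
  unfolding jump_state_def[abs_def] by (rule measurable_compose[OF measurable_conf measurable_fst])

lemma measurable_jump_hold: "jump_hold z k \<in> borel_measurable clockM"
  unfolding jump_hold_def[abs_def] by (rule measurable_compose[OF measurable_conf measurable_holding_pair])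

lemma measurable_process: "process z t \<in> measurable clockM (count_space UNIV)"
  unfolding process_def[abs_def]
proof (rule measurable_compose_countable[OF measurable_jump_state])
  have "Measurable.pred clockM (\<lambda>\<omega>. (\<Sum>k<n. jump_hold z k \<omega>) \<le> t \<and> t < (\<Sum>k<Suc n. jump_hold z k \<omega>))" for n
    using measurable_jump_hold[measurable] by measurable
  then show "(\<lambda>\<omega>. LEAST n. (\<Sum>k<n. jump_hold z k \<omega>) \<le> t \<and> t < (\<Sum>k<Suc n. jump_hold z k \<omega>)) \<in> measurable clockM (count_space UNIV)"
    by (rule measurable_Least)
qed

end

lemma AE_clock_nonneg: "AE \<omega> in clockM. \<forall>n. \<omega> n \<ge> 0"
proof -
  have "AE x in exp1. 0 \<le> x"
    unfolding exp1_def by (subst AE_density) (auto simp: exponential_density_def)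
  then have "AE \<omega> in clockM. 0 \<le> \<omega> n" for n
    unfolding clockM_def using prob_space_exp1 by (intro AE_PiM_component) auto
  then show ?thesis by (simp add: AE_all_countable)
qed

text \<open>Since \<open>jtotal\<close> counts only transitions that change the state, the
  hypotheses on the rates exclude clocks that ring without a jump; clocks with a common target are
  merged in \<open>jrate\<close>.\<close>

lemma is_ctmc_process:
  fixes rate :: "nat \<Rightarrow> state \<Rightarrow> real"
  assumes "competing_clocks rate"
    and jt: "\<And>s. jtotal tr s = (\<Sum>i<4. rate i s)"
    and jr: "\<And>s s'. jrate tr s s' = (\<Sum>i | i < 4 \<and> target i s = s'. rate i s)"
  shows "is_ctmc clockM tr z (competing_clocks.process rate target z)"
proof -
  interpret competing_clocks rate target by fact
  interpret P: prob_space clockM by (rule prob_space_clockM)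
  have "measure clockM {\<omega> \<in> space clockM. (\<forall>k\<le>n. jump_state z k \<omega> = st k) \<and> (\<forall>k<n. jump_hold z k \<omega> > u k)} =
     (if st 0 = z then 1 else 0) * (\<Prod>k<n. (jrate tr (st k) (st (Suc k)) / jtotal tr (st k)) * exp (- jtotal tr (st k) * u k))"
    if u: "\<forall>k<n. u k \<ge> 0" for n st u
  proof (cases "st 0 = z")
    case True
    have "measure clockM {\<omega> \<in> space clockM. (\<forall>k\<le>n. jump_state z k \<omega> = st k) \<and> (\<forall>k<n. jump_hold z k \<omega> > u k)} =
      measure clockM {w. (\<forall>k\<le>n. fst ((step ^^ k) (st 0, w)) = st k) \<and> (\<forall>k<n. case_prod holding ((step ^^ k) (st 0, w)) > u k)}"
    proof (rule measure_eq_AE)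
      show "AE \<omega> in clockM. (\<omega> \<in> {\<omega> \<in> space clockM. (\<forall>k\<le>n. jump_state z k \<omega> = st k) \<and> (\<forall>k<n. jump_hold z k \<omega> > u k)}) =
        (\<omega> \<in> {w. (\<forall>k\<le>n. fst ((step ^^ k) (st 0, w)) = st k) \<and> (\<forall>k<n. case_prod holding ((step ^^ k) (st 0, w)) > u k)})"
        using AE_clock_nonneg
      proof eventually_elim
        case (elim \<omega>)
        then have "(\<lambda>n. \<bar>\<omega> n\<bar>) = \<omega>" by auto
        then show ?case using True by (simp add: jump_state_def jump_hold_def conf_def)
      qed
      have "{\<omega> \<in> space clockM. jump_state z k \<omega> = st k} \<in> sets clockM" for k
        using measurable_sets[OF measurable_jump_state, of "{st k}" z k] by (simp add: vimage_def)
      moreover have "{\<omega> \<in> space clockM. jump_hold z k \<omega> > u k} \<in> sets clockM" for k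
        by (rule borel_measurable_less) (use measurable_jump_hold in auto)
      ultimately have "{\<omega> \<in> space clockM. (\<forall>k\<in>{..n}. jump_state z k \<omega> = st k) \<and> (\<forall>k\<in>{..<n}. jump_hold z k \<omega> > u k)} \<in> sets clockM"
        by (intro sets.sets_Collect_conj sets.sets_Collect_finite_All) auto
      then show "{\<omega> \<in> space clockM. (\<forall>k\<le>n. jump_state z k \<omega> = st k) \<and> (\<forall>k<n. jump_hold z k \<omega> > u k)} \<in> sets clockM"
        by (simp add: atMost_def lessThan_def)
    qed (rule measurable_path_event)
    also have "\<dots> = (\<Prod>k<n. (jrate tr (st k) (st (Suc k)) / jtotal tr (st k)) * exp (- jtotal tr (st k) * u k))"
    proof -
      have "0 \<le> (\<Prod>k<n. (jrate tr (st k) (st (Suc k)) / jtotal tr (st k)) * exp (- jtotal tr (st k) * u k))"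
        unfolding jt jr using rate_nonneg less_imp_le[OF total_pos]
        by (intro prod_nonneg mult_nonneg_nonneg divide_nonneg_nonneg sum_nonneg ballI) auto
      moreover have "emeasure clockM {w. (\<forall>k\<le>n. fst ((step ^^ k) (st 0, w)) = st k) \<and> (\<forall>k<n. case_prod holding ((step ^^ k) (st 0, w)) > u k)} =
         ennreal (\<Prod>k<n. (jrate tr (st k) (st (Suc k)) / jtotal tr (st k)) * exp (- jtotal tr (st k) * u k))"
        unfolding jt jr by (rule emeasure_path) (use u in simp)
      ultimately show ?thesis by (simp add: measure_def)
    qed
    finally show ?thesis using True by simp
  next
    case False
    then have "{\<omega> \<in> space clockM. (\<forall>k\<le>n. jump_state z k \<omega> = st k) \<and> (\<forall>k<n. jump_hold z k \<omega> > u k)} = {}"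
      by (auto simp: jump_state_def conf_def)
    then show ?thesis using False by (simp only: measure_empty) simp
  qed
  then show ?thesis
    unfolding is_ctmc_def
    by (intro exI[of _ "jump_state z"] exI[of _ "jump_hold z"] conjI allI impI
        measurable_jump_state measurable_jump_hold measurable_process)
      (auto intro: process_eq)
qed

section \<open>Strong law of large numbers for ring times\<close>

lemma clock_coordinates_nn_integral_prod:
  assumes idx: "inj_on idx {..<m}" and [measurable]: "g \<in> borel_measurable borel"
  shows "(\<integral>\<^sup>+\<omega>. (\<Prod>j<m. g (\<omega> (idx j))) \<partial>clockM) = (\<integral>\<^sup>+x. g x \<partial>exp1) ^ m"
proof -
  interpret product_prob_space "\<lambda>_. exp1" UNIV by (rule product_prob_space_exp1)
  have g: "g \<in> borel_measurable exp1" using assms(2) measurable_cong_sets[OF sets_exp1 refl] by blast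
  have comp: "(\<lambda>x. g (x j)) \<in> borel_measurable (\<Pi>\<^sub>M n\<in>{..<m}. exp1)" if "j < m" for j
  proof -
    have "(\<lambda>x. x j) \<in> measurable (\<Pi>\<^sub>M n\<in>{..<m}. exp1) exp1"
      using that by (intro measurable_component_singleton) auto
    then show ?thesis using g by (rule measurable_compose)
  qed
  have "(\<integral>\<^sup>+\<omega>. (\<Prod>j<m. g (\<omega> (idx j))) \<partial>clockM) =
    (\<integral>\<^sup>+\<omega>. (\<Prod>j<m. g ((\<lambda>n\<in>{..<m}. \<omega> (idx n)) j)) \<partial>(\<Pi>\<^sub>M n\<in>UNIV. exp1))"
    unfolding clockM_def by (intro nn_integral_cong prod.cong) auto
  also have "\<dots> = (\<integral>\<^sup>+x. (\<Prod>j<m. g (x j)) \<partial>distr (\<Pi>\<^sub>M n\<in>UNIV. exp1) (\<Pi>\<^sub>M n\<in>{..<m}. exp1) (\<lambda>\<omega>. \<lambda>n\<in>{..<m}. \<omega> (idx n)))"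
  proof (rule nn_integral_distr[symmetric])
    show "(\<lambda>\<omega>. \<lambda>n\<in>{..<m}. \<omega> (idx n)) \<in> measurable (\<Pi>\<^sub>M n\<in>UNIV. exp1) (\<Pi>\<^sub>M n\<in>{..<m}. exp1)" by measurable
    have "(\<lambda>x. \<Prod>j<m. g (x j)) \<in> borel_measurable (\<Pi>\<^sub>M n\<in>{..<m}. exp1)"
      using comp by (intro borel_measurable_prod_ennreal) auto
    then show "(\<lambda>x. \<Prod>j<m. g (x j)) \<in> borel_measurable
        (distr (\<Pi>\<^sub>M n\<in>UNIV. exp1) (\<Pi>\<^sub>M n\<in>{..<m}. exp1) (\<lambda>\<omega>. \<lambda>n\<in>{..<m}. \<omega> (idx n)))"
      by (simp only: measurable_distr_eq1)
  qed
  also have "distr (\<Pi>\<^sub>M n\<in>UNIV. exp1) (\<Pi>\<^sub>M n\<in>{..<m}. exp1) (\<lambda>\<omega>. \<lambda>n\<in>{..<m}. \<omega> (idx n)) = (\<Pi>\<^sub>M n\<in>{..<m}. exp1)"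
    using distr_PiM_reindex[of UNIV "\<lambda>_. exp1" idx "{..<m}"] idx prob_space_exp1 by simp
  also have "(\<integral>\<^sup>+x. (\<Prod>j<m. g (x j)) \<partial>(\<Pi>\<^sub>M n\<in>{..<m}. exp1)) = (\<Prod>j<m. \<integral>\<^sup>+x. g x \<partial>exp1)"
    by (rule product_nn_integral_prod) (use g in auto)
  finally show ?thesis by simp
qed

text \<open>The integral equals \<open>1 / (1 - s)\<close>, and \<open>- ln (1 - s)\<close> differs
  from \<open>s\<close> by at most \<open>2 * s\<^sup>2\<close> in this range.\<close>

lemma exp1_mgf_bound:
  assumes "\<bar>s\<bar> \<le> 1 / 2"
  shows "(\<integral>\<^sup>+x. ennreal (exp (s * x)) \<partial>exp1) \<le> ennreal (exp (s + 2 * s\<^sup>2))"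
proof -
  have "AE x in exp1. 0 < x"
  proof -
    have "AE x in lborel. x \<noteq> (0::real)" by (rule AE_lborel_singleton)
    then show ?thesis
      unfolding exp1_def by (subst AE_density) (auto simp: exponential_density_def elim!: eventually_mono)
  qed
  then have "(\<integral>\<^sup>+x. ennreal (exp (s * x)) \<partial>exp1) = (\<integral>\<^sup>+x. ennreal (exp (- (1 - s - 1) * x)) * indicator {0<..} x \<partial>exp1)"
    by (intro nn_integral_cong_AE) (auto elim!: eventually_mono)
  also have "\<dots> = ennreal (exp (- (1 - s) * 0) / (1 - s))"
    by (rule nn_integral_exp1_exp_tail) (use assms in auto)
  also have "\<dots> = ennreal (exp (- ln (1 - s)))"
    using assms by (simp add: exp_minus inverse_eq_divide)
  also have "\<dots> \<le> ennreal (exp (s + 2 * s\<^sup>2))"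
    using abs_ln_one_plus_x_minus_x_bound[of "- s"] assms by (intro ennreal_leI) (auto simp: abs_le_iff)
  finally show ?thesis .
qed

text \<open>Measured on the clock's own unit-speed scale, hence the same for every
  \<open>r\<close>.\<close>

definition ring_time :: "(nat \<Rightarrow> real) \<Rightarrow> nat \<Rightarrow> nat \<Rightarrow> real" where
  "ring_time \<omega> i m = (\<Sum>j<m. \<omega> (4 * j + i))"

lemma measurable_ring_time[measurable]: "(\<lambda>\<omega>. ring_time \<omega> i m) \<in> borel_measurable clockM"
  unfolding ring_time_def by measurable

text \<open>The sign of \<open>s\<close> selects the upper or the lower tail. The size
  \<open>d / 4\<close> minimises the exponent \<open>- \<bar>s\<bar> * d + 2 * s\<^sup>2\<close> per
  ring, with minimum \<open>- d\<^sup>2 / 8\<close>.\<close>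

lemma ring_time_chernoff:
  assumes s: "\<bar>s\<bar> = d / 4" and d: "0 < d" "d \<le> 1"
  shows "measure clockM {\<omega>. s * (ring_time \<omega> i m - m) \<ge> \<bar>s\<bar> * (d * m)} \<le> exp (- (d\<^sup>2 / 8)) ^ m"
proof -
  interpret P: prob_space clockM by (rule prob_space_clockM)
  define c where "c = ennreal (exp (- (s * m) - \<bar>s\<bar> * (d * m)))"
  have "{\<omega>. s * (ring_time \<omega> i m - m) \<ge> \<bar>s\<bar> * (d * m)} =
     {\<omega>\<in>space clockM. 1 \<le> c * ennreal (exp (s * ring_time \<omega> i m))}"
    by (auto simp: c_def ennreal_mult[symmetric] exp_add[symmetric] algebra_simps simp flip: ennreal_1)
  also have "emeasure clockM \<dots> \<le> c * (\<integral>\<^sup>+\<omega>. ennreal (exp (s * ring_time \<omega> i m)) * indicator (space clockM) \<omega> \<partial>clockM)"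
    by (rule nn_integral_Markov_inequality) measurable
  also have "(\<integral>\<^sup>+\<omega>. ennreal (exp (s * ring_time \<omega> i m)) * indicator (space clockM) \<omega> \<partial>clockM) =
    (\<integral>\<^sup>+\<omega>. (\<Prod>j<m. ennreal (exp (s * \<omega> (4 * j + i)))) \<partial>clockM)"
    by (intro nn_integral_cong) (auto simp: ring_time_def sum_distrib_left exp_sum prod_ennreal)
  also have "\<dots> = (\<integral>\<^sup>+x. ennreal (exp (s * x)) \<partial>exp1) ^ m"
    by (rule clock_coordinates_nn_integral_prod) (auto simp: inj_on_def)
  also have "\<dots> \<le> ennreal (exp (s + 2 * s\<^sup>2)) ^ m"
    using s d by (intro power_mono exp1_mgf_bound) auto
  also have "c * ennreal (exp (s + 2 * s\<^sup>2)) ^ m = ennreal (exp (- (s * m) - \<bar>s\<bar> * (d * m)) * exp (s + 2 * s\<^sup>2) ^ m)"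
    by (simp add: c_def ennreal_mult ennreal_power)
  also have "exp (- (s * m) - \<bar>s\<bar> * (d * m)) * exp (s + 2 * s\<^sup>2) ^ m = exp (- (d\<^sup>2 / 8)) ^ m"
  proof -
    have "s\<^sup>2 = (d / 4)\<^sup>2" by (metis s power2_abs)
    then have s2: "s\<^sup>2 = d\<^sup>2 / 16" by (simp add: power_divide)
    have "- (s * m) - \<bar>s\<bar> * (d * m) + real m * (s + 2 * s\<^sup>2) = real m * (- (d\<^sup>2 / 8))"
      unfolding s2 s by (simp add: algebra_simps power2_eq_square)
    then show ?thesis by (simp add: exp_of_nat_mult[symmetric] exp_add[symmetric])
  qed
  finally show ?thesis by (simp add: P.emeasure_eq_measure mult_left_mono)
qed

text \<open>The tail bounds are geometric in \<open>m\<close>, so Borel-Cantelli applies to each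
  tail. Accuracies of the form \<open>1 / Suc k\<close> keep the number of exceptional sets
  countable.\<close>

lemma ring_time_lln: "AE \<omega> in clockM. \<forall>i. (\<lambda>m. ring_time \<omega> i m / m) \<longlonglongrightarrow> 1"
proof -
  interpret P: prob_space clockM by (rule prob_space_clockM)
  have ev: "AE \<omega> in clockM. \<forall>\<^sub>F m in sequentially. \<not> s * (ring_time \<omega> i m - m) \<ge> \<bar>s\<bar> * (d * m)"
    if s: "\<bar>s\<bar> = d / 4" and d: "0 < d" "d \<le> 1" for s d i
  proof -
    define B where "B m = {\<omega>. s * (ring_time \<omega> i m - m) \<ge> \<bar>s\<bar> * (d * m)}" for m
    have "B m \<in> sets clockM" for m
    proof -
      have "{\<omega> \<in> space clockM. \<bar>s\<bar> * (d * m) \<le> s * (ring_time \<omega> i m - m)} \<in> sets clockM"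
        by (rule borel_measurable_le) measurable
      then show ?thesis by (simp add: B_def)
    qed
    moreover have "summable (\<lambda>m. measure clockM (B m))"
    proof (rule summable_comparison_test')
      show "summable (\<lambda>m. exp (- (d\<^sup>2 / 8)) ^ m)" using d by (intro summable_geometric) simp
      show "norm (measure clockM (B m)) \<le> exp (- (d\<^sup>2 / 8)) ^ m" for m
        unfolding B_def using ring_time_chernoff[OF that, of m i] by simp
    qed
    ultimately have "AE \<omega> in clockM. \<forall>\<^sub>F m in sequentially. \<omega> \<in> space clockM - B m"
      by (intro borel_cantelli_AE1) (auto simp: P.emeasure_eq_measure)
    then show ?thesis by (simp add: B_def)
  qed
  have "AE \<omega> in clockM. \<forall>i k. \<forall>\<^sub>F m in sequentially. \<bar>ring_time \<omega> i m / m - 1\<bar> < 1 / Suc k"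
  proof (subst AE_all_countable, intro allI, subst AE_all_countable, intro allI)
    fix i k :: nat
    define d where "d = 1 / real (Suc k)"
    have d: "0 < d" "d \<le> 1" by (auto simp: d_def)
    have "\<bar>d / 4\<bar> = d / 4" "\<bar>- (d / 4)\<bar> = d / 4" using d by auto
    from ev[OF this(1) d, of i] ev[OF this(2) d, of i]
    show "AE \<omega> in clockM. \<forall>\<^sub>F m in sequentially. \<bar>ring_time \<omega> i m / m - 1\<bar> < 1 / Suc k"
    proof eventually_elim
      case (elim \<omega>)
      from elim eventually_gt_at_top[of 0] show ?case
      proof eventually_elim
        case (elim m)
        have d4: "d / 4 > 0" "\<bar>d / 4\<bar> = d / 4" "\<bar>- (d / 4)\<bar> = d / 4"
          "- (d / 4) * (ring_time \<omega> i m - m) = d / 4 * (m - ring_time \<omega> i m)"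
          using d by (auto simp: algebra_simps)
        have "\<not> d * m \<le> ring_time \<omega> i m - m" "\<not> d * m \<le> m - ring_time \<omega> i m"
          using elim(1,2) unfolding d4(2-4) mult_le_cancel_left_pos[OF d4(1)] by blast+
        then have "\<bar>ring_time \<omega> i m - m\<bar> < d * m" by linarith
        moreover have "ring_time \<omega> i m / m - 1 = (ring_time \<omega> i m - m) / m"
          using elim(3) by (simp add: diff_divide_distrib)
        then have "\<bar>ring_time \<omega> i m / m - 1\<bar> = \<bar>ring_time \<omega> i m - m\<bar> / m" by simp
        ultimately show ?case using elim(3) unfolding d_def[symmetric] by (simp add: pos_divide_less_eq)
      qed
    qed
  qed
  then show ?thesis
  proof eventually_elim
    case (elim \<omega>)
    show ?case
    proof (intro allI tendstoI)
      fix i and e :: real assume "e > 0"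
      then obtain k where k: "1 / Suc k < e" using reals_Archimedean by (auto simp: inverse_eq_divide)
      show "\<forall>\<^sub>F m in sequentially. dist (ring_time \<omega> i m / m) 1 < e"
        using elim[rule_format, of i k] by eventually_elim (use k in \<open>auto simp: dist_real_def\<close>)
    qed
  qed
qed

section \<open>Ring counts against integrated rates\<close>

context competing_clocks begin

definition wins :: "'s \<Rightarrow> (nat \<Rightarrow> real) \<Rightarrow> nat \<Rightarrow> nat" where
  "wins z \<omega> k = winner (fst (conf z \<omega> k)) (snd (conf z \<omega> k))"

definition rings :: "'s \<Rightarrow> (nat \<Rightarrow> real) \<Rightarrow> nat \<Rightarrow> nat \<Rightarrow> nat" where
  "rings z \<omega> i k = (\<Sum>j<k. if wins z \<omega> j = i then 1 else 0)"

text \<open>The reading of clock \<open>i\<close> on its own scale at the \<open>k\<close>-th jump,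
  that is, its rate integrated along the path.\<close>

definition elapsed :: "'s \<Rightarrow> (nat \<Rightarrow> real) \<Rightarrow> nat \<Rightarrow> nat \<Rightarrow> real" where
  "elapsed z \<omega> i k = (\<Sum>j<k. rate i (jump_state z j \<omega>) * jump_hold z j \<omega>)"

definition jump_time :: "'s \<Rightarrow> (nat \<Rightarrow> real) \<Rightarrow> nat \<Rightarrow> real" where
  "jump_time z \<omega> k = (\<Sum>j<k. jump_hold z j \<omega>)"

lemma jump_state_Suc: "jump_state z (Suc k) \<omega> = target (wins z \<omega> k) (jump_state z k \<omega>)"
  by (simp add: jump_state_def conf_def wins_def step_def case_prod_beta)

lemma jump_state_0: "jump_state z 0 \<omega> = z"
  by (simp add: jump_state_def conf_def)

lemma wins_less: "wins z \<omega> k < 4" and rate_wins: "rate (wins z \<omega> k) (jump_state z k \<omega>) > 0"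
  by (simp_all add: wins_def jump_state_def winner_less rate_winner)

lemma jump_time_0: "jump_time z \<omega> 0 = 0"
  and jump_time_Suc: "jump_time z \<omega> (Suc k) = jump_time z \<omega> k + jump_hold z k \<omega>"
  by (simp_all add: jump_time_def)

lemma jump_time_mono: "k \<le> k' \<Longrightarrow> jump_time z \<omega> k \<le> jump_time z \<omega> k'"
  unfolding jump_time_def by (intro sum_mono2) (auto simp: jump_hold_nonneg)

lemma jump_time_nonneg: "0 \<le> jump_time z \<omega> k"
  using jump_time_mono[of 0 k z \<omega>] by (simp add: jump_time_0)

lemma rings_0: "rings z \<omega> i 0 = 0"
  and rings_Suc: "rings z \<omega> i (Suc k) = rings z \<omega> i k + (if wins z \<omega> k = i then 1 else 0)"
  by (simp_all add: rings_def)

lemma rings_mono: "k \<le> k' \<Longrightarrow> rings z \<omega> i k \<le> rings z \<omega> i k'"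
  unfolding rings_def by (intro sum_mono2) auto

lemma rings_total: "(\<Sum>i<4. rings z \<omega> i k) = k"
proof (induction k)
  case (Suc k)
  have "(\<Sum>i<4. rings z \<omega> i (Suc k)) = k + (\<Sum>i<4. if wins z \<omega> k = i then 1 else 0)"
    unfolding rings_Suc sum.distrib Suc ..
  also have "(\<Sum>i<4. if wins z \<omega> k = i then 1 else 0 :: nat) = 1"
    using wins_less[of z \<omega> k] by (subst sum.delta') auto
  finally show ?case by simp
qed (simp add: rings_0)

lemma elapsed_0: "elapsed z \<omega> i 0 = 0"
  and elapsed_Suc: "elapsed z \<omega> i (Suc k) = elapsed z \<omega> i k + rate i (jump_state z k \<omega>) * jump_hold z k \<omega>"
  by (simp_all add: elapsed_def)

lemma elapsed_le:
  assumes "\<And>j. j < k \<Longrightarrow> rate i (jump_state z j \<omega>) \<le> R"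
  shows "elapsed z \<omega> i k \<le> R * jump_time z \<omega> k"
  unfolding elapsed_def jump_time_def sum_distrib_left
  using assms jump_hold_nonneg by (intro sum_mono mult_right_mono) auto

text \<open>The invariant linking the residual clocks to the original ones: the pending coordinate
  is the next ring time minus the reading, and later coordinates hold gaps that are still
  untouched.\<close>

lemma conf_clocks:
  assumes \<omega>: "\<And>n. \<omega> n \<ge> 0" and i: "i < 4"
  shows "snd (conf z \<omega> k) (4 * m + i) =
    (if m = 0 then ring_time \<omega> i (Suc (rings z \<omega> i k)) - elapsed z \<omega> i k else \<omega> (4 * (rings z \<omega> i k + m) + i))"
proof (induction k arbitrary: m)
  case 0
  have "(\<lambda>n. \<bar>\<omega> n\<bar>) = \<omega>" using \<omega> by auto
  then show ?case by (simp add: conf_def rings_0 elapsed_0 ring_time_def)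
next
  case (Suc k)
  define s w where "s = fst (conf z \<omega> k)" and "w = snd (conf z \<omega> k)"
  have res: "snd (conf z \<omega> (Suc k)) = residual s w"
    by (simp add: conf_def s_def w_def step_def case_prod_beta)
  have win: "wins z \<omega> k = winner s w" by (simp add: wins_def s_def w_def)
  have el: "elapsed z \<omega> i (Suc k) = elapsed z \<omega> i k + rate i s * holding s w"
    by (simp add: elapsed_Suc jump_state_def jump_hold_def s_def w_def case_prod_beta)
  have mod: "(4 * m + i) mod 4 = i" "4 * m + i < 4 \<longleftrightarrow> m = 0" "4 * m + i + 4 = 4 * Suc m + i"
    using i by auto
  note IH = Suc[folded w_def]
  show ?case
  proof (cases "winner s w = i")
    \<comment> \<open>The winner's reading has just reached its ring time exactly, so its new
      pending time is one full gap.\<close>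
    case True
    then have "rate i s * holding s w = w i"
      using rate_winner[of s w] by (simp add: holding_def)
    then have "elapsed z \<omega> i (Suc k) = ring_time \<omega> i (Suc (rings z \<omega> i k))"
      using IH[of 0] el by simp
    moreover have "residual s w (4 * m + i) = \<omega> (4 * (rings z \<omega> i k + Suc m) + i)"
      using True IH[of "Suc m"] unfolding residual_def mod by simp
    moreover have "rings z \<omega> i (Suc k) = Suc (rings z \<omega> i k)" using True win by (simp add: rings_Suc)
    ultimately show ?thesis unfolding res by (simp add: ring_time_def)
  next
    case False
    then have c: "rings z \<omega> i (Suc k) = rings z \<omega> i k" using win by (simp add: rings_Suc)
    show ?thesis
    proof (cases "m = 0")
      case True
      then show ?thesis unfolding res residual_def c el using False IH[of 0] i by simp
    next
      case m: False
      then show ?thesis unfolding res residual_def mod c using False IH[of m] by simp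
    qed
  qed
qed

text \<open>With \<open>elapsed_lower\<close> this traps the reading between two consecutive ring
  times during the whole holding interval, which turns ring times into bounds on counts.\<close>

lemma elapsed_upper:
  assumes \<omega>: "\<And>n. \<omega> n \<ge> 0" and i: "i < 4"
  shows "elapsed z \<omega> i k + rate i (jump_state z k \<omega>) * jump_hold z k \<omega> \<le> ring_time \<omega> i (Suc (rings z \<omega> i k))"
proof -
  have "rate i (jump_state z k \<omega>) * jump_hold z k \<omega> \<le> snd (conf z \<omega> k) i"
    using residual_nonneg(2)[OF conf_nonneg i] by (simp add: jump_state_def jump_hold_def case_prod_beta)
  then show ?thesis using conf_clocks[OF \<omega> i, where m=0] by simp
qed

lemma elapsed_lower:
  assumes \<omega>: "\<And>n. \<omega> n \<ge> 0" and i: "i < 4"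
  shows "ring_time \<omega> i (rings z \<omega> i k) \<le> elapsed z \<omega> i k"
proof (induction k)
  case (Suc k)
  show ?case
  proof (cases "wins z \<omega> k = i")
    case True
    have "snd (conf z \<omega> k) i = rate i (jump_state z k \<omega>) * jump_hold z k \<omega>"
      using True rate_winner[of "fst (conf z \<omega> k)" "snd (conf z \<omega> k)"]
      by (simp add: wins_def jump_state_def jump_hold_def case_prod_beta holding_def)
    then show ?thesis
      using True conf_clocks[OF \<omega> i, where m=0 and k=k and z=z] by (simp add: elapsed_Suc rings_Suc)
  next
    case False
    then show ?thesis
      using Suc mult_nonneg_nonneg[OF rate_nonneg[of i "jump_state z k \<omega>"] jump_hold_nonneg[of z k \<omega>]] by (simp add: elapsed_Suc rings_Suc)
  qed
qed (simp add: ring_time_def rings_0 elapsed_0)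

lemma process_at:
  assumes "jump_time z \<omega> n \<le> t" "t < jump_time z \<omega> (Suc n)"
  shows "process z t \<omega> = jump_state z n \<omega>"
  using process_eq assms unfolding jump_time_def by blast

lemma jump_index_exists:
  assumes "0 \<le> t" "t < jump_time z \<omega> m"
  obtains n where "n < m" "jump_time z \<omega> n \<le> t" "t < jump_time z \<omega> (Suc n)"
proof -
  define n where "n = (LEAST k. t < jump_time z \<omega> (Suc k))"
  have "m \<noteq> 0" using assms jump_time_0[of z \<omega>] by (cases "m = 0") auto
  then obtain m' where m': "m = Suc m'" by (cases m) auto
  have "t < jump_time z \<omega> (Suc n)"
    unfolding n_def by (rule LeastI[of _ m']) (use assms m' in simp)
  moreover have "jump_time z \<omega> n \<le> t"
  proof (cases n)
    case (Suc k)
    then have "\<not> t < jump_time z \<omega> (Suc k)" unfolding n_def by (metis lessI not_less_Least)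
    then show ?thesis using Suc by simp
  qed (simp add: jump_time_0 assms)
  moreover have "n \<le> m'" unfolding n_def by (rule Least_le) (use assms m' in simp)
  ultimately show ?thesis using that[of n] m' by simp
qed

lemma process_has_integral:
  fixes g :: "'s \<Rightarrow> real"
  assumes "jump_time z \<omega> n \<le> t" "t \<le> jump_time z \<omega> (Suc n)"
  shows "((\<lambda>s. g (process z s \<omega>)) has_integral
    ((\<Sum>k<n. g (jump_state z k \<omega>) * jump_hold z k \<omega>) + g (jump_state z n \<omega>) * (t - jump_time z \<omega> n))) {0..t}"
  using assms
proof (induction n arbitrary: t)
  have piece: "((\<lambda>s. g (process z s \<omega>)) has_integral (g (jump_state z n \<omega>) * (t - jump_time z \<omega> n))) {jump_time z \<omega> n..t}"
    if "jump_time z \<omega> n \<le> t" "t \<le> jump_time z \<omega> (Suc n)" for n t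
  proof -
    have "((\<lambda>s. g (jump_state z n \<omega>)) has_integral (g (jump_state z n \<omega>) * (t - jump_time z \<omega> n))) {jump_time z \<omega> n..t}"
      using has_integral_const_real[of "g (jump_state z n \<omega>)" "jump_time z \<omega> n" t] that by (simp add: mult.commute)
    then show ?thesis
      \<comment> \<open>At the right end the process may already be in its next state; one point
        does not affect the integral.\<close>
      by (rule has_integral_spike_finite[of "{t}", rotated 2]) (use that in \<open>auto simp: process_at\<close>)
  qed
  {
    case 0
    then show ?case using piece[of 0 t] by (simp add: jump_time_0)
  next
    case (Suc n)
    have "((\<lambda>s. g (process z s \<omega>)) has_integral
      ((\<Sum>k<n. g (jump_state z k \<omega>) * jump_hold z k \<omega>) + g (jump_state z n \<omega>) * (jump_time z \<omega> (Suc n) - jump_time z \<omega> n))) {0..jump_time z \<omega> (Suc n)}"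
      by (rule Suc.IH) (auto intro: jump_time_mono)
    from has_integral_combine[OF jump_time_nonneg Suc.prems(1) this piece[OF Suc.prems]]
    show ?case by (simp add: jump_time_Suc)
  }
qed

end

section \<open>The scaled chain\<close>

lemma sum_less_4: "(\<Sum>i<4. f i) = f 0 + f 1 + f 2 + f (3::nat)" for f :: "nat \<Rightarrow> 'b::comm_monoid_add"
  by (simp add: eval_nat_numeral lessThan_Suc add.assoc add.commute add.left_commute)

context fluid_model begin

text \<open>In units of \<open>r\<close>, the constants \<open>c1\<close>, \<open>c2\<close>,
  \<open>c4\<close>, \<open>c6\<close> bound the rings of clocks 0, 2, 1, 3, while \<open>c3\<close>
  bounds \<open>X\<close> and \<open>c5\<close> bounds \<open>Y\<close>. The sum dominates them
  all.\<close>

definition growth_bound :: "real \<Rightarrow> real \<Rightarrow> real" where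
  "growth_bound T c = (let c1 = 2 * (lam * T + 1); c2 = 2 * (eps * (c + c1) * T + 1);
     c3 = c + real gam * c1 + c2; c4 = 2 * (beta * c3 * T + 1); c5 = c + c1 + c4; c6 = 2 * (eps * c5 * T + 1)
     in c1 + c2 + c3 + c4 + c5 + c6)"

end

section \<open>A priori bounds for the chain\<close>

locale fluid_chain = fluid_model +
  fixes r :: real
  assumes r_pos: "r > 0"
begin

text \<open>Clocks 0 and 1 are arrivals and acceptances; transition (iii) is split into an upward clock 2 and a
  downward clock 3, which lets the rates be bounded one after the other. Clock 3 is switched off at
  \<open>X = 0\<close>, where its transition would change nothing.\<close>

definition crate :: "nat \<Rightarrow> state \<Rightarrow> real" where
  "crate i s = (case s of (Y, X) \<Rightarrow>
     if i = 0 then lam * r else if i = 1 then beta * real X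
     else if i = 2 then (if Y < 0 then eps * - real_of_int Y else 0)
     else (if 0 < Y \<and> 1 \<le> X then eps * real_of_int Y else 0))"

definition ctarget :: "nat \<Rightarrow> state \<Rightarrow> state" where
  "ctarget i s = (case s of (Y, X) \<Rightarrow>
     if i = 0 then (Y - 1, X + gam) else if i = 1 then (Y + 1, X - min gam X)
     else if i = 2 then (Y, X + 1) else (Y, X - 1))"

lemma crate_pair: "crate i (Y, X) = (if i = 0 then lam * r else if i = 1 then beta * real X
     else if i = 2 then (if Y < 0 then eps * - real_of_int Y else 0)
     else (if 0 < Y \<and> 1 \<le> X then eps * real_of_int Y else 0))"
  by (simp add: crate_def)

lemma ctarget_pair: "ctarget i (Y, X) = (if i = 0 then (Y - 1, X + gam) else if i = 1 then (Y + 1, X - min gam X)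
     else if i = 2 then (Y, X + 1) else (Y, X - 1))"
  by (simp add: ctarget_def)

sublocale competing_clocks crate ctarget
proof
  show "0 \<le> crate i s" for i s
    using lam_pos beta_pos eps_pos r_pos by (cases s) (auto simp: crate_pair mult_le_0_iff)
  then have "0 \<le> crate 1 s + crate 2 s + crate 3 s" for s by (simp add: add_nonneg_nonneg)
  moreover have "0 < crate 0 s" for s
    using lam_pos r_pos by (auto simp: crate_def split: prod.split)
  ultimately show "0 < (\<Sum>i<4. crate i s)" for s
    unfolding sum_less_4 by (smt (verit))
qed

lemma jtotal_transitions: "jtotal (transitions lam beta eps gam r) s = (\<Sum>i<4. crate i s)"
  unfolding sum_less_4 by (cases s) (auto simp: jtotal_def transitions_def crate_pair sgn_if)

lemma jrate_transitions:
  "jrate (transitions lam beta eps gam r) s s' = (\<Sum>i | i < 4 \<and> ctarget i s = s'. crate i s)"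
proof -
  have "(\<Sum>i | i < 4 \<and> ctarget i s = s'. crate i s) = (\<Sum>i<4. if ctarget i s = s' then crate i s else 0)"
    by (subst sum.inter_filter[symmetric]) (auto intro!: sum.cong)
  also have "\<dots> = jrate (transitions lam beta eps gam r) s s'"
    unfolding sum_less_4
    by (cases s) (auto simp: jrate_def transitions_def crate_pair ctarget_pair sgn_if)
  finally show ?thesis ..
qed

lemma is_ctmc_fluid_chain: "is_ctmc clockM (transitions lam beta eps gam r) z (process z)"
  by (rule is_ctmc_process) (use competing_clocks_axioms jtotal_transitions jrate_transitions in auto)

definition Yk :: "state \<Rightarrow> (nat \<Rightarrow> real) \<Rightarrow> nat \<Rightarrow> real" where
  "Yk z \<omega> k = real_of_int (fst (jump_state z k \<omega>))"

definition Xk :: "state \<Rightarrow> (nat \<Rightarrow> real) \<Rightarrow> nat \<Rightarrow> real" where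
  "Xk z \<omega> k = real (snd (jump_state z k \<omega>))"

text \<open>What truncation at zero adds to \<open>X\<close> in acceptances, the discrete part of the regulator; its continuous
  part is the integral of \<open>blocked\<close>.\<close>

definition excess :: "state \<Rightarrow> (nat \<Rightarrow> real) \<Rightarrow> nat \<Rightarrow> real" where
  "excess z \<omega> k = Xk z \<omega> k - (Xk z \<omega> 0 + real gam * rings z \<omega> 0 k - real gam * rings z \<omega> 1 k
     + rings z \<omega> 2 k - rings z \<omega> 3 k)"

lemma Xk_nonneg: "Xk z \<omega> k \<ge> 0" by (simp add: Xk_def)

lemma wins_cases: "wins z \<omega> k = 0 \<or> wins z \<omega> k = 1 \<or> wins z \<omega> k = 2 \<or> wins z \<omega> k = 3"
  using wins_less[of z \<omega> k] by linarith

lemma Yk_balance: "Yk z \<omega> k = Yk z \<omega> 0 - rings z \<omega> 0 k + rings z \<omega> 1 k"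
proof (induction k)
  case (Suc k)
  obtain Y X where s: "jump_state z k \<omega> = (Y, X)" by fastforce
  show ?case
    using Suc wins_cases[of z \<omega> k] by (auto simp: Yk_def jump_state_Suc s ctarget_pair rings_Suc)
qed (simp add: rings_0)

lemma Xk_upper: "Xk z \<omega> k \<le> Xk z \<omega> 0 + real gam * rings z \<omega> 0 k + rings z \<omega> 2 k"
proof (induction k)
  case (Suc k)
  obtain Y X where s: "jump_state z k \<omega> = (Y, X)" by fastforce
  have "real (X - min gam X) \<le> real X" "real (X - 1) \<le> real X" by simp_all
  then show ?case
    using Suc wins_cases[of z \<omega> k] by (auto simp: Xk_def jump_state_Suc s ctarget_pair rings_Suc algebra_simps simp del: of_nat_diff)
qed (simp add: rings_0)

lemma excess_0: "excess z \<omega> 0 = 0"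
  by (simp add: excess_def rings_0)

text \<open>The discrete rule that the regulator grows only at the boundary: an acceptance is
  truncated only if fewer than \<open>gam\<close> invitations are pending, and then it lands at 0.
  The downward clock runs only when \<open>X\<close> is at least 1 and never truncates.\<close>

lemma excess_Suc:
  "excess z \<omega> k \<le> excess z \<omega> (Suc k) \<and> (excess z \<omega> k < excess z \<omega> (Suc k) \<longrightarrow> Xk z \<omega> (Suc k) = 0)"
proof -
  obtain Y X where s: "jump_state z k \<omega> = (Y, X)" by fastforce
  have X1: "X \<ge> 1" if "wins z \<omega> k = 3"
    using rate_wins[of z \<omega> k] that by (auto simp: s crate_pair split: if_splits)
  have "real (X - min gam X) = real X - min (real gam) (real X)" by (simp add: min_def)
  then show ?thesis
    using wins_cases[of z \<omega> k] X1
    by (auto simp: excess_def Xk_def jump_state_Suc s ctarget_pair rings_Suc algebra_simps of_nat_diff min_def)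
qed

lemma excess_mono: "k \<le> k' \<Longrightarrow> excess z \<omega> k \<le> excess z \<omega> k'"
  using lift_Suc_mono_le[of "excess z \<omega>"] excess_Suc by blast

text \<open>The bounds come in the order arrivals, negative part of \<open>Y\<close>, upward moves, \<open>X\<close>, acceptances, \<open>Y\<close>,
  downward moves, so that no circularity arises.\<close>

lemma chain_bounds:
  assumes \<omega>: "\<And>n. \<omega> n \<ge> 0" and T: "T \<ge> 0" and c: "c \<ge> 0"
    and low: "\<forall>i<4. \<forall>m. real m \<le> 2 * (ring_time \<omega> i m + r)"
    and z: "\<bar>Yk z \<omega> 0\<bar> \<le> c * r" "Xk z \<omega> 0 \<le> c * r"
    and n: "jump_time z \<omega> n \<le> T"
  shows "\<And>k. k \<le> n \<Longrightarrow> \<bar>Yk z \<omega> k\<bar> \<le> growth_bound T c * r"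
    and "\<And>k. k \<le> n \<Longrightarrow> Xk z \<omega> k \<le> growth_bound T c * r"
    and "\<And>i. i < 4 \<Longrightarrow> rings z \<omega> i n \<le> growth_bound T c * r"
proof -
  have r0: "r \<ge> 0" using r_pos by simp
  define c1 where "c1 = 2 * (lam * T + 1)"
  define c2 where "c2 = 2 * (eps * (c + c1) * T + 1)"
  define c3 where "c3 = c + real gam * c1 + c2"
  define c4 where "c4 = 2 * (beta * c3 * T + 1)"
  define c5 where "c5 = c + c1 + c4"
  define c6 where "c6 = 2 * (eps * c5 * T + 1)"
  have pos: "c1 \<ge> 0" "c2 \<ge> 0" "c3 \<ge> 0" "c4 \<ge> 0" "c5 \<ge> 0" "c6 \<ge> 0"
  proof -
    show 1: "c1 \<ge> 0" using T lam_pos by (simp add: c1_def)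
    show 2: "c2 \<ge> 0" using 1 T c eps_pos by (simp add: c2_def)
    show 3: "c3 \<ge> 0" using 1 2 c by (simp add: c3_def)
    show 4: "c4 \<ge> 0" using 3 T beta_pos by (simp add: c4_def)
    show 5: "c5 \<ge> 0" using 1 4 c by (simp add: c5_def)
    show "c6 \<ge> 0" using 5 T eps_pos by (simp add: c6_def)
  qed
  have B: "growth_bound T c = c1 + c2 + c3 + c4 + c5 + c6"
    unfolding growth_bound_def Let_def c1_def c2_def c3_def c4_def c5_def c6_def by simp
  \<comment> \<open>By \<open>low\<close>, a count is at most twice the sum of its ring time and
    \<open>r\<close>; the ring time is at most the reading, which is at most
    \<open>R * r * T\<close>.\<close>
  have count: "rings z \<omega> i n \<le> 2 * (R * T + 1) * r"
    if i: "i < 4" and "R \<ge> 0" and rate: "\<And>k. k < n \<Longrightarrow> crate i (jump_state z k \<omega>) \<le> R * r" for i R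
  proof -
    have "rings z \<omega> i n \<le> 2 * (ring_time \<omega> i (rings z \<omega> i n) + r)" using low i by blast
    also have "\<dots> \<le> 2 * (elapsed z \<omega> i n + r)" using elapsed_lower[OF \<omega> i] by simp
    also have "elapsed z \<omega> i n \<le> R * r * jump_time z \<omega> n" using rate by (rule elapsed_le)
    also have "\<dots> \<le> R * r * T" using n \<open>R \<ge> 0\<close> r0 by (intro mult_left_mono) auto
    finally show ?thesis by (simp add: algebra_simps)
  qed
  have rmono: "real (rings z \<omega> i k) \<le> rings z \<omega> i n" if "k \<le> n" for i k
    using rings_mono[OF that] by simp
  have A0: "rings z \<omega> 0 n \<le> c1 * r"
    unfolding c1_def by (rule count) (use lam_pos in \<open>auto simp: crate_def split: prod.split\<close>)
  have Ylow: "- Yk z \<omega> k \<le> (c + c1) * r" if "k \<le> n" for k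
  proof -
    have "- Yk z \<omega> k \<le> \<bar>Yk z \<omega> 0\<bar> + rings z \<omega> 0 k" using Yk_balance[of z \<omega> k] by simp
    also have "\<dots> \<le> c * r + c1 * r" using z A0 rmono[OF that, of 0] by linarith
    finally show ?thesis by (simp add: algebra_simps)
  qed
  have A2: "rings z \<omega> 2 n \<le> c2 * r"
    unfolding c2_def
  proof (rule count)
    fix k assume "k < n"
    then have "eps * - Yk z \<omega> k \<le> eps * ((c + c1) * r)"
      using eps_pos by (intro mult_left_mono Ylow) auto
    moreover have "0 \<le> eps * ((c + c1) * r)" using eps_pos c pos r0 by simp
    ultimately show "crate 2 (jump_state z k \<omega>) \<le> eps * (c + c1) * r"
      by (auto simp: crate_def Yk_def mult.assoc split: prod.split)
  qed (use eps_pos c pos in auto)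
  have Xup: "Xk z \<omega> k \<le> c3 * r" if "k \<le> n" for k
  proof -
    have "Xk z \<omega> k \<le> Xk z \<omega> 0 + real gam * rings z \<omega> 0 k + rings z \<omega> 2 k" by (rule Xk_upper)
    also have "\<dots> \<le> c * r + real gam * (c1 * r) + c2 * r"
      using z A0 A2 rmono[OF that, of 0] rmono[OF that, of 2] by (intro add_mono mult_left_mono) linarith+
    finally show ?thesis by (simp add: c3_def algebra_simps)
  qed
  have A1: "rings z \<omega> 1 n \<le> c4 * r"
    unfolding c4_def
  proof (rule count)
    fix k assume "k < n"
    then have "beta * Xk z \<omega> k \<le> beta * (c3 * r)" using Xup[of k] beta_pos by simp
    then show "crate 1 (jump_state z k \<omega>) \<le> beta * c3 * r"
      by (auto simp: crate_def Xk_def mult.assoc split: prod.split)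
  qed (use beta_pos pos in auto)
  have Yup: "\<bar>Yk z \<omega> k\<bar> \<le> c5 * r" if "k \<le> n" for k
  proof -
    have "\<bar>Yk z \<omega> k\<bar> \<le> \<bar>Yk z \<omega> 0\<bar> + rings z \<omega> 0 k + rings z \<omega> 1 k" using Yk_balance[of z \<omega> k] by simp
    also have "\<dots> \<le> c * r + c1 * r + c4 * r"
      using z A0 A1 rmono[OF that, of 0] rmono[OF that, of 1] by linarith
    finally show ?thesis by (simp add: c5_def algebra_simps)
  qed
  have A3: "rings z \<omega> 3 n \<le> c6 * r"
    unfolding c6_def
  proof (rule count)
    fix k assume "k < n"
    then have "eps * \<bar>Yk z \<omega> k\<bar> \<le> eps * (c5 * r)" using Yup[of k] eps_pos by simp
    moreover have "eps * Yk z \<omega> k \<le> eps * \<bar>Yk z \<omega> k\<bar>" using eps_pos by simp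
    moreover have "0 \<le> eps * (c5 * r)" using eps_pos pos r0 by simp
    ultimately show "crate 3 (jump_state z k \<omega>) \<le> eps * c5 * r"
      by (auto simp: crate_def Yk_def mult.assoc split: prod.split)
  qed (use eps_pos pos in auto)
  have le: "c1 * r \<le> growth_bound T c * r" "c2 * r \<le> growth_bound T c * r" "c3 * r \<le> growth_bound T c * r"
    "c4 * r \<le> growth_bound T c * r" "c5 * r \<le> growth_bound T c * r" "c6 * r \<le> growth_bound T c * r"
    unfolding B using pos r0 by (auto intro!: mult_right_mono)
  show "\<And>k. k \<le> n \<Longrightarrow> \<bar>Yk z \<omega> k\<bar> \<le> growth_bound T c * r" using Yup le by (meson order_trans)
  show "\<And>k. k \<le> n \<Longrightarrow> Xk z \<omega> k \<le> growth_bound T c * r" using Xup le by (meson order_trans)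
  fix i :: nat assume "i < 4"
  then have "i = 0 \<or> i = 1 \<or> i = 2 \<or> i = 3" by linarith
  then show "rings z \<omega> i n \<le> growth_bound T c * r" using A0 A1 A2 A3 le by (meson order_trans)
qed

section \<open>The reflected equation for the scaled chain\<close>

definition blocked :: "state \<Rightarrow> real" where
  "blocked s = (case s of (Y, X) \<Rightarrow> if 0 < Y \<and> X = 0 then eps * real_of_int Y else 0)"

lemma blocked_nonneg: "blocked s \<ge> 0"
  using eps_pos by (auto simp: blocked_def split: prod.split)

lemma ydrift_eq_rates: "beta * (real (snd s) / r) - lam = (crate 1 s - crate 0 s) / r"
  using r_pos by (cases s) (simp add: crate_pair diff_divide_distrib)

text \<open>The free drift is linear in the state, but the downward clock stops at
  \<open>X = 0\<close>; \<open>blocked\<close> is exactly the missing downward rate.\<close>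

lemma xdrift_eq_rates:
  "real gam * lam - real gam * beta * (real (snd s) / r) - eps * (real_of_int (fst s) / r) =
   (real gam * crate 0 s - real gam * crate 1 s + crate 2 s - crate 3 s - blocked s) / r"
  using r_pos by (cases s) (auto simp: crate_pair blocked_def field_simps)

text \<open>The total push, \<open>excess\<close> plus the integral of \<open>blocked\<close>, is
  nondecreasing and grows only at \<open>X = 0\<close>. These properties characterise the regulator;
  as the balance holds up to \<open>\<eta>\<close>, the push is within \<open>\<eta>\<close> of it,
  and the path within \<open>2 * \<eta>\<close>.\<close>

lemma chain_fluid_approx:
  assumes \<omega>: "\<And>n. \<omega> n \<ge> 0" and T: "T \<ge> 0" and c: "c \<ge> 0"
    and low: "\<forall>i<4. \<forall>m. real m \<le> 2 * (ring_time \<omega> i m + r)"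
    and close: "\<And>i m. i < 4 \<Longrightarrow> real m \<le> growth_bound T c * r + 1 \<Longrightarrow> \<bar>ring_time \<omega> i m - real m\<bar> \<le> \<delta> * r"
    and \<delta>: "1 \<le> \<delta> * r"
    and z: "\<bar>Yk z \<omega> 0\<bar> \<le> c * r" "Xk z \<omega> 0 \<le> c * r"
    and init: "\<bar>Yk z \<omega> 0 / r - a\<bar> \<le> \<delta>" "\<bar>Xk z \<omega> 0 / r - b\<bar> \<le> \<delta>"
  shows "fluid_approx (2 * ((4 * real gam + 5) * \<delta>)) T a b
    (\<lambda>t. real_of_int (fst (process z t \<omega>)) / r) (\<lambda>t. real (snd (process z t \<omega>)) / r)"
proof -
  note bounds = chain_bounds[OF \<omega> T c low z]
  define jt where "jt = jump_time z \<omega>"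
  define st where "st k = jump_state z k \<omega>" for k
  define A where "A i k = real (rings z \<omega> i k)" for i k
  define h where "h i n t = elapsed z \<omega> i n + crate i (st n) * (t - jt n)" for i n t
  define Yb where "Yb t = real_of_int (fst (process z t \<omega>)) / r" for t
  define Xb where "Xb t = real (snd (process z t \<omega>)) / r" for t
  define D where "D t = integral {0..t} (\<lambda>s. blocked (process z s \<omega>))" for t
  define F where "F = xfree b Yb Xb"
  \<comment> \<open>One \<open>\<delta>\<close> for the initial state and
    \<open>2 * \<delta>\<close> for each of four clocks, those of arrivals and acceptances weighted
    by \<open>gam\<close>.\<close>
  define \<eta> where "\<eta> = (4 * real gam + 5) * \<delta>"
  \<comment> \<open>The right end is included so that the balance also holds just before a jump,
    with the old state.\<close>
  define valid where "valid n t \<longleftrightarrow> jt n \<le> t \<and> t \<le> jt (Suc n) \<and> t \<le> T" for n t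
  have d0: "\<delta> > 0" using \<delta> r_pos by (metis less_le_trans zero_less_mult_pos2 zero_less_one)
  have eta0: "\<eta> \<ge> 0" using d0 by (simp add: \<eta>_def)
  have jt0: "jt n \<ge> 0" for n by (simp add: jt_def jump_time_nonneg)
  \<comment> \<open>No explosion: infinitely many jumps before \<open>T\<close> would make the four
    counts unbounded, against the a priori bound.\<close>
  obtain m where m: "T < jt m"
  proof (rule ccontr)
    assume "\<not> thesis"
    then have all: "jt m \<le> T" for m using that by (meson not_less)
    have "real m \<le> 4 * (growth_bound T c * r)" for m
    proof -
      have "real m = (\<Sum>i<4. real (rings z \<omega> i m))" using rings_total[of z \<omega> m] by (metis of_nat_sum)
      also have "\<dots> \<le> (\<Sum>i<(4::nat). growth_bound T c * r)"
        using bounds(3)[OF all[unfolded jt_def]] by (intro sum_mono) auto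
      finally show ?thesis by simp
    qed
    then show False using reals_Archimedean2 by (meson not_less)
  qed
  have index: "\<exists>n. jt n \<le> t \<and> t < jt (Suc n)" if "t \<in> {0..T}" for t
    using jump_index_exists[of t z \<omega> m] that m by (auto simp: jt_def)
  have int: "((\<lambda>s. g (process z s \<omega>)) has_integral
      ((\<Sum>k<n. g (st k) * jump_hold z k \<omega>) + g (st n) * (t - jt n))) {0..t}" if "valid n t" for n t and g :: "state \<Rightarrow> real"
    using process_has_integral[of z \<omega> n t g] that by (simp add: valid_def jt_def st_def)
  have int_rate: "((\<lambda>s. crate i (process z s \<omega>)) has_integral h i n t) {0..t}" if "valid n t" for i n t
    using int[OF that, of "crate i"] by (simp add: h_def elapsed_def st_def)
  have int_blocked: "((\<lambda>s. blocked (process z s \<omega>)) has_integral D t) {0..t}" if "valid n t" for n t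
    unfolding D_def using int[OF that, of blocked] by (intro integrable_integral) blast
  have integrable: "(\<lambda>s. g (process z s \<omega>)) integrable_on {0..t}" if t: "t \<in> {0..T}" for t and g :: "state \<Rightarrow> real"
  proof -
    obtain n where "jt n \<le> t" "t < jt (Suc n)" using index[OF t] by blast
    then have "valid n t" using t by (simp add: valid_def)
    from int[OF this] show ?thesis by blast
  qed
  \<comment> \<open>One \<open>\<delta> * r\<close> is the deviation of the ring time; the other
    covers the single ring between the two trapping ring times, as
    \<open>1 \<le> \<delta> * r\<close>.\<close>
  have dev: "\<bar>A i n - h i n t\<bar> \<le> 2 * (\<delta> * r)" if v: "valid n t" and i: "i < 4" for i n t
  proof -
    have nT: "jump_time z \<omega> n \<le> T" using v by (simp add: valid_def jt_def)
    have lo: "ring_time \<omega> i (rings z \<omega> i n) \<le> h i n t"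
      using elapsed_lower[where \<omega>=\<omega> and z=z and k=n, OF \<omega> i] mult_nonneg_nonneg[OF rate_nonneg[of i "st n"], of "t - jt n"] v
      by (simp add: h_def valid_def)
    have "crate i (st n) * (t - jt n) \<le> crate i (st n) * jump_hold z n \<omega>"
      using v rate_nonneg by (intro mult_left_mono) (auto simp: valid_def jt_def jump_time_Suc)
    then have up: "h i n t \<le> ring_time \<omega> i (Suc (rings z \<omega> i n))"
      using elapsed_upper[where \<omega>=\<omega> and z=z and k=n, OF \<omega> i] by (simp add: h_def st_def)
    have "real (rings z \<omega> i n) \<le> growth_bound T c * r" using bounds(3)[OF nT i] .
    then have "\<bar>ring_time \<omega> i (rings z \<omega> i n) - real (rings z \<omega> i n)\<bar> \<le> \<delta> * r"
      "\<bar>ring_time \<omega> i (Suc (rings z \<omega> i n)) - real (Suc (rings z \<omega> i n))\<bar> \<le> \<delta> * r"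
      by (intro close[OF i]; simp)+
    then show ?thesis using lo up \<delta> unfolding A_def by simp
  qed
  have dev': "\<bar>(A i n - h i n t) / r\<bar> \<le> 2 * \<delta>" if "valid n t" "i < 4" for i n t
    using dev[OF that] r_pos by (simp add: pos_divide_le_eq)
  have four: "(0::nat) < 4" "(1::nat) < 4" "(2::nat) < 4" "(3::nat) < 4" by simp_all
  have ypath_eq: "ypath a Xb t = a + (h 1 n t - h 0 n t) / r" if "valid n t" for n t
  proof -
    have "((\<lambda>s. (crate 1 (process z s \<omega>) - crate 0 (process z s \<omega>)) / r) has_integral (h 1 n t - h 0 n t) / r) {0..t}"
      by (intro has_integral_divide has_integral_diff int_rate that)
    note i = integral_unique[OF this]
    show ?thesis unfolding ypath_def Xb_def ydrift_eq_rates i ..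
  qed
  have F_eq: "F t = b + (real gam * h 0 n t - real gam * h 1 n t + h 2 n t - h 3 n t - D t) / r" if "valid n t" for n t
  proof -
    have "((\<lambda>s. (real gam * crate 0 (process z s \<omega>) - real gam * crate 1 (process z s \<omega>) + crate 2 (process z s \<omega>)
        - crate 3 (process z s \<omega>) - blocked (process z s \<omega>)) / r) has_integral
        (real gam * h 0 n t - real gam * h 1 n t + h 2 n t - h 3 n t - D t) / r) {0..t}"
      by (intro has_integral_divide has_integral_diff has_integral_add has_integral_mult_right int_rate int_blocked[OF that] that)
    note i = integral_unique[OF this]
    show ?thesis unfolding F_def xfree_def Yb_def Xb_def xdrift_eq_rates i ..
  qed
  have ident: "\<bar>Xk z \<omega> n / r - (F t + (excess z \<omega> n + D t) / r)\<bar> \<le> \<eta>" if v: "valid n t" for n t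
  proof -
    have "Xk z \<omega> n / r - (F t + (excess z \<omega> n + D t) / r) =
       (Xk z \<omega> 0 / r - b) + real gam * ((A 0 n - h 0 n t) / r) - real gam * ((A 1 n - h 1 n t) / r)
       + (A 2 n - h 2 n t) / r - (A 3 n - h 3 n t) / r"
      unfolding F_eq[OF v] excess_def A_def using r_pos by (simp add: field_simps)
    moreover have g: "\<bar>real gam * ((A i n - h i n t) / r)\<bar> \<le> real gam * (2 * \<delta>)" if "i < 4" for i
      using dev'[OF v that] by (simp only: abs_mult abs_of_nat) (intro mult_left_mono, auto)
    have abs5: "\<bar>x1\<bar> \<le> d1 \<Longrightarrow> \<bar>x2\<bar> \<le> d2 \<Longrightarrow> \<bar>x3\<bar> \<le> d2 \<Longrightarrow> \<bar>x4\<bar> \<le> d3 \<Longrightarrow> \<bar>x5\<bar> \<le> d3 \<Longrightarrow>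
      \<bar>x1 + x2 - x3 + x4 - x5\<bar> \<le> d1 + d2 + d2 + d3 + d3" for x1 x2 x3 x4 x5 d1 d2 d3 :: real
      by linarith
    have "\<bar>(Xk z \<omega> 0 / r - b) + real gam * ((A 0 n - h 0 n t) / r) - real gam * ((A 1 n - h 1 n t) / r)
       + (A 2 n - h 2 n t) / r - (A 3 n - h 3 n t) / r\<bar> \<le> \<delta> + real gam * (2 * \<delta>) + real gam * (2 * \<delta>) + 2 * \<delta> + 2 * \<delta>"
      by (rule abs5[OF init(2) g[OF four(1)] g[OF four(2)] dev'[OF v four(3)] dev'[OF v four(4)]])
    ultimately show ?thesis by (simp add: \<eta>_def algebra_simps)
  qed
  have Xnn: "Xk z \<omega> n / r \<ge> 0" for n using Xk_nonneg r_pos by simp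
  have intYX: "Yb integrable_on {0..t}" "Xb integrable_on {0..t}" if "t \<in> {0..T}" for t
    unfolding Yb_def Xb_def using integrable[OF that, of "\<lambda>s. real_of_int (fst s) / r"] integrable[OF that, of "\<lambda>s. real (snd s) / r"] by auto
  have contF: "continuous_on {0..t} F" if "t \<in> {0..T}" for t
    unfolding F_def by (rule continuous_xfree[OF intYX[OF that]])
  have D_mono: "D s \<le> D t" if "0 \<le> s" "s \<le> t" "t \<le> T" for s t
    unfolding D_def by (rule integral_subset_le) (use that integrable blocked_nonneg in auto)
  have D0: "D t \<ge> 0" if "t \<in> {0..T}" for t
    using D_mono[of 0 t] that by (simp add: D_def)
  \<comment> \<open>Within a holding interval either nothing is blocked and the push stays constant,
    or \<open>X = 0\<close> and the balance bounds the push directly by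
    \<open>- F t\<close>.\<close>
  have extend: "(excess z \<omega> n + D t) / r \<le> regulator F t + \<eta>"
    if Q: "(excess z \<omega> n + D (jt n)) / r \<le> regulator F (jt n) + \<eta>" and v: "valid n t" for n t
  proof (cases "blocked (st n) = 0")
    case True
    have vn: "valid n (jt n)" using v by (simp add: valid_def jt_def jump_time_mono)
    have "D t = D (jt n)"
      using has_integral_unique[OF int_blocked[OF v] int[OF v, of blocked]]
        has_integral_unique[OF int_blocked[OF vn] int[OF vn, of blocked]] True by simp
    moreover have "regulator F (jt n) \<le> regulator F t"
      using v jt0 order_trans[OF jt0] by (intro regulator_mono contF) (auto simp: valid_def)
    ultimately show ?thesis using Q by simp
  next
    case False
    then have "Xk z \<omega> n = 0" by (auto simp: Xk_def blocked_def st_def split: prod.splits if_splits)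
    then have "(excess z \<omega> n + D t) / r \<le> - F t + \<eta>" using ident[OF v] by simp
    moreover have "t \<in> {0..T}" using v order_trans[OF jt0] by (auto simp: valid_def)
    then have "- F t \<le> regulator F t" by (intro regulator_upper contF) auto
    ultimately show ?thesis by simp
  qed
  \<comment> \<open>At a jump the push grows only on landing at \<open>X = 0\<close>, where the
    balance again bounds it by \<open>- F\<close>.\<close>
  have Q: "(excess z \<omega> n + D (jt n)) / r \<le> regulator F (jt n) + \<eta>" if "jt n \<le> T" for n
    using that
  proof (induction n)
    case 0
    then show ?case
      using eta0 T regulator_nonneg[OF contF[of 0]] by (simp add: jt_def jump_time_0 excess_0 D_def)
  next
    case (Suc n)
    have le: "jt n \<le> jt (Suc n)" by (simp add: jt_def jump_time_mono)
    have v: "valid n (jt (Suc n))" using Suc.prems le by (simp add: valid_def)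
    show ?case
    proof (cases "excess z \<omega> n < excess z \<omega> (Suc n)")
      case True
      then have "Xk z \<omega> (Suc n) = 0" using excess_Suc by blast
      moreover have "valid (Suc n) (jt (Suc n))" using Suc.prems by (simp add: valid_def jt_def jump_time_mono)
      ultimately have "(excess z \<omega> (Suc n) + D (jt (Suc n))) / r \<le> - F (jt (Suc n)) + \<eta>"
        using ident[of "Suc n" "jt (Suc n)"] by simp
      moreover have "- F (jt (Suc n)) \<le> regulator F (jt (Suc n))"
        using Suc.prems jt0 by (intro regulator_upper contF) auto
      ultimately show ?thesis by simp
    next
      case False
      then have "excess z \<omega> (Suc n) = excess z \<omega> n" using excess_Suc[of z \<omega> n] by simp
      then show ?thesis using extend[OF Suc.IH v] Suc.prems le by simp
    qed
  qed
  \<comment> \<open>Nonnegativity of \<open>X\<close> forces the push at each earlier time to be at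
    least \<open>- F\<close> up to \<open>\<eta>\<close>, and the push never decreases.\<close>
  have lower: "regulator F t \<le> (excess z \<omega> n + D t) / r + \<eta>"
    if t: "t \<in> {0..T}" and n: "jt n \<le> t" "t < jt (Suc n)" for n t
  proof (rule regulator_least)
    have e0: "excess z \<omega> k \<ge> 0" for k using excess_mono[of 0 k] by (simp add: excess_0)
    show "0 \<le> (excess z \<omega> n + D t) / r + \<eta>"
      using e0 D0[OF t] r_pos eta0 by (intro add_nonneg_nonneg divide_nonneg_nonneg) auto
    fix s assume s: "s \<in> {0..t}"
    obtain k where k: "jt k \<le> s" "s < jt (Suc k)" using index[of s] s t by auto
    have "k \<le> n"
    proof (rule ccontr)
      assume "\<not> k \<le> n"
      then have "jt (Suc n) \<le> jt k" by (simp add: jt_def jump_time_mono)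
      then show False using k n s by auto
    qed
    have "valid k s" using k s t by (simp add: valid_def)
    then have "- F s \<le> (excess z \<omega> k + D s) / r + \<eta>" using ident[of k s] Xnn[of k] by linarith
    also have "(excess z \<omega> k + D s) / r \<le> (excess z \<omega> n + D t) / r"
      using excess_mono[OF \<open>k \<le> n\<close>] D_mono[of s t] s t r_pos by (intro divide_right_mono add_mono) auto
    finally show "- F s \<le> (excess z \<omega> n + D t) / r + \<eta>" by simp
  qed (use t in auto)
  have "fluid_approx (2 * \<eta>) T a b Yb Xb"
  proof (rule fluid_approxI)
    show "Yb integrable_on {0..T}" "Xb integrable_on {0..T}" using intYX[of T] T by auto
    fix t assume t: "t \<in> {0..T}"
    obtain n where n: "jt n \<le> t" "t < jt (Suc n)" using index[OF t] by blast
    have v: "valid n t" using n t by (simp add: valid_def)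
    have p: "process z t \<omega> = st n" using process_at[of z \<omega> n t] n by (simp add: jt_def st_def)
    have Yb: "Yb t = Yk z \<omega> n / r" and Xb: "Xb t = Xk z \<omega> n / r"
      by (simp_all add: Yb_def Xb_def p Yk_def Xk_def st_def)
    have nT: "jump_time z \<omega> n \<le> T" using v by (simp add: valid_def jt_def)
    show "\<bar>Yb t\<bar> \<le> growth_bound T c \<and> \<bar>Xb t\<bar> \<le> growth_bound T c"
      unfolding Yb Xb using bounds(1,2)[OF nT order_refl] Xk_nonneg[of z \<omega> n] r_pos
      by (simp add: abs_divide pos_divide_le_eq)
    have "Yb t - ypath a Xb t = (Yk z \<omega> 0 / r - a) - (A 0 n - h 0 n t) / r + (A 1 n - h 1 n t) / r"
      unfolding Yb ypath_eq[OF v] A_def Yk_balance[of z \<omega> n] by (simp add: diff_divide_distrib add_divide_distrib)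
    then have "\<bar>Yb t - ypath a Xb t\<bar> \<le> 5 * \<delta>"
      using dev'[OF v four(1)] dev'[OF v four(2)] init(1) by linarith
    also have "\<dots> \<le> 2 * \<eta>" using d0 by (simp add: \<eta>_def)
    finally show "\<bar>Yb t - ypath a Xb t\<bar> \<le> 2 * \<eta>" .
    have "(excess z \<omega> n + D t) / r \<le> regulator F t + \<eta>"
      using extend[OF Q v] v n(1) by (simp add: valid_def)
    then show "\<bar>Xb t - (xfree b Yb Xb t + regulator (xfree b Yb Xb) t)\<bar> \<le> 2 * \<eta>"
      using ident[OF v] lower[OF t n] unfolding Xb F_def[symmetric] by linarith
  qed
  then show ?thesis by (simp add: Yb_def[abs_def] Xb_def[abs_def] \<eta>_def)
qed

text \<open>A constant of this locale, so that outside it the process can be named for varying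
  \<open>r\<close>.\<close>

definition chain_process :: "state \<Rightarrow> real \<Rightarrow> (nat \<Rightarrow> real) \<Rightarrow> state" where
  "chain_process = process"

end

section \<open>Estimates for all large r\<close>

text \<open>Beyond some \<open>N\<close> the relative error is below
  \<open>\<delta> / (C + 1)\<close> and \<open>m\<close> is at most \<open>(C + 1) * r\<close>; the
  finitely many smaller \<open>m\<close> have a fixed total error, which large \<open>r\<close>
  absorbs.\<close>

lemma eventually_ring_time_close:
  assumes lim: "(\<lambda>m. ring_time \<omega> i m / m) \<longlonglongrightarrow> 1" and "\<delta> > 0" "C \<ge> 0"
  shows "\<forall>\<^sub>F r in at_top. \<forall>m. real m \<le> C * r + 1 \<longrightarrow> \<bar>ring_time \<omega> i m - real m\<bar> \<le> \<delta> * r"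
proof -
  define e where "e = \<delta> / (C + 1)"
  have e: "e > 0" using assms by (simp add: e_def)
  obtain N where N: "\<And>m. m \<ge> N \<Longrightarrow> dist (ring_time \<omega> i m / m) 1 < e"
    using tendstoD[OF lim e] by (auto simp: eventually_sequentially)
  define B where "B = (\<Sum>m\<le>N. \<bar>ring_time \<omega> i m - real m\<bar>)"
  have "\<bar>ring_time \<omega> i m - real m\<bar> \<le> \<delta> * r" if r: "r \<ge> max 1 (B / \<delta>)" and m: "real m \<le> C * r + 1" for r m
  proof (cases "m \<le> N")
    case True
    have "\<bar>ring_time \<omega> i m - real m\<bar> \<le> B"
      unfolding B_def using True by (intro member_le_sum) auto
    also have "\<dots> \<le> \<delta> * r" using r \<open>\<delta> > 0\<close> by (simp add: pos_divide_le_eq mult.commute)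
    finally show ?thesis .
  next
    case False
    then have m0: "real m > 0" by simp
    have "ring_time \<omega> i m - real m = (ring_time \<omega> i m / m - 1) * m" using m0 by (simp add: field_simps)
    then have "\<bar>ring_time \<omega> i m - real m\<bar> = \<bar>ring_time \<omega> i m / m - 1\<bar> * m" by (simp add: abs_mult)
    also have "\<dots> \<le> e * m" using N[of m] False by (intro mult_right_mono) (auto simp: dist_real_def)
    also have "\<dots> \<le> e * ((C + 1) * r)" using m r e by (intro mult_left_mono) (auto simp: algebra_simps)
    also have "\<dots> = \<delta> * r" using \<open>C \<ge> 0\<close> by (simp add: e_def)
    finally show ?thesis .
  qed
  then show ?thesis unfolding eventually_at_top_linorder by blast
qed

text \<open>Cruder than closeness but valid for every \<open>m\<close>, so it can be used before the
  counts are known to be of order \<open>r\<close>.\<close>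

lemma eventually_ring_time_lower:
  assumes lim: "(\<lambda>m. ring_time \<omega> i m / m) \<longlonglongrightarrow> 1" and \<omega>: "\<And>n. \<omega> n \<ge> 0"
  shows "\<forall>\<^sub>F r in at_top. \<forall>m. real m \<le> 2 * (ring_time \<omega> i m + r)"
proof -
  obtain N where N: "\<And>m. m \<ge> N \<Longrightarrow> dist (ring_time \<omega> i m / m) 1 < 1 / 2"
    using tendstoD[OF lim, of "1 / 2"] by (auto simp: eventually_sequentially)
  have "real m \<le> 2 * (ring_time \<omega> i m + r)" if r: "r \<ge> real N" for r m
  proof (cases "m \<le> N")
    case True
    have "ring_time \<omega> i m \<ge> 0" unfolding ring_time_def using \<omega> by (intro sum_nonneg) auto
    then show ?thesis using True r by simp
  next
    case False
    then have "N \<le> m" by simp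
    from N[OF this] have "1 / 2 < ring_time \<omega> i m / m" unfolding dist_real_def by linarith
    then have "real m \<le> 2 * ring_time \<omega> i m" using False by (simp add: pos_less_divide_eq)
    then show ?thesis using r by simp
  qed
  then show ?thesis unfolding eventually_at_top_linorder by blast
qed

lemma (in fluid_model) chain_eventually_fluid_approx:
  assumes \<omega>: "\<And>n. \<omega> n \<ge> 0" and lln: "\<And>i. (\<lambda>m. ring_time \<omega> i m / m) \<longlonglongrightarrow> 1"
    and Y0: "((\<lambda>r. real_of_int (fst (z0 r)) / r) \<longlongrightarrow> a) at_top"
    and X0: "((\<lambda>r. real (snd (z0 r)) / r) \<longlongrightarrow> b) at_top"
    and T: "T \<ge> 0" and e: "e > 0"
  shows "\<forall>\<^sub>F r in at_top. fluid_approx e T a b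
    (\<lambda>t. real_of_int (fst (fluid_chain.chain_process lam beta eps gam r (z0 r) t \<omega>)) / r)
    (\<lambda>t. real (snd (fluid_chain.chain_process lam beta eps gam r (z0 r) t \<omega>)) / r)"
proof -
  \<comment> \<open>The cap 1 keeps the scaled initial states below \<open>c\<close>; the other
    entry makes the final accuracy at most \<open>e\<close>.\<close>
  define \<delta> where "\<delta> = min 1 (e / (2 * (4 * real gam + 5)))"
  have \<delta>: "\<delta> > 0" "\<delta> \<le> 1" "2 * ((4 * real gam + 5) * \<delta>) \<le> e"
  proof -
    show "\<delta> > 0" "\<delta> \<le> 1" using e by (auto simp: \<delta>_def intro!: divide_pos_pos add_nonneg_pos)
    have "\<delta> \<le> e / (2 * (4 * real gam + 5))" by (simp add: \<delta>_def)
    then show "2 * ((4 * real gam + 5) * \<delta>) \<le> e" by (simp add: pos_le_divide_eq algebra_simps)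
  qed
  define c where "c = \<bar>a\<bar> + \<bar>b\<bar> + 1"
  have c: "c \<ge> 0" by (simp add: c_def)
  define G where "G = max 0 (growth_bound T c)"
  have close: "\<forall>\<^sub>F r in at_top. \<forall>i\<in>{..<4}. \<forall>m. real m \<le> G * r + 1 \<longrightarrow> \<bar>ring_time \<omega> i m - real m\<bar> \<le> \<delta> * r"
    by (intro eventually_ball_finite ballI eventually_ring_time_close lln \<delta>) (auto simp: G_def)
  have low: "\<forall>\<^sub>F r in at_top. \<forall>i\<in>{..<4}. \<forall>m. real m \<le> 2 * (ring_time \<omega> i m + r)"
    by (intro eventually_ball_finite ballI eventually_ring_time_lower lln \<omega>) auto
  have yc: "\<forall>\<^sub>F r in at_top. dist (real_of_int (fst (z0 r)) / r) a < \<delta>"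
    and xc: "\<forall>\<^sub>F r in at_top. dist (real (snd (z0 r)) / r) b < \<delta>"
    using tendstoD[OF Y0 \<delta>(1)] tendstoD[OF X0 \<delta>(1)] by auto
  have big: "\<forall>\<^sub>F r in at_top. r > 0 \<and> 1 \<le> \<delta> * r"
    using eventually_ge_at_top[of "1 / \<delta>"] eventually_gt_at_top[of 0]
    by eventually_elim (use \<delta>(1) in \<open>auto simp: pos_divide_le_eq mult.commute\<close>)
  from close low yc xc big show ?thesis
  proof eventually_elim
    case (elim r)
    interpret ch: fluid_chain lam beta eps gam r by unfold_locales (use elim in simp)
    have r0: "r > 0" using elim by simp
    have Y: "ch.Yk (z0 r) \<omega> 0 = real_of_int (fst (z0 r))" and X: "ch.Xk (z0 r) \<omega> 0 = real (snd (z0 r))"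
      by (simp_all add: ch.Yk_def ch.Xk_def ch.jump_state_0)
    have "\<bar>real_of_int (fst (z0 r)) / r\<bar> \<le> c" "real (snd (z0 r)) / r \<le> c"
      using elim(3,4) \<delta>(2) unfolding c_def dist_real_def by linarith+
    then have zb: "\<bar>ch.Yk (z0 r) \<omega> 0\<bar> \<le> c * r" "ch.Xk (z0 r) \<omega> 0 \<le> c * r"
      unfolding Y X using r0 by (simp_all add: abs_divide pos_divide_le_eq)
    have "fluid_approx (2 * ((4 * real gam + 5) * \<delta>)) T a b
      (\<lambda>t. real_of_int (fst (ch.process (z0 r) t \<omega>)) / r) (\<lambda>t. real (snd (ch.process (z0 r) t \<omega>)) / r)"
    proof (rule ch.chain_fluid_approx[OF \<omega> T c _ _ _ zb])
      show "\<forall>i<4. \<forall>m. real m \<le> 2 * (ring_time \<omega> i m + r)" using elim(2) by auto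
      show "1 \<le> \<delta> * r" using elim by simp
      show "\<bar>ch.Yk (z0 r) \<omega> 0 / r - a\<bar> \<le> \<delta>" "\<bar>ch.Xk (z0 r) \<omega> 0 / r - b\<bar> \<le> \<delta>"
        using elim(3,4) unfolding Y X dist_real_def by linarith+
      fix i m :: nat assume i: "i < 4" and m: "real m \<le> growth_bound T c * r + 1"
      have "growth_bound T c * r \<le> G * r" using r0 by (intro mult_right_mono) (auto simp: G_def)
      then show "\<bar>ring_time \<omega> i m - real m\<bar> \<le> \<delta> * r" using elim(1) i m by auto
    qed
    then show ?case unfolding ch.chain_process_def using \<delta>(3) by (rule fluid_approx_mono) simp
  qed
qed

section \<open>Convergence to the fluid limit\<close>

theorem theorem1:
  fixes lam beta eps :: real and gam :: nat and z0 :: "real \<Rightarrow> int \<times> nat" and y0 x0 :: real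
  assumes "lam > 0" and "beta > 0" and "eps > 0" and "gam > 0"
    and "eps < real gam ^ 2 * beta / 4"
    and "((\<lambda>r. real_of_int (fst (z0 r)) / r) \<longlongrightarrow> y0) at_top"
    and "((\<lambda>r. (real (snd (z0 r)) - lam * r / beta) / r) \<longlongrightarrow> x0) at_top"
    and "x0 \<ge> - lam / beta"
  shows "\<exists>(M :: (nat \<Rightarrow> real) measure) (Z :: real \<Rightarrow> real \<Rightarrow> (nat \<Rightarrow> real) \<Rightarrow> int \<times> nat)
            (y :: real \<Rightarrow> real) (x :: real \<Rightarrow> real).
     prob_space M \<and>
     (\<forall>r>0. is_ctmc M (transitions lam beta eps gam r) (z0 r) (Z r)) \<and>
     fluid_solution lam beta eps gam y0 x0 y x \<and>
     (\<forall>y' x'. fluid_solution lam beta eps gam y0 x0 y' x' \<longrightarrow>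
        (\<forall>t\<ge>0. y' t = y t \<and> x' t = x t)) \<and>
     {t. t \<ge> 0 \<and> \<not> regular_point y x t} \<in> null_sets lborel \<and>
     (AE \<omega> in M. \<forall>T\<ge>0. \<forall>e>0. \<forall>\<^sub>F r in at_top. \<forall>t\<in>{0..T}.
        \<bar>real_of_int (fst (Z r t \<omega>)) / r - y t\<bar> < e \<and>
        \<bar>(real (snd (Z r t \<omega>)) - lam * r / beta) / r - x t\<bar> < e)"
proof -
  interpret fluid_model lam beta eps gam by unfold_locales (use assms in auto)
  interpret P: prob_space clockM by (rule prob_space_clockM)
  define b where "b = x0 + lam / beta"
  have b: "b \<ge> 0" using assms(8) by (simp add: b_def)
  define Z where "Z r = fluid_chain.chain_process lam beta eps gam r (z0 r)" for r
  define Yb where "Yb r \<omega> t = real_of_int (fst (Z r t \<omega>)) / r" for r \<omega> t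
  define Xb where "Xb r \<omega> t = real (snd (Z r t \<omega>)) / r" for r \<omega> t
  have shift: "(x - lam * r / beta) / r = x / r - lam / beta" if "r > 0" for x r :: real
    using that by (simp add: diff_divide_distrib)
  have X0: "((\<lambda>r. real (snd (z0 r)) / r) \<longlongrightarrow> b) at_top"
  proof -
    have "((\<lambda>r. (real (snd (z0 r)) - lam * r / beta) / r + lam / beta) \<longlongrightarrow> x0 + lam / beta) at_top"
      by (intro tendsto_intros assms)
    then show ?thesis
      unfolding b_def by (rule Lim_transform_eventually)
        (use eventually_gt_at_top[of 0] in \<open>eventually_elim, simp add: shift\<close>)
  qed
  \<comment> \<open>This event mentions neither \<open>r\<close> nor \<open>T\<close> nor the
    accuracy, so one null set serves them all.\<close>
  define good where "good \<omega> \<longleftrightarrow> (\<forall>n. \<omega> n \<ge> 0) \<and> (\<forall>i. (\<lambda>m. ring_time \<omega> i m / m) \<longlonglongrightarrow> 1)" for \<omega>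
  have AE_good: "AE \<omega> in clockM. good \<omega>"
    unfolding good_def using AE_clock_nonneg ring_time_lln by eventually_elim simp
  have approx: "\<forall>\<^sub>F r in at_top. fluid_approx e T y0 b (Yb r \<omega>) (Xb r \<omega>)" if "good \<omega>" "T \<ge> 0" "e > 0" for \<omega> T e
    unfolding Yb_def Xb_def Z_def
    by (rule chain_eventually_fluid_approx) (use that assms X0 in \<open>auto simp: good_def\<close>)
  obtain \<omega> where \<omega>: "good \<omega>"
  proof (rule ccontr)
    assume "\<not> thesis"
    then have "\<not> good \<omega>" for \<omega> using that by blast
    then have "AE \<omega> in clockM. False" using AE_good by simp
    then show False by simp
  qed
  have "\<exists>Y X. fluid_approx (1 / Suc n) (real n) y0 b Y X" for n
    using eventually_happens[OF approx[OF \<omega>, of "real n" "1 / Suc n"]] by auto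
  then obtain Y X where "\<And>n. fluid_approx (1 / Suc n) (real n) y0 b (Y n) (X n)" by metis
  then obtain y x where exact: "\<And>T. fluid_approx 0 T y0 b y x" using fluid_exact_exists by blast
  define yF where "yF t = y (max 0 t)" for t
  define xF where "xF t = x (max 0 t) - lam / beta" for t
  have sol: "fluid_solution lam beta eps gam y0 x0 yF xF" and cont: "continuous_on UNIV yF" "continuous_on UNIV xF"
    using fluid_exact_solution[OF exact b] by (simp_all add: yF_def[abs_def] xF_def[abs_def] b_def)
  have conv: "\<forall>\<^sub>F r in at_top. \<forall>t\<in>{0..T}. \<bar>real_of_int (fst (Z r t \<omega>)) / r - yF t\<bar> < e \<and>
        \<bar>(real (snd (Z r t \<omega>)) - lam * r / beta) / r - xF t\<bar> < e" if \<omega>: "good \<omega>" and T: "T \<ge> 0" and e: "e > 0" for \<omega> T e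
  proof -
    \<comment> \<open>Chosen so that the stability bound becomes \<open>e / 2\<close>.\<close>
    define e' where "e' = e / (4 * exp (growth * T))"
    have e': "e' > 0" using e by (simp add: e'_def)
    from approx[OF \<omega> T e'] eventually_gt_at_top[of 0] show ?thesis
    proof eventually_elim
      case (elim r)
      show ?case
      proof
        fix t assume t: "t \<in> {0..T}"
        have "\<bar>Yb r \<omega> t - y t\<bar> + \<bar>Xb r \<omega> t - x t\<bar> \<le> 2 * (e' + 0) * exp (growth * T)"
          by (rule fluid_approx_stable[OF elim(1) exact t])
        also have "\<dots> < e" using e by (simp add: e'_def)
        finally have "\<bar>Yb r \<omega> t - y t\<bar> < e" "\<bar>Xb r \<omega> t - x t\<bar> < e" by linarith+
        then show "\<bar>real_of_int (fst (Z r t \<omega>)) / r - yF t\<bar> < e \<and>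
          \<bar>(real (snd (Z r t \<omega>)) - lam * r / beta) / r - xF t\<bar> < e"
          using t elim(2) by (simp add: Yb_def Xb_def yF_def xF_def shift)
      qed
    qed
  qed
  have ctmc: "is_ctmc clockM (transitions lam beta eps gam r) (z0 r) (Z r)" if "r > 0" for r
  proof -
    interpret ch: fluid_chain lam beta eps gam r by unfold_locales (use that in simp)
    show ?thesis unfolding Z_def ch.chain_process_def by (rule ch.is_ctmc_fluid_chain)
  qed
  have "{t. t \<ge> 0 \<and> \<not> regular_point yF xF t} \<in> null_sets lborel"
    by (rule nonregular_null_set[OF _ cont]) (use sol in \<open>auto simp: fluid_solution_def\<close>)
  moreover have "\<forall>y' x'. fluid_solution lam beta eps gam y0 x0 y' x' \<longrightarrow> (\<forall>t\<ge>0. y' t = yF t \<and> x' t = xF t)"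
    using fluid_solution_unique[OF _ sol] by blast
  moreover have "AE \<omega> in clockM. \<forall>T\<ge>0. \<forall>e>0. \<forall>\<^sub>F r in at_top. \<forall>t\<in>{0..T}.
        \<bar>real_of_int (fst (Z r t \<omega>)) / r - yF t\<bar> < e \<and>
        \<bar>(real (snd (Z r t \<omega>)) - lam * r / beta) / r - xF t\<bar> < e"
    using AE_good by eventually_elim (use conv in blast)
  ultimately show ?thesis
    using P.prob_space_axioms ctmc sol by blast
qed

end
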